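(* Let $\Theta_{(r)}=(0,\infty)^d\times[1,\infty]^d\times[2,\infty]$, $\Theta_{(c)}=(0,\infty)^d\times(0,\infty)$, $\Theta=\Theta_{(r)}\times\Theta_{(c)}$, and for $\vartheta=(\vec\beta,\vec r,q,\vec L,Q)\in\Theta$ let $$\mathcal F_\vartheta=\mathbb N_{\vec r,d}(\vec\beta,\vec L)\cap\mathbb B_q(Q).$$ Then optimally-adaptive estimators of the $\mathbb L_2$-norm of a density over the collection $\{\mathcal F_\vartheta,\ \vartheta\in\Theta\}$ do not exist; that is, there exist $\vartheta_1,\vartheta_2\in\Theta$ such that $$\liminf_{n\to\infty}\ \inf_{\widetilde N_n}\ \sup_{\vartheta\in\{\vartheta_1,\vartheta_2\}}\phi_n^{-1}(\mathcal F_\vartheta)\,\mathcal R_n\big[\widetilde N_n;\mathcal F_\vartheta\big]=\infty,$$ where the infimum is over all estimators.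
   Context: Model. $d\ge1$; one observes $X_1,\dots,X_n$ i.i.d. random vectors in $\mathbb R^d$ with density $f$ with respect to Lebesgue measure; $\mathbb E_f$ is expectation under the law of $(X_1,\dots,X_n)$. The functional to be estimated is $\|f\|_2$. An estimator $\widetilde N_n$ is any measurable real function of $(X_1,\dots,X_n)$. For a class $\mathbb F$ of functions (always understood as the probability densities with finite $\mathbb L_2$-norm belonging to it) put $\mathcal R_n[\widetilde N_n;\mathbb F]=\sup_{f\in\mathbb F}\big(\mathbb E_f[\widetilde N_n-\|f\|_2]^2\big)^{1/2}$. The minimax risk is $\inf_{\widetilde N_n}\mathcal R_n[\widetilde N_n;\mathbb F]$ and the minimax rate $\phi_n(\mathbb F)$ is the order at which it tends to zero as $n\to\infty$. Classes. $\mathbb B_q(Q)=\{f:\mathbb R^d\to\mathbb R:\ \|f\|_q\le Q\}$. Let $(e_1,\dots,e_d)$ be the canonical basis, $\Delta_{u,j}G(x)=G(x+ue_j)-G(x)$ and $\Delta^k_{u,j}=\Delta_{u,j}\Delta^{k-1}_{u,j}$. The anisotropic Nikolskii class $\mathbb N_{\vec r,d}(\vec\beta,\vec L)$ ($\vec\beta,\vec L\in(0,\infty)^d$, $\vec r\in[1,\infty]^d$) is the set of $G:\mathbb R^d\to\mathbb R$ such that $\|G\|_{r_j}\le L_j$ for all $j$ and there exist natural numbers $k_j>\beta_j$ with $\|\Delta^{k_j}_{u,j}G\|_{r_j}\le L_j|u|^{\beta_j}$ for all $u\in\mathbb R$, $j=1,\dots,d$. Minimax rates. With $\frac1\beta=\sum_j\frac1{\beta_j}$,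 $\frac1\omega=\sum_j\frac1{\beta_jr_j}$, $\tau(s)=1-\frac1\omega+\frac1{\beta s}$, $s\in[1,\infty]$, it is known that $\phi_n(\mathcal F_\vartheta)=n^{-\mathfrak z}$, where $\mathfrak z=\frac12\wedge\frac1{\tau(1)}$ if $\tau(2)\ge1$; $\mathfrak z=\frac{1-2/q}{2-2/q-\tau(q)}$ if $\tau(2)<1,\ \tau(q)<0$; $\mathfrak z=\frac12\wedge\frac{\tau(2)}{\tau(1)}$ if $\tau(2)<1,\ \tau(q)\ge0$. Standing convention: only classes are considered on which a rate-optimal estimator exists and the minimax risk is of exact order $\phi_n(\mathcal F_\vartheta)$ (in particular the class is non-empty). An optimally-adaptive estimator over $\{\mathcal F_\vartheta,\vartheta\in\Theta\}$ is an estimator $\widehat N_n$ not depending on $\vartheta$ with $\limsup_n\phi_n^{-1}(\mathcal F_\vartheta)\mathcal R_n[\widehat N_n;\mathcal F_\vartheta]<\infty$ for all $\vartheta\in\Theta$; the paper formally defines nonexistence as the existence of a pair $\vartheta_1,\vartheta_2$ with the property displayed in the claim. *)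

theory Defs
  imports "HOL-Probability.Probability"
begin

section \<open>Norms on functions of \<open>d\<close> real variables\<close>

text \<open>Integrability exponents in \<open>[1,\<infinity>]\<close> are of type \<^typ>\<open>ennreal\<close>, the value \<open>\<infinity>\<close> being allowed.
  The convention \<open>1/\<infinity> = 0\<close> is the one of \<^const>\<open>inverse\<close> on \<^typ>\<open>ennreal\<close>.\<close>

definition recip :: "ennreal \<Rightarrow> real" where
  "recip s = enn2real (inverse s)"

definition epowr :: "ennreal \<Rightarrow> real \<Rightarrow> ennreal" where
  "epowr x a = (if x = \<infinity> then \<infinity> else ennreal (enn2real x powr a))"

definition Lnorm :: "ennreal \<Rightarrow> (real ^ 'd \<Rightarrow> real) \<Rightarrow> ennreal" where
  "Lnorm s g =
     (if s = \<infinity> then esssup lborel (\<lambda>x. ennreal \<bar>g x\<bar>)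
      else epowr (\<integral>\<^sup>+x. ennreal (\<bar>g x\<bar> powr enn2real s) \<partial>lborel) (recip s))"


section \<open>Functional classes\<close>

definition fdiff :: "real \<Rightarrow> 'd \<Rightarrow> (real ^ 'd \<Rightarrow> real) \<Rightarrow> real ^ 'd \<Rightarrow> real" where
  "fdiff u j G = (\<lambda>x. G (x + u *\<^sub>R axis j 1) - G x)"

definition Lball :: "ennreal \<Rightarrow> real \<Rightarrow> (real ^ 'd \<Rightarrow> real) set" where
  "Lball q Q = {f \<in> borel_measurable lborel. Lnorm q f \<le> ennreal Q}"

definition nikolskii ::
    "('d \<Rightarrow> ennreal) \<Rightarrow> ('d \<Rightarrow> real) \<Rightarrow> ('d \<Rightarrow> real) \<Rightarrow> (real ^ 'd \<Rightarrow> real) set" where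
  "nikolskii r \<beta> L = {G \<in> borel_measurable lborel. \<forall>j.
      Lnorm (r j) G \<le> ennreal (L j) \<and>
      (\<exists>k::nat. real k > \<beta> j \<and>
         (\<forall>u::real. Lnorm (r j) ((fdiff u j ^^ k) G) \<le> ennreal (L j * \<bar>u\<bar> powr \<beta> j)))}"

record 'd params =
  smoothness :: "'d \<Rightarrow> real"
  integrab :: "'d \<Rightarrow> ennreal"
  qexp :: ennreal
  radius :: "'d \<Rightarrow> real"
  qbound :: real

definition Theta :: "('d::finite) params set" where
  "Theta = {\<theta>. (\<forall>j. 0 < smoothness \<theta> j) \<and> (\<forall>j. 1 \<le> integrab \<theta> j) \<and> 2 \<le> qexp \<theta> \<and>
                (\<forall>j. 0 < radius \<theta> j) \<and> 0 < qbound \<theta>}"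

definition fclass :: "('d::finite) params \<Rightarrow> (real ^ 'd \<Rightarrow> real) set" where
  "fclass \<theta> = nikolskii (integrab \<theta>) (smoothness \<theta>) (radius \<theta>) \<inter> Lball (qexp \<theta>) (qbound \<theta>)"


section \<open>Estimators and risks\<close>

definition L2_densities :: "(real ^ 'd \<Rightarrow> real) set" where
  "L2_densities = {f \<in> borel_measurable lborel.
      (\<forall>x. 0 \<le> f x) \<and> (\<integral>\<^sup>+x. ennreal (f x) \<partial>lborel) = 1 \<and> Lnorm 2 f < \<infinity>}"

definition sample_law :: "nat \<Rightarrow> (real ^ 'd \<Rightarrow> real) \<Rightarrow> (nat \<Rightarrow> real ^ 'd) measure" where
  "sample_law n f = (\<Pi>\<^sub>M i\<in>{1..n}. density lborel (\<lambda>x. ennreal (f x)))"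

definition estimators :: "nat \<Rightarrow> ((nat \<Rightarrow> real ^ 'd) \<Rightarrow> real) set" where
  "estimators n = borel_measurable (\<Pi>\<^sub>M i\<in>{1..n}. borel)"

text \<open>The mean squared error is a nonnegative integral, so that it takes the value \<open>\<infinity>\<close> when the
  error is not square integrable.\<close>

definition risk ::
    "nat \<Rightarrow> ((nat \<Rightarrow> real ^ 'd) \<Rightarrow> real) \<Rightarrow> (real ^ 'd \<Rightarrow> real) set \<Rightarrow> ennreal" where
  "risk n N F = (SUP f \<in> F \<inter> L2_densities.
      epowr (\<integral>\<^sup>+X. ennreal ((N X - enn2real (Lnorm 2 f))\<^sup>2) \<partial>sample_law n f) (1/2))"

definition minimax_risk :: "nat \<Rightarrow> (real ^ 'd \<Rightarrow> real) set \<Rightarrow> ennreal" where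
  "minimax_risk n F = (INF N \<in> estimators n. risk n N F)"


section \<open>Minimax rates\<close>

text \<open>In the next definition the two sums are \<open>1/\<omega>\<close> and \<open>1/\<beta>\<close>.\<close>

definition tau :: "('d::finite) params \<Rightarrow> ennreal \<Rightarrow> real" where
  "tau \<theta> s = 1 - (\<Sum>j\<in>UNIV. recip (integrab \<theta> j) / smoothness \<theta> j)
               + (\<Sum>j\<in>UNIV. 1 / smoothness \<theta> j) * recip s"

definition rate_exponent :: "('d::finite) params \<Rightarrow> real" where
  "rate_exponent \<theta> =
     (if tau \<theta> 2 \<ge> 1 then min (1/2) (1 / tau \<theta> 1)
      else if tau \<theta> (qexp \<theta>) < 0 then
        (1 - 2 * recip (qexp \<theta>)) / (2 - 2 * recip (qexp \<theta>) - tau \<theta> (qexp \<theta>))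
      else min (1/2) (tau \<theta> 2 / tau \<theta> 1))"

definition rate :: "('d::finite) params \<Rightarrow> nat \<Rightarrow> real" where
  "rate \<theta> n = real n powr (- rate_exponent \<theta>)"

text \<open>The standing convention on the classes under consideration: the minimax risk is of exact
  order \<open>\<phi> n\<close>, and some estimator attains this order. Such a class contains a density in
  \<open>L2_densities\<close>, since otherwise the supremum in \<open>risk\<close> would be over the empty set
  and equal to \<open>0\<close>.\<close>

definition has_minimax_rate :: "(real ^ 'd \<Rightarrow> real) set \<Rightarrow> (nat \<Rightarrow> real) \<Rightarrow> bool" where
  "has_minimax_rate F \<phi> \<longleftrightarrow>
     0 < liminf (\<lambda>n. minimax_risk n F / ennreal (\<phi> n)) \<and>
     limsup (\<lambda>n. minimax_risk n F / ennreal (\<phi> n)) < \<infinity> \<and>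
     (\<exists>N. (\<forall>n. N n \<in> estimators n) \<and> limsup (\<lambda>n. risk n (N n) F / ennreal (\<phi> n)) < \<infinity>)"

end

theory Submission
  imports Defs "HOL-Real_Asymp.Real_Asymp"
begin

text \<open>Take all \<open>r j = 2\<close>, \<open>q = \<infinity>\<close> and constant smoothness \<open>b \<le> 1/2\<close>. Then \<open>\<tau>(2) = 1\<close> and the rate
  is \<open>n powr (- z)\<close> with \<open>z = 2b / (2b + d)\<close>; the two classes are those with \<open>b = 1/2\<close> and \<open>b = 1/4\<close>.

  Upper bound: the estimator is the square root of a decoupled U-statistic of a cube kernel of width
  \<open>h\<close>. Its bias is \<open>1/2\<close> times an average of \<open>\<parallel>f(\<cdot> + w) - f\<parallel>\<^sup>2\<close> over the cube. Since the order \<open>k\<close>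
  of the differences in the Nikolskii class may depend on \<open>f\<close>, one needs a bound for first
  differences that is uniform in \<open>k\<close>. The numbers \<open>m i j = \<parallel>\<Delta>\<^sup>i (T + 1)\<^sup>j f\<parallel>\<^sup>2\<close>, where \<open>T\<close> is the
  translation by \<open>u\<close>, satisfy \<open>m (i+1) j + m i (j+1) = 4 m i j\<close>, so they are the moments of
  \<open>x\<^sup>i (4 - x)\<^sup>j\<close> under a measure on \<open>[0,4]\<close>, and passing from \<open>u\<close> to \<open>2u\<close> is the logistic map
  \<open>x \<mapsto> x (4 - x)\<close>. The pointwise inequality
  \<open>x \<le> x(4-x)/3 + 4 (x(4-x)/3)\<^sup>k + 4 (x/3)\<^sup>k\<close> then yields a recursion over dyadic scales.

  Lower bounds: the uniform density on a large cube, which lies in every class, is compared with the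
  mixture of the densities that double it on a random half of small paired cells. With \<open>2m\<close> cells the
  chi-square distance is at most \<open>exp (n\<^sup>2 / m)\<close>, and the two norms differ by the factor \<open>sqrt 2\<close>. For
  \<open>m\<close> of order \<open>n\<^sup>2\<close> this gives the minimax lower bound. An estimator that is rate optimal on the
  smoother class errs polynomially less at the uniform density, so \<open>m\<close> may be taken smaller by a
  factor of order \<open>ln n\<close>, and a logarithmic loss on the rougher class follows.\<close>

section \<open>Two-index moment arrays on an interval and an inequality for the logistic map\<close>

section \<open>Hausdorff moments\<close>

text \<open>The falling factorial \<open>x (x - 1) ... (x - p + 1)\<close>. The argument is real so
  that it can be compared with the power \<open>x ^ p\<close>; at a natural number below
  \<open>p\<close> it vanishes.\<close>

definition ffall :: "real \<Rightarrow> nat \<Rightarrow> real" where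
  "ffall x p = (\<Prod>i<p. x - real i)"

lemma ffall_of_nat:
  "ffall (real l) p = (if p \<le> l then fact l / fact (l - p) else 0)"
proof (cases "p \<le> l")
  case True
  then show ?thesis
  proof (induction p)
    case (Suc p)
    have "fact (l - p) = (real l - real p) * fact (l - Suc p)"
      using Suc.prems fact_reduce[of "l - p", where ?'a = real] by (simp add: of_nat_diff)
    moreover have "real l - real p \<noteq> 0" using Suc.prems by simp
    ultimately have "fact l / fact (l - p) * (real l - real p) = fact l / fact (l - Suc p)"
      by simp
    moreover have "ffall (real l) (Suc p) = ffall (real l) p * (real l - real p)"
      by (simp add: ffall_def)
    ultimately show ?case using Suc by simp
  qed (simp add: ffall_def)
next
  case False
  then have "l \<in> {..<p}" by simp
  then have "\<exists>i\<in>{..<p}. real l - real i = 0" by (intro bexI[of _ l]) auto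
  then show ?thesis using False unfolding ffall_def
    by (auto simp: prod_zero_iff)
qed

text \<open>The falling factorials cancel against the factorials of the binomial coefficient.
  Outside the range \<open>p \<le> l \<le> n - q\<close> one of the two falling factorials is zero,
  which explains the case distinction.\<close>

lemma choose_mult_ffall:
  assumes "l \<le> n" "p + q \<le> n"
  shows "real (n choose l) * (ffall l p * ffall (n - l) q) =
    (if p \<le> l \<and> l \<le> n - q then ffall n (p + q) * real ((n - p - q) choose (l - p)) else 0)"
proof (cases "p \<le> l \<and> l \<le> n - q")
  case True
  then have le: "l - p \<le> n - p - q" "q \<le> n - l" "p \<le> l" using assms by auto
  have a: "ffall (real l) p = fact l / fact (l - p)" using ffall_of_nat[of l p] le by simp
  have b: "ffall (real (n - l)) q = fact (n - l) / fact (n - l - q)"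
    using ffall_of_nat[of "n - l" q] le by simp
  have c: "ffall (real n) (p + q) = fact n / fact (n - p - q)"
    using ffall_of_nat[of n "p + q"] assms by simp
  have d: "real (n choose l) = fact n / (fact l * fact (n - l))"
    using binomial_fact[OF assms(1), where ?'a = real] .
  have e: "n - p - q - (l - p) = n - l - q" using True assms by auto
  have f: "real ((n - p - q) choose (l - p)) = fact (n - p - q) / (fact (l - p) * fact (n - l - q))"
    using binomial_fact[OF le(1), where ?'a = real] unfolding e .
  show ?thesis unfolding a b c d f using True by (simp add: divide_simps)
next
  case False
  then have "\<not> p \<le> l \<or> \<not> q \<le> n - l" using assms by auto
  then show ?thesis using False ffall_of_nat[of l p] ffall_of_nat[of "n - l" q] assms
    by (auto simp: of_nat_diff)
qed

text \<open>Iterate the recursion \<open>n\<close> times and collect terms by Pascal's rule. For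
  moments of \<open>x ^ i * (1 - x) ^ j\<close> this is multiplication by
  \<open>(x + (1 - x)) ^ n = 1\<close> under the integral.\<close>

lemma array_binomial_expansion:
  fixes \<mu> :: "nat \<Rightarrow> nat \<Rightarrow> real"
  assumes "\<And>i j. \<mu> i j = \<mu> (Suc i) j + \<mu> i (Suc j)"
  shows "\<mu> p q = (\<Sum>l\<le>n. real (n choose l) * \<mu> (p + l) (q + (n - l)))"
proof (induction n arbitrary: p q)
  case (Suc n)
  have "(\<Sum>l\<le>Suc n. real (Suc n choose l) * \<mu> (p + l) (q + (Suc n - l))) =
    \<mu> p (q + Suc n) + (\<Sum>l\<le>n. real (Suc n choose Suc l) * \<mu> (p + Suc l) (q + (n - l)))"
    by (subst sum.atMost_Suc_shift) simp
  also have "\<dots> = (\<mu> p (q + Suc n) + (\<Sum>l\<le>n. real (n choose Suc l) * \<mu> (p + Suc l) (q + (n - l))))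
      + (\<Sum>l\<le>n. real (n choose l) * \<mu> (p + Suc l) (q + (n - l)))"
    by (simp add: algebra_simps sum.distrib)
  also have "\<mu> p (q + Suc n) + (\<Sum>l\<le>n. real (n choose Suc l) * \<mu> (p + Suc l) (q + (n - l)))
     = (\<Sum>l\<le>Suc n. real (n choose l) * \<mu> (p + l) (q + (Suc n - l)))"
    by (subst sum.atMost_Suc_shift[of "\<lambda>l. real (n choose l) * \<mu> (p + l) (q + (Suc n - l))"]) simp
  also have "\<dots> = (\<Sum>l\<le>n. real (n choose l) * \<mu> (p + l) (Suc q + (n - l)))"
    by (simp add: Suc_diff_le)
  also have "\<dots> = \<mu> p (Suc q)" using Suc[of p "Suc q"] by simp
  also have "(\<Sum>l\<le>n. real (n choose l) * \<mu> (p + Suc l) (q + (n - l))) = \<mu> (Suc p) q"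
    using Suc[of "Suc p" q] by simp
  finally show ?case using assms[of p q] by simp
qed simp

text \<open>The weights \<open>(n choose l) * \<mu> l (n - l)\<close> have exact factorial moments:
  \<open>choose_mult_ffall\<close> pulls out \<open>ffall n (p + q)\<close>, and what remains is the
  expansion of \<open>\<mu> p q\<close> of order \<open>n - p - q\<close>.\<close>

lemma array_weights:
  fixes \<mu> :: "nat \<Rightarrow> nat \<Rightarrow> real"
  assumes "\<And>i j. \<mu> i j = \<mu> (Suc i) j + \<mu> i (Suc j)" and "p + q \<le> n"
  shows "(\<Sum>l\<le>n. real (n choose l) * \<mu> l (n - l) * (ffall l p * ffall (n - l) q))
    = ffall n (p + q) * \<mu> p q"
proof -
  let ?N = "n - p - q"
  have "(\<Sum>l\<le>n. real (n choose l) * \<mu> l (n - l) * (ffall l p * ffall (n - l) q)) =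
    (\<Sum>l\<le>n. if p \<le> l \<and> l \<le> n - q then ffall n (p + q) * real (?N choose (l - p)) * \<mu> l (n - l) else 0)"
  proof (intro sum.cong refl)
    fix l assume "l \<in> {..n}"
    then show "real (n choose l) * \<mu> l (n - l) * (ffall l p * ffall (n - l) q) =
      (if p \<le> l \<and> l \<le> n - q then ffall n (p + q) * real (?N choose (l - p)) * \<mu> l (n - l) else 0)"
      using choose_mult_ffall[of l n p q] assms(2) by (auto simp: algebra_simps)
  qed
  also have "\<dots> = (\<Sum>l\<in>{p..n-q}. ffall n (p + q) * real (?N choose (l - p)) * \<mu> l (n - l))"
    by (subst sum.inter_filter[symmetric]) (auto intro!: sum.cong)
  also have "\<dots> = (\<Sum>l\<le>?N. ffall n (p + q) * real (?N choose l) * \<mu> (p + l) (q + (?N - l)))"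
    using assms(2)
    by (intro sum.reindex_bij_witness[of _ "\<lambda>l. p + l" "\<lambda>l. l - p"]) (auto simp: algebra_simps)
  also have "\<dots> = ffall n (p + q) * \<mu> p q"
    by (subst array_binomial_expansion[of \<mu>, OF assms(1), of p q ?N]) (simp add: sum_distrib_left mult.assoc)
  finally show ?thesis .
qed

text \<open>After division by \<open>n ^ p\<close> both quantities are products of \<open>p\<close>
  factors of modulus at most 1, and corresponding factors differ by at most \<open>p / n\<close>.
  The difference of the products is bounded by the sum of these differences.\<close>

lemma ffall_pow_diff:
  assumes "0 \<le> x" "x \<le> real n" "p \<le> n" "0 < n"
  shows "\<bar>ffall x p / real n ^ p - (x / n) ^ p\<bar> \<le> real p * real p / n"
    and "\<bar>ffall x p / real n ^ p\<bar> \<le> 1"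
proof -
  have e: "ffall x p / real n ^ p = (\<Prod>i<p. (x - real i) / n)"
    by (simp add: ffall_def prod_dividef)
  have b: "\<bar>(x - real i) / n\<bar> \<le> 1" if "i < p" for i
    using assms that by (auto simp: divide_simps abs_le_iff)
  have b': "\<bar>x / n\<bar> \<le> 1" using assms by (auto simp: divide_simps)
  have "\<bar>(\<Prod>i<p. (x - real i) / n) - (\<Prod>i<p. x / n)\<bar> \<le> (\<Sum>i<p. \<bar>(x - real i) / n - x / n\<bar>)"
    using norm_prod_diff[of "{..<p}" "\<lambda>i. (x - real i) / n" "\<lambda>i. x / n"] b b' by auto
  also have "\<dots> \<le> (\<Sum>i<p. real p / n)"
    using assms by (intro sum_mono) (auto simp: diff_divide_distrib divide_right_mono)
  finally show "\<bar>ffall x p / real n ^ p - (x / n) ^ p\<bar> \<le> real p * real p / n"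
    by (simp add: e)
  show "\<bar>ffall x p / real n ^ p\<bar> \<le> 1"
    unfolding e abs_prod by (rule prod_le_1) (use b in auto)
qed

text \<open>The weights \<open>(n choose l) * \<mu> l (n - l)\<close> placed at the points \<open>l / n\<close> are the
  approximating measures in Hausdorff's moment problem.\<close>

lemma array_hausdorff_limit:
  fixes \<mu> :: "nat \<Rightarrow> nat \<Rightarrow> real"
  assumes rec: "\<And>i j. \<mu> i j = \<mu> (Suc i) j + \<mu> i (Suc j)" and nonneg: "\<And>i j. 0 \<le> \<mu> i j"
  shows "(\<lambda>n. \<Sum>l\<le>n. real (n choose l) * \<mu> l (n - l) * ((l / n) ^ p * (1 - l / n) ^ q)) \<longlonglongrightarrow> \<mu> p q"
proof -
  let ?w = "\<lambda>n l. real (n choose l) * \<mu> l (n - l)"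
  let ?A = "\<lambda>n. \<Sum>l\<le>n. ?w n l * ((l / n) ^ p * (1 - l / n) ^ q)"
  let ?B = "\<lambda>n. ffall n (p + q) / real n ^ (p + q) * \<mu> p q"
  have W: "(\<Sum>l\<le>n. ?w n l) = \<mu> 0 0" for n
    using array_binomial_expansion[of \<mu>, OF rec, of 0 0 n] by simp
  \<comment> \<open>\<open>?B n\<close> is the exact factorial moment of the weights,
    \<open>?A n\<close> their power moment. The difference is of order \<open>1 / n\<close> because
    the total mass of the weights is \<open>\<mu> 0 0\<close> for every \<open>n\<close>.\<close>
  have diff: "\<bar>?A n - ?B n\<bar> \<le> \<mu> 0 0 * ((real p * real p + real q * real q) / n)" if n: "n \<ge> p + q" "n > 0" for n
  proof -
    have "?B n = (\<Sum>l\<le>n. ?w n l * ((ffall l p / real n ^ p) * (ffall (n - l) q / real n ^ q)))"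
      using array_weights[of \<mu>, OF rec n(1)] 
      by (simp add: power_add sum_divide_distrib[symmetric] mult.assoc[symmetric])
    then have "\<bar>?A n - ?B n\<bar> = \<bar>\<Sum>l\<le>n. ?w n l * ((l / n) ^ p * (1 - l / n) ^ q
        - (ffall l p / real n ^ p) * (ffall (n - l) q / real n ^ q))\<bar>"
      by (simp add: right_diff_distrib sum_subtractf)
    also have "\<dots> \<le> (\<Sum>l\<le>n. ?w n l * ((real p * real p + real q * real q) / n))"
    proof (rule order_trans[OF sum_abs], rule sum_mono)
      fix l assume "l \<in> {..n}"
      then have l: "l \<le> n" by simp
      define a where "a = (real l / n) ^ p"
      define b where "b = (1 - real l / n) ^ q"
      define a' where "a' = ffall l p / real n ^ p"
      define b' where "b' = ffall (n - l) q / real n ^ q"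
      have 1: "\<bar>a' - a\<bar> \<le> real p * real p / n" 
        using ffall_pow_diff(1)[of "real l" n p] n l by (simp add: a_def a'_def)
      have 2: "\<bar>b' - b\<bar> \<le> real q * real q / n" "\<bar>b'\<bar> \<le> 1"
        using ffall_pow_diff[of "real (n - l)" n q] n l 
        by (simp_all add: b_def b'_def of_nat_diff diff_divide_distrib)
      have 3: "\<bar>a\<bar> \<le> 1" using l n by (auto simp: a_def power_abs intro!: power_le_one)
      have "\<bar>a * b - a' * b'\<bar> = \<bar>a * (b - b') + (a - a') * b'\<bar>" by (simp add: algebra_simps)
      also have "\<dots> \<le> \<bar>a\<bar> * \<bar>b - b'\<bar> + \<bar>a - a'\<bar> * \<bar>b'\<bar>" by (metis abs_mult abs_triangle_ineq)
      also have "\<dots> \<le> 1 * \<bar>b - b'\<bar> + \<bar>a - a'\<bar> * 1"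
        by (intro add_mono mult_mono) (use 2 3 in auto)
      also have "\<dots> \<le> (real p * real p + real q * real q) / n"
        using 1 2 by (simp add: add_divide_distrib abs_minus_commute)
      finally have B: "\<bar>a * b - a' * b'\<bar> \<le> (real p * real p + real q * real q) / n" .
      have Wn: "0 \<le> ?w n l" using nonneg by simp
      show "\<bar>?w n l * ((l / n) ^ p * (1 - l / n) ^ q
        - (ffall l p / real n ^ p) * (ffall (n - l) q / real n ^ q))\<bar>
        \<le> ?w n l * ((real p * real p + real q * real q) / n)"
      proof -
        have "\<bar>?w n l * (a * b - a' * b')\<bar> = ?w n l * \<bar>a * b - a' * b'\<bar>"
          by (simp only: abs_mult[of "?w n l"] abs_of_nonneg[OF Wn])
        also have "\<dots> \<le> ?w n l * ((real p * real p + real q * real q) / n)"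
          by (rule mult_left_mono[OF B Wn])
        finally show ?thesis by (simp only: a_def b_def a'_def b'_def)
      qed
    qed
    also have "\<dots> = (\<Sum>l\<le>n. ?w n l) * ((real p * real p + real q * real q) / n)"
      by (rule sum_distrib_right[symmetric])
    also have "\<dots> = \<mu> 0 0 * ((real p * real p + real q * real q) / n)"
      unfolding W ..
    finally show ?thesis .
  qed
  have lim0: "(\<lambda>n. \<mu> 0 0 * ((real p * real p + real q * real q) / real n)) \<longlonglongrightarrow> 0"
    using tendsto_mult_right_zero[OF lim_const_over_n] by blast
  have "(\<lambda>n. ?A n - ?B n) \<longlonglongrightarrow> 0"
    by (rule Lim_null_comparison[OF _ lim0])
       (use diff in \<open>auto intro!: eventually_sequentiallyI[of "Suc (p + q)"]\<close>)
  moreover have "?B \<longlonglongrightarrow> \<mu> p q"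
  proof -
    have lim1: "(\<lambda>n. (real (p + q) * real (p + q)) / real n) \<longlonglongrightarrow> 0"
      by (rule lim_const_over_n)
    have "(\<lambda>n. ffall n (p + q) / real n ^ (p + q) - 1) \<longlonglongrightarrow> 0"
    proof (rule Lim_null_comparison[OF _ lim1], rule eventually_sequentiallyI[of "Suc (p + q)"])
      fix n assume "Suc (p + q) \<le> n"
      then show "norm (ffall n (p + q) / real n ^ (p + q) - 1) \<le> real (p + q) * real (p + q) / real n"
        using ffall_pow_diff(1)[of "real n" n "p + q"] by simp
    qed
    then have "(\<lambda>n. ffall n (p + q) / real n ^ (p + q)) \<longlonglongrightarrow> 1" by (simp add: LIM_zero_iff)
    from tendsto_mult[OF this tendsto_const[of "\<mu> p q"]] show ?thesis by simp
  qed
  ultimately have "(\<lambda>n. (?A n - ?B n) + ?B n) \<longlonglongrightarrow> 0 + \<mu> p q" by (rule tendsto_add)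
  then show ?thesis by simp
qed

text \<open>With \<open>x = 4 * y\<close> and \<open>z = x * (4 - x)\<close>, a single term on the
  right suffices on each range: \<open>z / 3\<close> for \<open>x \<le> 1\<close>;
  \<open>4 * (z / 3) ^ k\<close> for \<open>1 \<le> x \<le> 3\<close>, where
  \<open>z \<ge> 3\<close>; and \<open>4 * (x / 3) ^ k\<close> for \<open>x \<ge> 3\<close>. The
  last two are at least 4 on their ranges.\<close>

lemma logistic_ineq:
  fixes y :: real
  assumes "0 \<le> y" "y \<le> 1" "0 < k"
  shows "4 * y \<le> 16 * (y * (1 - y)) / 3 + 4 / 3 ^ k * (16 ^ k * (y ^ k * (1 - y) ^ k) + 4 ^ k * y ^ k)"
proof -
  define x where "x = 4 * y"
  define z where "z = x * (4 - x)"
  have x: "0 \<le> x" "x \<le> 4" "0 \<le> z" using assms by (auto simp: x_def z_def)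
  have "16 * (y * (1 - y)) / 3 + 4 / 3 ^ k * (16 ^ k * (y ^ k * (1 - y) ^ k) + 4 ^ k * y ^ k)
     = z / 3 + 4 * (z / 3) ^ k + 4 * (x / 3) ^ k"
  proof -
    have "z = 16 * (y * (1 - y))" by (simp add: z_def x_def algebra_simps)
    then have "16 * (y * (1 - y)) / 3 = z / 3" "16 ^ k * (y ^ k * (1 - y) ^ k) = z ^ k"
      by (simp_all only: power_mult_distrib)
    moreover have "4 ^ k * y ^ k = x ^ k"
      by (simp add: power_mult_distrib x_def)
    ultimately show ?thesis by (simp only: power_divide) (simp add: field_simps)
  qed
  moreover have "x \<le> z / 3 + 4 * (z / 3) ^ k + 4 * (x / 3) ^ k"
  proof -
    consider "x \<le> 1" | "1 \<le> x" "x \<le> 3" | "3 \<le> x" by linarith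
    then show ?thesis
    proof cases
      case 1
      then have "x * 3 \<le> z" unfolding z_def by (intro mult_left_mono) (use x in auto)
      moreover have "0 \<le> (z / 3) ^ k" "0 \<le> (x / 3) ^ k" using x by auto
      ultimately show ?thesis by linarith
    next
      case 2
      have "0 \<le> (x - 1) * (3 - x)" using 2 by simp
      then have "3 \<le> z" by (simp add: z_def algebra_simps)
      then have "1 \<le> (z / 3) ^ k" by (intro one_le_power) simp
      moreover have "0 \<le> (x / 3) ^ k" using x by auto
      ultimately show ?thesis using 2 x by linarith
    next
      case 3
      then have "1 \<le> (x / 3) ^ k" by (intro one_le_power) simp
      moreover have "0 \<le> (z / 3) ^ k" using x by auto
      ultimately show ?thesis using x by linarith
    qed
  qed
  ultimately show ?thesis by (simp add: x_def)
qed

text \<open>Division by \<open>4 ^ (i + j)\<close> turns the recursion into that of moments on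
  \<open>[0,1]\<close>. The inequality \<open>logistic_ineq\<close> is summed against the discrete
  weights and carried to the limit, so these weights stand in for the measure itself.\<close>

lemma parallelogram_array_bound:
  fixes m :: "nat \<Rightarrow> nat \<Rightarrow> real"
  assumes rec: "\<And>i j. m (Suc i) j + m i (Suc j) = 4 * m i j" and nonneg: "\<And>i j. 0 \<le> m i j"
    and k: "0 < k"
  shows "m 1 0 \<le> m 1 1 / 3 + 4 / 3 ^ k * (m k k + m k 0)"
proof -
  define \<mu> where "\<mu> = (\<lambda>i j. m i j / 4 ^ (i + j))"
  have rec': "\<mu> i j = \<mu> (Suc i) j + \<mu> i (Suc j)" for i j
    using rec[of i j] by (simp add: \<mu>_def field_simps)
  have nonneg': "0 \<le> \<mu> i j" for i j using nonneg by (simp add: \<mu>_def)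
  let ?w = "\<lambda>n l. real (n choose l) * \<mu> l (n - l)"
  let ?S = "\<lambda>p q n. \<Sum>l\<le>n. ?w n l * ((l / n) ^ p * (1 - l / n) ^ q)"
  note lim = array_hausdorff_limit[of \<mu>, OF rec' nonneg']
  have "(\<lambda>n. 16 * ?S 1 1 n / 3 + 4 / 3 ^ k * (16 ^ k * ?S k k n + 4 ^ k * ?S k 0 n) - 4 * ?S 1 0 n)
    \<longlonglongrightarrow> 16 * \<mu> 1 1 / 3 + 4 / 3 ^ k * (16 ^ k * \<mu> k k + 4 ^ k * \<mu> k 0) - 4 * \<mu> 1 0"
    by (intro tendsto_intros lim) auto
  moreover have "0 \<le> 16 * ?S 1 1 n / 3 + 4 / 3 ^ k * (16 ^ k * ?S k k n + 4 ^ k * ?S k 0 n) - 4 * ?S 1 0 n" for n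
  proof -
    have "4 * ?S 1 0 n = (\<Sum>l\<le>n. ?w n l * (4 * (l / n)))"
      by (simp add: sum_distrib_left algebra_simps)
    also have "\<dots> \<le> (\<Sum>l\<le>n. ?w n l * (16 * ((l / n) * (1 - (l / n))) / 3 
        + 4 / 3 ^ k * (16 ^ k * ((l / n) ^ k * (1 - (l / n)) ^ k) + 4 ^ k * (l / n) ^ k)))"
      by (intro sum_mono mult_left_mono logistic_ineq mult_nonneg_nonneg nonneg' k)
         (auto simp: divide_simps)
    also have "\<dots> = 16 * ?S 1 1 n / 3 + 4 / 3 ^ k * (16 ^ k * ?S k k n + 4 ^ k * ?S k 0 n)"
      by (simp add: sum_distrib_left sum_distrib_right distrib_left sum.distrib sum_divide_distrib
          mult.left_commute mult.assoc)
    finally show ?thesis by simp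
  qed
  ultimately have "0 \<le> 16 * \<mu> 1 1 / 3 + 4 / 3 ^ k * (16 ^ k * \<mu> k k + 4 ^ k * \<mu> k 0) - 4 * \<mu> 1 0"
    by (intro LIMSEQ_le_const[where a=0]) auto
  moreover have "(16::real) ^ k = 4 ^ (k + k)" by (simp add: power_add power_mult_distrib[symmetric])
  ultimately show ?thesis by (simp add: \<mu>_def)
qed


section \<open>Squared \<open>L2\<close> norms of differences of arbitrary order\<close>

section \<open>First differences controlled by higher differences\<close>

text \<open>The squared \<open>L2\<close> norm, kept in \<open>ennreal\<close> so that the
  identities below also make sense when it is infinite.\<close>

definition sq_int :: "(real ^ 'd \<Rightarrow> real) \<Rightarrow> ennreal" where
  "sq_int g = (\<integral>\<^sup>+x. ennreal ((g x)\<^sup>2) \<partial>lborel)"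

lemma recip_2: "recip 2 = 1 / 2"
proof -
  have "recip 2 = enn2real (inverse (ennreal 2))" unfolding recip_def ennreal_numeral ..
  also have "inverse (ennreal 2) = ennreal (inverse 2)" by (rule inverse_ennreal) simp
  also have "enn2real (ennreal (inverse 2)) = inverse 2" by (rule enn2real_ennreal) simp
  finally show ?thesis by simp
qed

lemma recip_1: "recip 1 = 1"
  by (simp add: recip_def)

lemma Lnorm_2: "Lnorm 2 g = epowr (sq_int g) (1 / 2)"
  by (simp add: Lnorm_def recip_2 sq_int_def)

lemma epowr_half_le_iff:
  assumes "0 \<le> c"
  shows "epowr x (1 / 2) \<le> ennreal c \<longleftrightarrow> x \<le> ennreal (c\<^sup>2)"
proof (cases x)
  case (real r)
  have "sqrt r \<le> c \<longleftrightarrow> r \<le> c\<^sup>2"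
    using assms real by (auto simp: real_le_lsqrt sqrt_le_D)
  then show ?thesis using real assms
    by (simp add: epowr_def powr_half_sqrt)
qed (simp add: epowr_def top_unique)

lemma enn2real_Lnorm_2: "enn2real (Lnorm 2 g) = sqrt (enn2real (sq_int g))"
proof (cases "sq_int g")
  case (real r)
  then show ?thesis by (simp add: Lnorm_2 epowr_def powr_half_sqrt)
qed (simp add: Lnorm_2 epowr_def)

lemma Lnorm_top_le_iff:
  assumes [measurable]: "g \<in> borel_measurable borel" and "0 \<le> c"
  shows "Lnorm \<infinity> g \<le> ennreal c \<longleftrightarrow> (AE x in lborel. \<bar>g x\<bar> \<le> c)"
proof
  assume "Lnorm \<infinity> g \<le> ennreal c"
  then have "esssup lborel (\<lambda>x. ennreal \<bar>g x\<bar>) \<le> ennreal c" by (simp add: Lnorm_def)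
  then have "AE x in lborel. ennreal \<bar>g x\<bar> \<le> ennreal c"
    by (intro eventually_mono[OF esssup_AE[of "\<lambda>x. ennreal \<bar>g x\<bar>" lborel]]) (rule order_trans)
  then show "AE x in lborel. \<bar>g x\<bar> \<le> c" using assms by simp
next
  assume "AE x in lborel. \<bar>g x\<bar> \<le> c"
  then have "AE x in lborel. ennreal \<bar>g x\<bar> \<le> ennreal c"
    by eventually_elim (simp add: ennreal_leI)
  then show "Lnorm \<infinity> g \<le> ennreal c"
    by (simp add: Lnorm_def esssup_I)
qed

lemma nn_integral_lborel_shift:
  fixes f :: "'a::euclidean_space \<Rightarrow> ennreal"
  assumes [measurable]: "f \<in> borel_measurable borel"
  shows "(\<integral>\<^sup>+x. f (x + c) \<partial>lborel) = (\<integral>\<^sup>+x. f x \<partial>lborel)"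
proof -
  have "(\<integral>\<^sup>+x. f x \<partial>lborel) = (\<integral>\<^sup>+x. f x \<partial>distr lborel borel ((+) c))"
    by (simp only: lborel_distr_plus)
  also have "\<dots> = (\<integral>\<^sup>+x. f (c + x) \<partial>lborel)"
    by (subst nn_integral_distr) auto
  finally show ?thesis by (simp add: add.commute)
qed

text \<open>The operator \<open>T + 1\<close>, where \<open>T\<close> is the translation by
  \<open>u\<close> along axis \<open>j\<close>. It is the companion of \<open>fdiff u j\<close>,
  which is \<open>T - 1\<close>.\<close>

definition fplus :: "real \<Rightarrow> 'd \<Rightarrow> (real ^ 'd \<Rightarrow> real) \<Rightarrow> real ^ 'd \<Rightarrow> real" where
  "fplus u j G = (\<lambda>x. G (x + u *\<^sub>R axis j 1) + G x)"

lemma measurable_fdiff[measurable]: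
  assumes [measurable]: "g \<in> borel_measurable borel"
  shows "fdiff u j g \<in> borel_measurable borel"
  unfolding fdiff_def by measurable

lemma measurable_fplus[measurable]:
  assumes [measurable]: "g \<in> borel_measurable borel"
  shows "fplus u j g \<in> borel_measurable borel"
  unfolding fplus_def by measurable

lemma measurable_fdiff_pow[measurable]: 
  "g \<in> borel_measurable borel \<Longrightarrow> (fdiff u j ^^ i) g \<in> borel_measurable borel"
  by (induction i) auto

lemma measurable_fplus_pow[measurable]: 
  "g \<in> borel_measurable borel \<Longrightarrow> (fplus u j ^^ i) g \<in> borel_measurable borel"
  by (induction i) auto

text \<open>The cross terms of the two squares cancel pointwise, and by translation invariance the
  shifted square has the same integral. This is the source of the moment recursion.\<close>

lemma sq_int_parallelogram:
  assumes [measurable]: "g \<in> borel_measurable borel"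
  shows "sq_int (fdiff u j g) + sq_int (fplus u j g) = 4 * sq_int g"
proof -
  let ?v = "u *\<^sub>R axis j 1"
  have "sq_int (fdiff u j g) + sq_int (fplus u j g)
     = (\<integral>\<^sup>+x. ennreal ((g (x + ?v) - g x)\<^sup>2) + ennreal ((g (x + ?v) + g x)\<^sup>2) \<partial>lborel)"
    unfolding sq_int_def fdiff_def fplus_def by (subst nn_integral_add) auto
  also have "\<dots> = (\<integral>\<^sup>+x. 2 * ennreal ((g (x + ?v))\<^sup>2) + 2 * ennreal ((g x)\<^sup>2) \<partial>lborel)"
  proof (intro nn_integral_cong)
    fix x
    have eq: "ennreal ((a - b)\<^sup>2) + ennreal ((a + b)\<^sup>2) = 2 * ennreal (a\<^sup>2) + 2 * ennreal (b\<^sup>2)" for a b :: real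
    proof -
      have "ennreal ((a - b)\<^sup>2) + ennreal ((a + b)\<^sup>2) = ennreal ((a - b)\<^sup>2 + (a + b)\<^sup>2)"
        by (rule ennreal_plus[symmetric]) auto
      also have "(a - b)\<^sup>2 + (a + b)\<^sup>2 = 2 * a\<^sup>2 + 2 * b\<^sup>2"
        by (simp add: power2_eq_square algebra_simps)
      also have "ennreal \<dots> = ennreal (2 * a\<^sup>2) + ennreal (2 * b\<^sup>2)"
        by (rule ennreal_plus) auto
      finally show ?thesis by (simp only: ennreal_mult ennreal_numeral zero_le_power2 zero_le_numeral)
    qed
    show "ennreal ((g (x + ?v) - g x)\<^sup>2) + ennreal ((g (x + ?v) + g x)\<^sup>2)
       = 2 * ennreal ((g (x + ?v))\<^sup>2) + 2 * ennreal ((g x)\<^sup>2)"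
      by (rule eq)
  qed
  also have "\<dots> = 2 * sq_int g + 2 * sq_int g"
    unfolding sq_int_def using nn_integral_lborel_shift[of "\<lambda>x. ennreal ((g x)\<^sup>2)" ?v]
    by (subst nn_integral_add) (auto simp: nn_integral_cmult)
  also have "\<dots> = 4 * sq_int g"
    by (simp add: distrib_right[symmetric])
  finally show ?thesis .
qed

lemma fdiff_fplus_commute: "fdiff u j (fplus u j g) = fplus u j (fdiff u j g)"
  by (simp add: fdiff_def fplus_def fun_eq_iff algebra_simps)

lemma fdiff_pow_fplus_commute: "(fdiff u j ^^ i) (fplus u j g) = fplus u j ((fdiff u j ^^ i) g)"
  by (induction i) (auto simp: fdiff_fplus_commute)

text \<open>The factorisation \<open>T^2 - 1 = (T - 1) (T + 1)\<close> for the translation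
  \<open>T\<close> by \<open>u\<close>.\<close>

lemma fdiff_double: "fdiff (2 * u) j g = fdiff u j (fplus u j g)"
  by (simp add: fdiff_def fplus_def fun_eq_iff algebra_simps scaleR_2[symmetric])

lemma fdiff_pow_double: "(fdiff (2 * u) j ^^ k) g = (fdiff u j ^^ k) ((fplus u j ^^ k) g)"
  by (induction k) (auto simp: fdiff_double fdiff_pow_fplus_commute)

lemma sq_int_array_finite:
  assumes "g \<in> borel_measurable borel" "sq_int g < \<infinity>"
  shows "sq_int (fdiff u j g) < \<infinity>" "sq_int (fplus u j g) < \<infinity>"
proof -
  have "4 * sq_int g < \<infinity>" using assms(2) by (simp add: ennreal_mult_less_top)
  then have *: "sq_int (fdiff u j g) + sq_int (fplus u j g) < \<infinity>"
    by (subst sq_int_parallelogram[OF assms(1)])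
  then show "sq_int (fdiff u j g) < \<infinity>" "sq_int (fplus u j g) < \<infinity>"
    by simp_all
qed

lemma sq_int_fplus_pow_finite:
  "g \<in> borel_measurable borel \<Longrightarrow> sq_int g < \<infinity> \<Longrightarrow> sq_int ((fplus u j ^^ i) g) < \<infinity>"
  by (induction i) (auto intro!: sq_int_array_finite[simplified])

lemma sq_int_fdiff_pow_finite:
  "g \<in> borel_measurable borel \<Longrightarrow> sq_int g < \<infinity> \<Longrightarrow> sq_int ((fdiff u j ^^ i) g) < \<infinity>"
  by (induction i) (auto intro!: sq_int_array_finite[simplified])

text \<open>The constant does not depend on the order \<open>k\<close> of the differences; this matters because the
  order in the definition of the Nikolskii class may vary with the function.\<close>

lemma fdiff_bound_of_fdiff_pow:
  fixes f :: "real ^ 'd \<Rightarrow> real"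
  assumes f[measurable]: "f \<in> borel_measurable borel" and fin: "sq_int f < \<infinity>"
    and k: "0 < k" and b: "0 < b" "b \<le> 1 / 2" and A: "0 \<le> A"
    and bound: "\<And>u. sq_int ((fdiff u j ^^ k) f) \<le> ennreal (A * \<bar>u\<bar> powr (2 * b))"
  shows "sq_int (fdiff u j f) \<le> ennreal (12 * A * \<bar>u\<bar> powr (2 * b))"
proof -
  define D where "D = (\<lambda>u. enn2real (sq_int (fdiff u j f)))"
  define M where "M = enn2real (sq_int f)"
  \<comment> \<open>The array \<open>m\<close> collects the mixed differences and sums of
    \<open>f\<close> at step \<open>u\<close>. By the doubling identities \<open>m 1 1\<close> and
    \<open>m k k\<close> belong to step \<open>2 * u\<close>, so the array inequality links the
    scales \<open>u\<close> and \<open>2 * u\<close>.\<close>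
  have step: "D u \<le> D (2 * u) / 3 + 4 * A * \<bar>u\<bar> powr (2 * b)" for u
  proof -
    define m where "m = (\<lambda>i l. enn2real (sq_int ((fdiff u j ^^ i) ((fplus u j ^^ l) f))))"
    have finm: "sq_int ((fdiff u j ^^ i) ((fplus u j ^^ l) f)) < \<infinity>" for i l
      by (intro sq_int_fdiff_pow_finite sq_int_fplus_pow_finite measurable_fplus_pow f fin)
    have rec: "m (Suc i) l + m i (Suc l) = 4 * m i l" for i l
    proof -
      let ?g = "(fdiff u j ^^ i) ((fplus u j ^^ l) f)"
      have "m (Suc i) l + m i (Suc l) = enn2real (sq_int (fdiff u j ?g) + sq_int (fplus u j ?g))"
      proof -
        have e: "(fdiff u j ^^ Suc i) ((fplus u j ^^ l) f) = fdiff u j ?g"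
          "(fdiff u j ^^ i) ((fplus u j ^^ Suc l) f) = fplus u j ?g"
          by (simp_all only: funpow.simps comp_apply fdiff_pow_fplus_commute)
        show ?thesis
          unfolding m_def e using finm[of "Suc i" l] finm[of i "Suc l"] unfolding e
          by (intro enn2real_plus[symmetric]) auto
      qed
      also have "\<dots> = enn2real (4 * sq_int ?g)"
        by (subst sq_int_parallelogram) (intro measurable_fdiff_pow measurable_fplus_pow f, rule refl)
      finally show ?thesis by (simp add: m_def enn2real_mult)
    qed
    have "m 1 0 \<le> m 1 1 / 3 + 4 / 3 ^ k * (m k k + m k 0)"
      by (rule parallelogram_array_bound[of m, OF rec _ k]) (simp add: m_def)
    moreover have "m 1 0 = D u" "m 1 1 = D (2 * u)"
      by (simp_all add: m_def D_def fdiff_double)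
    moreover have "m k k \<le> A * \<bar>2 * u\<bar> powr (2 * b)"
      using bound[of "2 * u"] A unfolding m_def fdiff_pow_double[symmetric]
      by (intro enn2real_leI) auto
    moreover have "m k 0 \<le> A * \<bar>u\<bar> powr (2 * b)"
      using bound[of "u"] A unfolding m_def by (intro enn2real_leI) auto
    \<comment> \<open>Since \<open>2 * b \<le> 1\<close>, doubling the step at most doubles the
      bound. The last two terms of the array inequality then contribute the factor
      \<open>4 / 3 ^ k * (2 + 1)\<close>, which is at most 4.\<close>
    moreover have "\<bar>2 * u\<bar> powr (2 * b) \<le> 2 * \<bar>u\<bar> powr (2 * b)"
    proof -
      have "2 powr (2 * b) \<le> 2 powr (1::real)" using b by (intro powr_mono) auto
      then show ?thesis by (simp add: abs_mult powr_mult mult_right_mono)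
    qed
    ultimately have "D u \<le> D (2 * u) / 3 + 4 / 3 ^ k * (A * (2 * \<bar>u\<bar> powr (2 * b)) + A * \<bar>u\<bar> powr (2 * b))"
      using A by (smt (verit) mult_left_mono divide_nonneg_pos zero_less_power)
    also have "\<dots> = D (2 * u) / 3 + 1 / 3 ^ k * (12 * A * \<bar>u\<bar> powr (2 * b))"
      by simp
    also have "\<dots> \<le> D (2 * u) / 3 + 1 / 3 * (12 * A * \<bar>u\<bar> powr (2 * b))"
    proof -
      have "(1 / 3) ^ k \<le> (1 / 3 :: real) ^ 1" using k by (intro power_decreasing) auto
      then show ?thesis using A by (intro add_left_mono mult_right_mono) (auto simp: power_one_over)
    qed
    finally show ?thesis by simp
  qed
  \<comment> \<open>The constant 12 is the fixed point of the recursion: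
    \<open>12 * 2 / 3 + 4 = 12\<close>. The trivial bound \<open>4 * M\<close> is divided by 3 at
    each doubling and disappears as \<open>J\<close> grows.\<close>
  have bd: "D u \<le> 12 * A * \<bar>u\<bar> powr (2 * b) + 4 * M * (1 / 3) ^ J" for J u
  proof (induction J arbitrary: u)
    case 0
    have "D u \<le> enn2real (sq_int (fdiff u j f) + sq_int (fplus u j f))"
      unfolding D_def using sq_int_array_finite[OF f fin, of u j] by (intro enn2real_mono) auto
    also have "\<dots> = 4 * M" by (subst sq_int_parallelogram) (auto simp: M_def enn2real_mult)
    finally show ?case using A by simp (smt (verit) powr_ge_zero mult_nonneg_nonneg)
  next
    case (Suc J)
    have "\<bar>2 * u\<bar> powr (2 * b) \<le> 2 * \<bar>u\<bar> powr (2 * b)"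
    proof -
      have "2 powr (2 * b) \<le> 2 powr (1::real)" using b by (intro powr_mono) auto
      then show ?thesis by (simp add: abs_mult powr_mult mult_right_mono)
    qed
    then have "12 * A * \<bar>2 * u\<bar> powr (2 * b) \<le> 12 * A * (2 * \<bar>u\<bar> powr (2 * b))"
      using A by (intro mult_left_mono) auto
    with Suc[of "2 * u"] step[of u] show ?case by simp
  qed
  have "(\<lambda>J. 12 * A * \<bar>u\<bar> powr (2 * b) + 4 * M * (1 / 3) ^ J) \<longlonglongrightarrow> 12 * A * \<bar>u\<bar> powr (2 * b) + 4 * M * 0"
    by (intro tendsto_intros LIMSEQ_power_zero) auto
  then have "D u \<le> 12 * A * \<bar>u\<bar> powr (2 * b) + 4 * M * 0"
    by (rule LIMSEQ_le_const) (use bd in auto)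
  then have "D u \<le> 12 * A * \<bar>u\<bar> powr (2 * b)" by simp
  moreover have "sq_int (fdiff u j f) = ennreal (D u)"
    unfolding D_def using sq_int_array_finite(1)[OF f fin, of u j] by simp
  ultimately show ?thesis by (simp add: ennreal_leI)
qed


section \<open>Kernel smoothing and its bias\<close>

section \<open>Smoothing by a cube kernel\<close>

lemma sq_int_add_le:
  assumes [measurable]: "g \<in> borel_measurable borel" "g' \<in> borel_measurable borel"
  shows "sq_int (\<lambda>x. g x + g' x) \<le> 2 * sq_int g + 2 * sq_int g'"
proof -
  have "sq_int (\<lambda>x. g x + g' x) \<le> (\<integral>\<^sup>+x. 2 * ennreal ((g x)\<^sup>2) + 2 * ennreal ((g' x)\<^sup>2) \<partial>lborel)"
    unfolding sq_int_def
  proof (intro nn_integral_mono)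
    fix x
    have "(g x + g' x)\<^sup>2 \<le> 2 * (g x)\<^sup>2 + 2 * (g' x)\<^sup>2"
      using sum_squares_bound[of "g x" "g' x"] by (simp add: power2_sum)
    then have "ennreal ((g x + g' x)\<^sup>2) \<le> ennreal (2 * (g x)\<^sup>2 + 2 * (g' x)\<^sup>2)"
      by (rule ennreal_leI)
    also have "\<dots> = ennreal (2 * (g x)\<^sup>2) + ennreal (2 * (g' x)\<^sup>2)"
      by (rule ennreal_plus) auto
    finally show "ennreal ((g x + g' x)\<^sup>2) \<le> 2 * ennreal ((g x)\<^sup>2) + 2 * ennreal ((g' x)\<^sup>2)"
      by (simp only: ennreal_mult ennreal_numeral zero_le_power2 zero_le_numeral)
  qed
  also have "\<dots> = 2 * sq_int g + 2 * sq_int g'"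
    unfolding sq_int_def by (subst nn_integral_add) (auto simp: nn_integral_cmult)
  finally show ?thesis .
qed

text \<open>The shift is carried out one coordinate at a time. Each coordinate costs
  \<open>2 * M\<close> plus twice the previous bound, and the factor 4 per coordinate absorbs
  both.\<close>

lemma sq_int_shift_diff_le:
  fixes f :: "real ^ 'd \<Rightarrow> real"
  assumes f[measurable]: "f \<in> borel_measurable borel" and M: "0 \<le> M"
    and bound: "\<And>j u. \<bar>u\<bar> \<le> h \<Longrightarrow> sq_int (fdiff u j f) \<le> ennreal M"
    and w: "\<And>j. \<bar>w $ j\<bar> \<le> h"
  shows "sq_int (\<lambda>x. f (x + w) - f x) \<le> ennreal (4 ^ CARD('d) * M)"
proof -
  let ?v = "\<lambda>S. \<Sum>j\<in>S. (w $ j) *\<^sub>R axis j 1"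
  have "sq_int (\<lambda>x. f (x + ?v S) - f x) \<le> ennreal (4 ^ card S * M)" if "finite S" for S
    using that
  proof induction
    case empty
    then show ?case by (simp add: sq_int_def)
  next
    case (insert j S)
    let ?d = "fdiff (w $ j) j f"
    have "sq_int (\<lambda>x. f (x + ?v (insert j S)) - f x) =
       sq_int (\<lambda>x. ?d (x + ?v S) + (f (x + ?v S) - f x))"
      using insert by (intro arg_cong[where f = sq_int]) (auto simp: fdiff_def fun_eq_iff algebra_simps)
    also have "\<dots> \<le> 2 * sq_int (\<lambda>x. ?d (x + ?v S)) + 2 * sq_int (\<lambda>x. f (x + ?v S) - f x)"
      by (intro sq_int_add_le) auto
    also have "sq_int (\<lambda>x. ?d (x + ?v S)) = sq_int ?d"
      unfolding sq_int_def by (rule nn_integral_lborel_shift) auto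
    also have "2 * sq_int ?d + 2 * sq_int (\<lambda>x. f (x + ?v S) - f x)
        \<le> 2 * ennreal M + 2 * ennreal (4 ^ card S * M)"
      by (intro add_mono mult_left_mono bound w insert) auto
    also have "\<dots> = ennreal (2 * M + 2 * (4 ^ card S * M))"
      using M by (simp add: ennreal_mult)
    also have "\<dots> \<le> ennreal (4 ^ card (insert j S) * M)"
    proof (rule ennreal_leI)
      have "1 * M \<le> 4 ^ card S * M" using M by (intro mult_right_mono) auto
      then show "2 * M + 2 * (4 ^ card S * M) \<le> 4 ^ card (insert j S) * M" using insert by (simp add: algebra_simps)
    qed
    finally show ?case .
  qed
  from this[of UNIV] have "sq_int (\<lambda>x. f (x + ?v UNIV) - f x) \<le> ennreal (4 ^ CARD('d) * M)" by simp
  moreover have "?v UNIV = w"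
    by (simp add: vec_eq_iff axis_def if_distrib[of "(*) _"] sum.delta cong: if_cong)
  ultimately show ?thesis by simp
qed

text \<open>The uniform density on the cube \<open>[0,h]^d\<close>. It is one-sided, so
  \<open>cube_kernel h (y - x)\<close> is not symmetric in \<open>x\<close> and
  \<open>y\<close>.\<close>

definition cube_kernel :: "real \<Rightarrow> real ^ 'd \<Rightarrow> real" where
  "cube_kernel h w = indicator (cbox 0 (\<chi> j. h)) w / h ^ CARD('d)"

lemma measurable_cube_kernel[measurable]: "cube_kernel h \<in> borel_measurable borel"
  unfolding cube_kernel_def by measurable

lemma cube_kernel_nonneg: "0 < h \<Longrightarrow> 0 \<le> cube_kernel h w"
  by (simp add: cube_kernel_def)

lemma cube_kernel_le: "0 < h \<Longrightarrow> cube_kernel h (w :: real ^ 'd) \<le> 1 / h ^ CARD('d)"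
  by (simp add: cube_kernel_def indicator_def)

lemma emeasure_cbox_vec:
  fixes a b :: "real ^ 'd"
  assumes "\<And>j. a $ j \<le> b $ j"
  shows "emeasure lborel (cbox a b) = ennreal (\<Prod>j\<in>UNIV. b $ j - a $ j)"
proof -
  have "emeasure lborel (cbox a b) = ennreal (measure lborel (cbox a b))"
    using emeasure_lborel_cbox_finite[of a b] by (intro emeasure_eq_ennreal_measure) auto
  also have "measure lborel (cbox a b) = (\<Prod>j\<in>UNIV. b $ j - a $ j)"
    using assms by (intro content_cbox_cart) (auto simp: interval_ne_empty_cart)
  finally show ?thesis .
qed

lemma nn_integral_cube_kernel:
  assumes "0 < h"
  shows "(\<integral>\<^sup>+w. ennreal (cube_kernel h (w :: real ^ 'd)) \<partial>lborel) = 1"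
proof -
  have "(\<integral>\<^sup>+w. ennreal (cube_kernel h (w :: real ^ 'd)) \<partial>lborel) =
    (\<integral>\<^sup>+w. ennreal (1 / h ^ CARD('d)) * indicator (cbox 0 (\<chi> j. h)) (w :: real ^ 'd) \<partial>lborel)"
    by (intro nn_integral_cong) (auto simp: cube_kernel_def indicator_def)
  also have "\<dots> = ennreal (1 / h ^ CARD('d)) * emeasure lborel (cbox 0 (\<chi> j. h) :: (real ^ 'd) set)"
    by (subst nn_integral_cmult_indicator) auto
  also have "\<dots> = ennreal (1 / h ^ CARD('d)) * ennreal (h ^ CARD('d))"
    using assms by (subst emeasure_cbox_vec) auto
  also have "\<dots> = 1" using assms by (simp add: ennreal_mult[symmetric] del: ennreal_1 flip: ennreal_1)
  finally show ?thesis .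
qed

text \<open>For a density \<open>f\<close>, the mean of \<open>cube_kernel h (Y - X)\<close> when
  \<open>X\<close> and \<open>Y\<close> are independent with density \<open>f\<close>.\<close>

definition smoothed_sq_int :: "real \<Rightarrow> (real ^ 'd \<Rightarrow> real) \<Rightarrow> ennreal" where
  "smoothed_sq_int h f =
     (\<integral>\<^sup>+x. \<integral>\<^sup>+y. ennreal (f x) * (ennreal (cube_kernel h (y - x)) * ennreal (f y)) \<partial>lborel \<partial>lborel)"

text \<open>Integrate \<open>2 f(x) f(x+w) + (f(x+w) - f(x))^2 = f(x+w)^2 + f(x)^2\<close> over
  \<open>x\<close> and average over \<open>w\<close> with the kernel, whose mass is 1. The bias
  stands as a summand on the left, since subtraction in \<open>ennreal\<close> is truncated.\<close>

lemma smoothed_sq_int_identity: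
  fixes f :: "real ^ 'd \<Rightarrow> real"
  assumes f[measurable]: "f \<in> borel_measurable borel" and nonneg: "\<And>x. 0 \<le> f x" and h: "0 < h"
  shows "2 * smoothed_sq_int h f
      + (\<integral>\<^sup>+w. ennreal (cube_kernel h w) * sq_int (\<lambda>x. f (x + w) - f x) \<partial>lborel) = 2 * sq_int f"
proof -
  have "smoothed_sq_int h f =
      (\<integral>\<^sup>+x. \<integral>\<^sup>+w. ennreal (f x) * (ennreal (cube_kernel h w) * ennreal (f (x + w))) \<partial>lborel \<partial>lborel)"
    unfolding smoothed_sq_int_def
  proof (rule nn_integral_cong)
    fix x
    show "(\<integral>\<^sup>+y. ennreal (f x) * (ennreal (cube_kernel h (y - x)) * ennreal (f y)) \<partial>lborel) =
      (\<integral>\<^sup>+w. ennreal (f x) * (ennreal (cube_kernel h w) * ennreal (f (x + w))) \<partial>lborel)"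
      by (subst nn_integral_lborel_shift[of _ x, symmetric]) (auto simp: add.commute)
  qed
  also have "\<dots> = (\<integral>\<^sup>+w. \<integral>\<^sup>+x. ennreal (f x) * (ennreal (cube_kernel h w) * ennreal (f (x + w))) \<partial>lborel \<partial>lborel)"
    by (intro lborel_pair.Fubini') simp
  also have "\<dots> = (\<integral>\<^sup>+w. ennreal (cube_kernel h w) * (\<integral>\<^sup>+x. ennreal (f x) * ennreal (f (x + w)) \<partial>lborel) \<partial>lborel)"
    by (intro nn_integral_cong, subst nn_integral_cmult[symmetric]) (auto simp: mult_ac)
  finally have s: "smoothed_sq_int h f = \<dots>" .
  have eq: "2 * (\<integral>\<^sup>+x. ennreal (f x) * ennreal (f (x + w)) \<partial>lborel) + sq_int (\<lambda>x. f (x + w) - f x)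
     = 2 * sq_int f" for w
  proof -
    have pt: "2 * (ennreal (f x) * ennreal (f (x + w))) + ennreal ((f (x + w) - f x)\<^sup>2)
       = ennreal ((f (x + w))\<^sup>2) + ennreal ((f x)\<^sup>2)" for x
    proof -
      have "ennreal 2 * (ennreal (f x) * ennreal (f (x + w))) = ennreal (2 * (f x * f (x + w)))"
        using nonneg by (simp only: ennreal_mult mult_nonneg_nonneg zero_le_numeral)
      then have "2 * (ennreal (f x) * ennreal (f (x + w))) + ennreal ((f (x + w) - f x)\<^sup>2)
        = ennreal (2 * (f x * f (x + w))) + ennreal ((f (x + w) - f x)\<^sup>2)" by simp
      also have "\<dots> = ennreal (2 * (f x * f (x + w)) + (f (x + w) - f x)\<^sup>2)"
        by (rule ennreal_plus[symmetric]) (simp_all add: nonneg)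
      also have "2 * (f x * f (x + w)) + (f (x + w) - f x)\<^sup>2 = (f (x + w))\<^sup>2 + (f x)\<^sup>2"
        by (simp add: power2_eq_square algebra_simps)
      also have "ennreal \<dots> = ennreal ((f (x + w))\<^sup>2) + ennreal ((f x)\<^sup>2)"
        by (rule ennreal_plus) auto
      finally show ?thesis .
    qed
    have "2 * (\<integral>\<^sup>+x. ennreal (f x) * ennreal (f (x + w)) \<partial>lborel) + sq_int (\<lambda>x. f (x + w) - f x)
      = (\<integral>\<^sup>+x. 2 * (ennreal (f x) * ennreal (f (x + w))) + ennreal ((f (x + w) - f x)\<^sup>2) \<partial>lborel)"
      unfolding sq_int_def by (subst nn_integral_add) (auto simp: nn_integral_cmult)
    also have "\<dots> = (\<integral>\<^sup>+x. ennreal ((f (x + w))\<^sup>2) + ennreal ((f x)\<^sup>2) \<partial>lborel)"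
      by (intro nn_integral_cong pt)
    also have "\<dots> = sq_int f + sq_int f"
      unfolding sq_int_def using nn_integral_lborel_shift[of "\<lambda>x. ennreal ((f x)\<^sup>2)" w]
      by (subst nn_integral_add) auto
    finally show ?thesis by (simp add: mult_2)
  qed
  have [measurable]: "(\<lambda>w. sq_int (\<lambda>x. f (x + w) - f x)) \<in> borel_measurable borel"
    unfolding sq_int_def by measurable
  have "2 * smoothed_sq_int h f
      + (\<integral>\<^sup>+w. ennreal (cube_kernel h w) * sq_int (\<lambda>x. f (x + w) - f x) \<partial>lborel)
    = (\<integral>\<^sup>+w. 2 * (ennreal (cube_kernel h w) * (\<integral>\<^sup>+x. ennreal (f x) * ennreal (f (x + w)) \<partial>lborel))
        + ennreal (cube_kernel h w) * sq_int (\<lambda>x. f (x + w) - f x) \<partial>lborel)"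
    unfolding s by (subst nn_integral_add) (auto simp: nn_integral_cmult)
  also have "\<dots> = (\<integral>\<^sup>+(w :: real ^ 'd). ennreal (cube_kernel h w) * (2 * sq_int f) \<partial>lborel)"
  proof (rule nn_integral_cong)
    fix w :: "real ^ 'd"
    show "2 * (ennreal (cube_kernel h w) * (\<integral>\<^sup>+x. ennreal (f x) * ennreal (f (x + w)) \<partial>lborel))
        + ennreal (cube_kernel h w) * sq_int (\<lambda>x. f (x + w) - f x) = ennreal (cube_kernel h w) * (2 * sq_int f)"
      unfolding eq[of w, symmetric] distrib_left by (simp only: mult.left_commute)
  qed
  also have "\<dots> = 2 * sq_int f"
    using nn_integral_cube_kernel[OF h, where 'd = 'd] by (subst nn_integral_multc) auto
  finally show ?thesis .
qed

text \<open>Both bounds are read off from the identity: the averaged term is nonnegative, and the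
  kernel restricts it to shifts with coordinates in \<open>[0,h]\<close>. The factor
  \<open>1 / 2\<close> in front of the bias is given away.\<close>

lemma smoothed_sq_int_bias:
  fixes f :: "real ^ 'd \<Rightarrow> real"
  assumes f[measurable]: "f \<in> borel_measurable borel" and nonneg: "\<And>x. 0 \<le> f x" and h: "0 < h"
    and M: "0 \<le> M" and bound: "\<And>j u. \<bar>u\<bar> \<le> h \<Longrightarrow> sq_int (fdiff u j f) \<le> ennreal M"
  shows "smoothed_sq_int h f \<le> sq_int f" "sq_int f \<le> smoothed_sq_int h f + ennreal (4 ^ CARD('d) * M)"
proof -
  let ?R = "\<integral>\<^sup>+w. ennreal (cube_kernel h w) * sq_int (\<lambda>x. f (x + w) - f x) \<partial>lborel"
  note id = smoothed_sq_int_identity[OF f nonneg h]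
  have cancel: "a \<le> b" if "2 * a \<le> 2 * b" for a b :: ennreal
    using that by (simp add: ennreal_mult_le_mult_iff)
  have "2 * smoothed_sq_int h f \<le> 2 * sq_int f"
    unfolding id[symmetric] by simp
  then show "smoothed_sq_int h f \<le> sq_int f" by (rule cancel)
  have "?R \<le> (\<integral>\<^sup>+w. ennreal (cube_kernel h (w :: real ^ 'd)) * ennreal (4 ^ CARD('d) * M) \<partial>lborel)"
  proof (intro nn_integral_mono)
    fix w :: "real ^ 'd"
    show "ennreal (cube_kernel h w) * sq_int (\<lambda>x. f (x + w) - f x)
      \<le> ennreal (cube_kernel h w) * ennreal (4 ^ CARD('d) * M)"
    proof (cases "w \<in> cbox 0 (\<chi> j. h)")
      case True
      then have "\<bar>w $ j\<bar> \<le> h" for j by (auto simp: mem_box_cart)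
      then show ?thesis by (intro mult_left_mono sq_int_shift_diff_le f M bound) auto
    qed (simp add: cube_kernel_def)
  qed
  also have "\<dots> = ennreal (4 ^ CARD('d) * M)"
    using nn_integral_cube_kernel[OF h, where 'd = 'd] by (subst nn_integral_multc) auto
  finally have R: "?R \<le> ennreal (4 ^ CARD('d) * M)" .
  have "2 * sq_int f \<le> 2 * smoothed_sq_int h f + ennreal (4 ^ CARD('d) * M)"
    unfolding id[symmetric] by (intro add_left_mono R)
  also have "\<dots> \<le> 2 * smoothed_sq_int h f + 2 * ennreal (4 ^ CARD('d) * M)"
    by (intro add_left_mono) (simp add: mult_2)
  also have "\<dots> = 2 * (smoothed_sq_int h f + ennreal (4 ^ CARD('d) * M))"
    by (simp add: distrib_left)
  finally show "sq_int f \<le> smoothed_sq_int h f + ennreal (4 ^ CARD('d) * M)" by (rule cancel)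
qed


section \<open>First and second moments of sums over independent coordinates, and the square root of
  an estimator\<close>

section \<open>Moments of pair statistics\<close>

text \<open>Induction on the index set, integrating out the new coordinate first. The second bound
  is the usual variance bound with the negative term, a multiple of the squared mean, dropped; thus
  all quantities stay in \<open>ennreal\<close>.\<close>

lemma (in prob_space) iid_sum_moments:
  fixes g :: "'a \<Rightarrow> ennreal" and I :: "'i set"
  assumes I: "finite I" and g[measurable]: "g \<in> borel_measurable M"
  shows "(\<integral>\<^sup>+X. (\<Sum>i\<in>I. g (X i)) \<partial>Pi\<^sub>M I (\<lambda>_. M)) = of_nat (card I) * (\<integral>\<^sup>+x. g x \<partial>M)" (is ?first)
    and "(\<integral>\<^sup>+X. (\<Sum>i\<in>I. g (X i))\<^sup>2 \<partial>Pi\<^sub>M I (\<lambda>_. M))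
      \<le> (of_nat (card I) * (\<integral>\<^sup>+x. g x \<partial>M))\<^sup>2 + of_nat (card I) * (\<integral>\<^sup>+x. (g x)\<^sup>2 \<partial>M)" (is ?second)
proof -
  interpret P: product_sigma_finite "\<lambda>_::'i. M" by standard
  have pr: "prob_space (Pi\<^sub>M J (\<lambda>_::'i. M))" for J
    by (intro prob_space_PiM prob_space_axioms)
  have "?first \<and> ?second"
    using I
  proof (induction I)
    case empty
    then show ?case by simp
  next
    case (insert k I)
    interpret J: prob_space "Pi\<^sub>M I (\<lambda>_::'i. M)" by (rule pr)
    let ?s = "\<lambda>X. \<Sum>i\<in>I. g (X i)"
    have s[measurable]: "?s \<in> borel_measurable (Pi\<^sub>M I (\<lambda>_. M))" by measurable
    have upd: "(\<Sum>i\<in>insert k I. g ((X(k := y)) i)) = g y + ?s X" for X y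
    proof -
      have "(\<Sum>i\<in>I. g ((X(k := y)) i)) = ?s X"
        using insert by (intro sum.cong refl) auto
      then show ?thesis using insert by simp
    qed
    have m: "(\<lambda>X. \<Sum>i\<in>insert k I. g (X i)) \<in> borel_measurable (Pi\<^sub>M (insert k I) (\<lambda>_. M))" 
      by (intro borel_measurable_sum) measurable
    then have m2: "(\<lambda>X. (\<Sum>i\<in>insert k I. g (X i))\<^sup>2) \<in> borel_measurable (Pi\<^sub>M (insert k I) (\<lambda>_. M))"
      unfolding power2_eq_square by (intro borel_measurable_times_ennreal)
    have IH: "(\<integral>\<^sup>+X. ?s X \<partial>Pi\<^sub>M I (\<lambda>_. M)) = of_nat (card I) * (\<integral>\<^sup>+x. g x \<partial>M)"
      "(\<integral>\<^sup>+X. (?s X)\<^sup>2 \<partial>Pi\<^sub>M I (\<lambda>_. M)) \<le> (of_nat (card I) * (\<integral>\<^sup>+x. g x \<partial>M))\<^sup>2 + of_nat (card I) * (\<integral>\<^sup>+x. (g x)\<^sup>2 \<partial>M)"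
      using insert by auto
    have "(\<integral>\<^sup>+X. (\<Sum>i\<in>insert k I. g (X i)) \<partial>Pi\<^sub>M (insert k I) (\<lambda>_. M)) 
      = (\<integral>\<^sup>+X. \<integral>\<^sup>+y. g y + ?s X \<partial>M \<partial>Pi\<^sub>M I (\<lambda>_. M))"
      using P.product_nn_integral_insert[OF insert(1,2) m] unfolding upd .
    also have "\<dots> = (\<integral>\<^sup>+X. (\<integral>\<^sup>+x. g x \<partial>M) + ?s X \<partial>Pi\<^sub>M I (\<lambda>_. M))"
      by (intro nn_integral_cong, subst nn_integral_add) (auto simp: emeasure_space_1)
    also have "\<dots> = (\<integral>\<^sup>+x. g x \<partial>M) + of_nat (card I) * (\<integral>\<^sup>+x. g x \<partial>M)"
      by (subst nn_integral_add) (auto simp: IH J.emeasure_space_1)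
    finally have 1: "(\<integral>\<^sup>+X. (\<Sum>i\<in>insert k I. g (X i)) \<partial>Pi\<^sub>M (insert k I) (\<lambda>_. M))
       = of_nat (card (insert k I)) * (\<integral>\<^sup>+x. g x \<partial>M)"
      using insert by (simp add: distrib_right)
    let ?a = "\<integral>\<^sup>+x. g x \<partial>M" and ?b = "\<integral>\<^sup>+x. (g x)\<^sup>2 \<partial>M" and ?c = "of_nat (card I) :: ennreal"
    have "(\<integral>\<^sup>+X. (\<Sum>i\<in>insert k I. g (X i))\<^sup>2 \<partial>Pi\<^sub>M (insert k I) (\<lambda>_. M)) 
      = (\<integral>\<^sup>+X. \<integral>\<^sup>+y. (g y + ?s X)\<^sup>2 \<partial>M \<partial>Pi\<^sub>M I (\<lambda>_. M))"
      using P.product_nn_integral_insert[OF insert(1,2) m2] unfolding upd .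
    also have "\<dots> = (\<integral>\<^sup>+X. (?b + (?s X)\<^sup>2) + 2 * ?a * ?s X \<partial>Pi\<^sub>M I (\<lambda>_. M))"
    proof (rule nn_integral_cong)
      fix X
      have "(\<integral>\<^sup>+y. (g y + ?s X)\<^sup>2 \<partial>M) = (\<integral>\<^sup>+y. ((g y)\<^sup>2 + (?s X)\<^sup>2) + (2 * ?s X) * g y \<partial>M)"
        by (simp add: power2_sum mult_ac)
      also have "\<dots> = (?b + (?s X)\<^sup>2) + (2 * ?s X) * ?a"
        by (simp add: nn_integral_add nn_integral_cmult emeasure_space_1)
      finally show "(\<integral>\<^sup>+y. (g y + ?s X)\<^sup>2 \<partial>M) = (?b + (?s X)\<^sup>2) + 2 * ?a * ?s X" by (simp add: mult_ac)
    qed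
    also have "\<dots> = (?b + (\<integral>\<^sup>+X. (?s X)\<^sup>2 \<partial>Pi\<^sub>M I (\<lambda>_. M))) + 2 * ?a * (\<integral>\<^sup>+X. ?s X \<partial>Pi\<^sub>M I (\<lambda>_. M))"
      by (simp add: nn_integral_add nn_integral_cmult J.emeasure_space_1)
    also have "\<dots> \<le> (?b + ((?c * ?a)\<^sup>2 + ?c * ?b)) + 2 * ?a * (?c * ?a)"
      unfolding IH(1) by (intro add_right_mono add_left_mono IH(2))
    also have "\<dots> \<le> ((?c * ?a)\<^sup>2 + ?a\<^sup>2 + 2 * (?c * ?a) * ?a) + (?b + ?c * ?b)"
    proof -
      have "(?b + ((?c * ?a)\<^sup>2 + ?c * ?b)) + 2 * ?a * (?c * ?a)
        = ((?c * ?a)\<^sup>2 + 2 * (?c * ?a) * ?a) + (?b + ?c * ?b)" by (simp add: ac_simps)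
      also have "\<dots> \<le> ((?c * ?a)\<^sup>2 + ?a\<^sup>2 + 2 * (?c * ?a) * ?a) + (?b + ?c * ?b)"
        by (intro add_right_mono) simp
      finally show ?thesis .
    qed
    also have "\<dots> = (of_nat (card (insert k I)) * ?a)\<^sup>2 + of_nat (card (insert k I)) * ?b"
    proof -
      have e: "of_nat (card (insert k I)) * ?a = ?c * ?a + ?a" "of_nat (card (insert k I)) * ?b = ?b + ?c * ?b"
        using insert by (simp_all add: distrib_right add.commute)
      show ?thesis unfolding e power2_sum ..
    qed
    finally show ?case using 1 by blast
  qed
  then show ?first ?second by auto
qed

text \<open>\<open>iid_sum_moments\<close> is applied to the coordinates in \<open>J\<close> with
  those in \<open>I\<close> fixed, and then to those in \<open>I\<close>. The bound \<open>Q\<close>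
  on both partial integrals and the bound \<open>H\<close> on the kernel turn each remaining square
  into a multiple of \<open>\<theta>\<close>, so the variance bound is proportional to
  \<open>\<theta>\<close>.\<close>

lemma (in prob_space) bilinear_sum_moments:
  fixes k :: "'a \<Rightarrow> 'a \<Rightarrow> ennreal" and I J :: "'i set"
  assumes IJ: "I \<inter> J = {}" "finite I" "finite J"
    and k: "case_prod k \<in> borel_measurable (M \<Otimes>\<^sub>M M)"
    and Q1: "\<And>x. (\<integral>\<^sup>+y. k x y \<partial>M) \<le> Q" and Q2: "\<And>y. (\<integral>\<^sup>+x. k x y \<partial>M) \<le> Q"
    and H: "\<And>x y. k x y \<le> H"
  defines "\<theta> \<equiv> \<integral>\<^sup>+x. \<integral>\<^sup>+y. k x y \<partial>M \<partial>M" and "a \<equiv> of_nat (card I) :: ennreal" and "b \<equiv> of_nat (card J) :: ennreal"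
  shows "(\<integral>\<^sup>+X. (\<Sum>i\<in>I. \<Sum>j\<in>J. k (X i) (X j)) \<partial>Pi\<^sub>M (I \<union> J) (\<lambda>_. M)) = a * b * \<theta>" (is ?first)
    and "(\<integral>\<^sup>+X. (\<Sum>i\<in>I. \<Sum>j\<in>J. k (X i) (X j))\<^sup>2 \<partial>Pi\<^sub>M (I \<union> J) (\<lambda>_. M))
      \<le> (a * b * \<theta>)\<^sup>2 + (a * b\<^sup>2 * Q + a\<^sup>2 * b * Q + a * b * H) * \<theta>" (is ?second)
proof -
  interpret P: product_sigma_finite "\<lambda>_::'i. M" by standard
  interpret MM: pair_sigma_finite M M by standard
  note k[measurable]
  have [measurable]: "(\<lambda>x. k (f x) (g x)) \<in> borel_measurable N"
    if [measurable]: "f \<in> measurable N M" "g \<in> measurable N M" for f g and N :: "'n measure"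
  proof -
    have "(\<lambda>x. case_prod k (f x, g x)) \<in> borel_measurable N" by measurable
    then show ?thesis by simp
  qed
  let ?I = "Pi\<^sub>M I (\<lambda>_. M)" and ?J = "Pi\<^sub>M J (\<lambda>_. M)"
  let ?S = "\<lambda>X. \<Sum>i\<in>I. \<Sum>j\<in>J. k (X i) (X j)"
  let ?phi = "\<lambda>x y. \<Sum>i\<in>I. k (x i) y"
  define A where "A = (\<lambda>x. \<integral>\<^sup>+y. k x y \<partial>M)"
  define B where "B = (\<lambda>y. \<integral>\<^sup>+x. k x y \<partial>M)"
  have [measurable]: "A \<in> borel_measurable M" "B \<in> borel_measurable M"
    unfolding A_def B_def by measurable
  have AT: "(\<integral>\<^sup>+x. A x \<partial>M) = \<theta>" by (simp add: \<theta>_def A_def)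
  have BT: "(\<integral>\<^sup>+y. B y \<partial>M) = \<theta>" unfolding \<theta>_def B_def by (rule MM.Fubini') measurable
  have [measurable]: "(\<lambda>X. X i) \<in> measurable (Pi\<^sub>M (I \<union> J) (\<lambda>_. M)) M" if "i \<in> I \<union> J" for i
    using that by measurable
  have Sm[measurable]: "?S \<in> borel_measurable (Pi\<^sub>M (I \<union> J) (\<lambda>_. M))"
    by (intro borel_measurable_sum) measurable
  then have Sm2: "(\<lambda>X. (?S X)\<^sup>2) \<in> borel_measurable (Pi\<^sub>M (I \<union> J) (\<lambda>_. M))"
    unfolding power2_eq_square by (intro borel_measurable_times_ennreal)
  have merge: "?S (merge I J (x, y)) = (\<Sum>j\<in>J. ?phi x (y j))" for x y
  proof -
    have "?S (merge I J (x, y)) = (\<Sum>i\<in>I. \<Sum>j\<in>J. k (x i) (y j))"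
      using IJ by (intro sum.cong refl) (auto simp: merge_def)
    then show ?thesis by (simp add: sum.swap[of _ I J])
  qed
  have phim: "?phi x \<in> borel_measurable M" if "x \<in> space ?I" for x
    using that by (intro borel_measurable_sum) (auto simp: space_PiM PiE_iff)
  have int_phi: "(\<integral>\<^sup>+y. ?phi x y \<partial>M) = (\<Sum>i\<in>I. A (x i))" if "x \<in> space ?I" for x
    unfolding A_def using that by (intro nn_integral_sum) (auto simp: space_PiM PiE_iff)
  have "(\<integral>\<^sup>+X. ?S X \<partial>Pi\<^sub>M (I \<union> J) (\<lambda>_. M)) = (\<integral>\<^sup>+x. \<integral>\<^sup>+y. (\<Sum>j\<in>J. ?phi x (y j)) \<partial>?J \<partial>?I)"
    using P.product_nn_integral_fold[OF IJ Sm] unfolding merge .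
  also have "\<dots> = (\<integral>\<^sup>+x. b * (\<Sum>i\<in>I. A (x i)) \<partial>?I)"
    by (intro nn_integral_cong) (simp add: iid_sum_moments(1)[OF IJ(3) phim] int_phi b_def)
  also have "\<dots> = b * (a * \<theta>)"
    using iid_sum_moments(1)[OF IJ(2), of A] by (subst nn_integral_cmult) (auto simp: AT a_def)
  finally show ?first by (simp add: mult_ac)
  have "(\<integral>\<^sup>+X. (?S X)\<^sup>2 \<partial>Pi\<^sub>M (I \<union> J) (\<lambda>_. M)) = (\<integral>\<^sup>+x. \<integral>\<^sup>+y. (\<Sum>j\<in>J. ?phi x (y j))\<^sup>2 \<partial>?J \<partial>?I)"
    using P.product_nn_integral_fold[OF IJ Sm2] unfolding merge .
  also have "\<dots> \<le> (\<integral>\<^sup>+x. (b * (\<Sum>i\<in>I. A (x i)))\<^sup>2 + b * (\<integral>\<^sup>+y. (?phi x y)\<^sup>2 \<partial>M) \<partial>?I)"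
  proof (rule nn_integral_mono)
    fix x assume "x \<in> space ?I"
    then show "(\<integral>\<^sup>+y. (\<Sum>j\<in>J. ?phi x (y j))\<^sup>2 \<partial>?J) \<le> (b * (\<Sum>i\<in>I. A (x i)))\<^sup>2 + b * (\<integral>\<^sup>+y. (?phi x y)\<^sup>2 \<partial>M)"
      using iid_sum_moments(2)[OF IJ(3) phim] by (simp add: int_phi b_def)
  qed
  also have "\<dots> = b\<^sup>2 * (\<integral>\<^sup>+x. (\<Sum>i\<in>I. A (x i))\<^sup>2 \<partial>?I) + b * (\<integral>\<^sup>+x. \<integral>\<^sup>+y. (?phi x y)\<^sup>2 \<partial>M \<partial>?I)"
    by (simp add: nn_integral_add nn_integral_cmult power_mult_distrib)
  \<comment> \<open>Exchanging the integrals fixes \<open>y\<close>; then \<open>?phi x y\<close> is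
    a sum over the independent coordinates in \<open>I\<close>, and the moment bound applies
    again.\<close>
  also have "(\<integral>\<^sup>+x. \<integral>\<^sup>+y. (?phi x y)\<^sup>2 \<partial>M \<partial>?I) = (\<integral>\<^sup>+y. \<integral>\<^sup>+x. (?phi x y)\<^sup>2 \<partial>?I \<partial>M)"
  proof -
    interpret J: prob_space ?I by (intro prob_space_PiM prob_space_axioms)
    interpret X: pair_sigma_finite M ?I by standard
    show ?thesis by (rule X.Fubini') measurable
  qed
  also have "\<dots> \<le> (\<integral>\<^sup>+y. (a * B y)\<^sup>2 + a * (\<integral>\<^sup>+x. (k x y)\<^sup>2 \<partial>M) \<partial>M)"
  proof (rule nn_integral_mono)
    fix y assume y: "y \<in> space M"
    show "(\<integral>\<^sup>+x. (?phi x y)\<^sup>2 \<partial>?I) \<le> (a * B y)\<^sup>2 + a * (\<integral>\<^sup>+x. (k x y)\<^sup>2 \<partial>M)"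
      using iid_sum_moments(2)[OF IJ(2), of "\<lambda>x. k x y"] y by (simp add: B_def a_def)
  qed
  also have "\<dots> = a\<^sup>2 * (\<integral>\<^sup>+y. (B y)\<^sup>2 \<partial>M) + a * (\<integral>\<^sup>+y. \<integral>\<^sup>+x. (k x y)\<^sup>2 \<partial>M \<partial>M)"
    by (simp add: nn_integral_add nn_integral_cmult power_mult_distrib)
  also have "(\<integral>\<^sup>+y. (B y)\<^sup>2 \<partial>M) \<le> Q * \<theta>"
  proof -
    have "(\<integral>\<^sup>+y. (B y)\<^sup>2 \<partial>M) \<le> (\<integral>\<^sup>+y. Q * B y \<partial>M)"
      unfolding power2_eq_square by (intro nn_integral_mono mult_right_mono) (auto simp: B_def Q2)
    then show ?thesis by (simp add: nn_integral_cmult BT)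
  qed
  also have "(\<integral>\<^sup>+y. \<integral>\<^sup>+x. (k x y)\<^sup>2 \<partial>M \<partial>M) \<le> H * \<theta>"
  proof -
    have "(\<integral>\<^sup>+y. \<integral>\<^sup>+x. (k x y)\<^sup>2 \<partial>M \<partial>M) \<le> (\<integral>\<^sup>+y. \<integral>\<^sup>+x. H * k x y \<partial>M \<partial>M)"
      unfolding power2_eq_square by (intro nn_integral_mono mult_right_mono H) auto
    also have "\<dots> = (\<integral>\<^sup>+y. H * B y \<partial>M)"
      unfolding B_def by (intro nn_integral_cong nn_integral_cmult) measurable
    finally show ?thesis by (simp add: nn_integral_cmult BT)
  qed
  also have "(\<integral>\<^sup>+x. (\<Sum>i\<in>I. A (x i))\<^sup>2 \<partial>?I) \<le> (a * \<theta>)\<^sup>2 + a * (Q * \<theta>)"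
  proof -
    have "(\<integral>\<^sup>+x. (\<Sum>i\<in>I. A (x i))\<^sup>2 \<partial>?I) \<le> (a * \<theta>)\<^sup>2 + a * (\<integral>\<^sup>+x. (A x)\<^sup>2 \<partial>M)"
      using iid_sum_moments(2)[OF IJ(2), of A] by (simp add: AT a_def)
    also have "(\<integral>\<^sup>+x. (A x)\<^sup>2 \<partial>M) \<le> (\<integral>\<^sup>+x. Q * A x \<partial>M)"
      unfolding power2_eq_square by (intro nn_integral_mono mult_right_mono) (auto simp: A_def Q1)
    also have "\<dots> = Q * \<theta>" by (simp add: nn_integral_cmult AT)
    finally show ?thesis by (simp add: mult_left_mono add_left_mono)
  qed
  finally have "(\<integral>\<^sup>+X. (?S X)\<^sup>2 \<partial>Pi\<^sub>M (I \<union> J) (\<lambda>_. M))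
     \<le> b\<^sup>2 * ((a * \<theta>)\<^sup>2 + a * (Q * \<theta>)) + b * (a\<^sup>2 * (Q * \<theta>) + a * (H * \<theta>))"
    by (simp add: mult_left_mono add_mono)
  also have "\<dots> = (a * b * \<theta>)\<^sup>2 + (a * b\<^sup>2 * Q + a\<^sup>2 * b * Q + a * b * H) * \<theta>"
    by (simp add: power_mult_distrib distrib_left distrib_right ac_simps)
  finally show ?second .
qed

text \<open>Two regimes. If \<open>S\<^sup>2\<close> is at most \<open>B\<close>, then
  \<open>(sqrt U - S)^2 \<le> U + S^2\<close> has mean at most \<open>2 * B\<close>. Otherwise
  \<open>\<bar>sqrt U - S\<bar> \<le> \<bar>U - S^2\<bar> / S\<close>, and the division by
  \<open>S^2\<close> is paid for by the bounds \<open>B * S^2\<close> for the squared bias and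
  \<open>v * S^2\<close> for the variance. The variance being proportional to
  \<open>\<theta>\<close> is what makes this work uniformly in \<open>S\<close>.\<close>

lemma (in prob_space) sqrt_estimator_error:
  fixes U :: "'a \<Rightarrow> real" and \<theta> S v B :: real
  assumes U[measurable]: "U \<in> borel_measurable M" and U0: "\<And>x. 0 \<le> U x"
    and EU: "(\<integral>\<^sup>+x. ennreal (U x) \<partial>M) = ennreal \<theta>"
    and EU2: "(\<integral>\<^sup>+x. (ennreal (U x))\<^sup>2 \<partial>M) \<le> ennreal (\<theta>\<^sup>2 + v * \<theta>)"
    and v: "0 \<le> v" and B: "0 \<le> B" and S: "0 \<le> S" and \<theta>: "0 \<le> \<theta>" "\<theta> \<le> S\<^sup>2" "S\<^sup>2 \<le> \<theta> + B"
  shows "(\<integral>\<^sup>+x. ennreal ((sqrt (U x) - S)\<^sup>2) \<partial>M) \<le> ennreal (2 * B + v)"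
proof (cases "S = 0 \<or> S\<^sup>2 < B")
  case True
  then have SB: "S\<^sup>2 \<le> B" using B by auto
  have "(\<integral>\<^sup>+x. ennreal ((sqrt (U x) - S)\<^sup>2) \<partial>M) \<le> (\<integral>\<^sup>+x. ennreal (U x) + ennreal (S\<^sup>2) \<partial>M)"
  proof (rule nn_integral_mono)
    fix x
    have "(sqrt (U x) - S)\<^sup>2 \<le> U x + S\<^sup>2"
      using U0[of x] S by (simp add: power2_diff)
    then have "ennreal ((sqrt (U x) - S)\<^sup>2) \<le> ennreal (U x + S\<^sup>2)" by (rule ennreal_leI)
    then show "ennreal ((sqrt (U x) - S)\<^sup>2) \<le> ennreal (U x) + ennreal (S\<^sup>2)"
      using U0[of x] by simp
  qed
  also have "\<dots> = ennreal \<theta> + ennreal (S\<^sup>2)"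
    by (subst nn_integral_add) (auto simp: EU emeasure_space_1)
  also have "\<dots> = ennreal (\<theta> + S\<^sup>2)" using \<theta> by (intro ennreal_plus[symmetric]) auto
  also have "\<dots> \<le> ennreal (2 * B + v)"
    by (rule ennreal_leI) (use SB \<theta> v in linarith)
  finally show ?thesis .
next
  case False
  then have SB: "B \<le> S\<^sup>2" "0 < S" using S by auto
  let ?D = "\<integral>\<^sup>+x. ennreal ((U x - S\<^sup>2)\<^sup>2) \<partial>M"
  \<comment> \<open>The cross term of the square is moved to the left to avoid subtraction, and is
    cancelled after the right-hand side has been split in the same way.\<close>
  have "?D + ennreal (2 * S\<^sup>2 * \<theta>) = (\<integral>\<^sup>+x. ennreal ((U x - S\<^sup>2)\<^sup>2) + ennreal (2 * S\<^sup>2) * ennreal (U x) \<partial>M)"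
    using \<theta> by (subst nn_integral_add) (auto simp: nn_integral_cmult EU ennreal_mult)
  also have "\<dots> = (\<integral>\<^sup>+x. (ennreal (U x))\<^sup>2 + ennreal (S ^ 4) \<partial>M)"
  proof (rule nn_integral_cong)
    fix x
    have "ennreal ((U x - S\<^sup>2)\<^sup>2) + ennreal (2 * S\<^sup>2) * ennreal (U x)
        = ennreal ((U x - S\<^sup>2)\<^sup>2) + ennreal (2 * S\<^sup>2 * U x)"
      using U0 by (simp add: ennreal_mult)
    also have "\<dots> = ennreal ((U x - S\<^sup>2)\<^sup>2 + 2 * S\<^sup>2 * U x)"
      using U0 by (intro ennreal_plus[symmetric]) auto
    also have "(U x - S\<^sup>2)\<^sup>2 + 2 * S\<^sup>2 * U x = (U x)\<^sup>2 + S ^ 4"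
      by algebra
    also have "ennreal \<dots> = ennreal ((U x)\<^sup>2) + ennreal (S ^ 4)"
      by (rule ennreal_plus) auto
    finally show "ennreal ((U x - S\<^sup>2)\<^sup>2) + ennreal (2 * S\<^sup>2) * ennreal (U x) = (ennreal (U x))\<^sup>2 + ennreal (S ^ 4)"
      using U0 by (simp add: ennreal_power)
  qed
  also have "\<dots> = (\<integral>\<^sup>+x. (ennreal (U x))\<^sup>2 \<partial>M) + ennreal (S ^ 4)"
    by (subst nn_integral_add) (auto simp: emeasure_space_1)
  also have "\<dots> \<le> ennreal (\<theta>\<^sup>2 + v * \<theta>) + ennreal (S ^ 4)"
    by (intro add_right_mono EU2)
  also have "\<dots> = ennreal (\<theta>\<^sup>2 + v * \<theta> + S ^ 4)"
    using v \<theta> by (intro ennreal_plus[symmetric]) auto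
  also have "\<theta>\<^sup>2 + v * \<theta> + S ^ 4 = ((S\<^sup>2 - \<theta>)\<^sup>2 + v * \<theta>) + 2 * S\<^sup>2 * \<theta>"
    by algebra
  also have "ennreal \<dots> = ennreal ((S\<^sup>2 - \<theta>)\<^sup>2 + v * \<theta>) + ennreal (2 * S\<^sup>2 * \<theta>)"
    using v \<theta> by (intro ennreal_plus) auto
  finally have "?D \<le> ennreal ((S\<^sup>2 - \<theta>)\<^sup>2 + v * \<theta>)"
    by simp
  also have "\<dots> \<le> ennreal ((B + v) * S\<^sup>2)"
  proof (rule ennreal_leI)
    have "(S\<^sup>2 - \<theta>)\<^sup>2 \<le> B * S\<^sup>2"
      unfolding power2_eq_square[of "S\<^sup>2 - \<theta>"] by (intro mult_mono) (use \<theta> SB B in auto)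
    moreover have "v * \<theta> \<le> v * S\<^sup>2" using v \<theta> by (intro mult_left_mono) auto
    ultimately show "(S\<^sup>2 - \<theta>)\<^sup>2 + v * \<theta> \<le> (B + v) * S\<^sup>2" by (simp add: distrib_right)
  qed
  finally have D: "?D \<le> ennreal ((B + v) * S\<^sup>2)" .
  have "(\<integral>\<^sup>+x. ennreal ((sqrt (U x) - S)\<^sup>2) \<partial>M) \<le> (\<integral>\<^sup>+x. ennreal (1 / S\<^sup>2) * ennreal ((U x - S\<^sup>2)\<^sup>2) \<partial>M)"
  proof (rule nn_integral_mono)
    fix x
    have "(sqrt (U x) - S)\<^sup>2 * S\<^sup>2 \<le> (sqrt (U x) - S)\<^sup>2 * (sqrt (U x) + S)\<^sup>2"
      using U0[of x] S by (intro mult_left_mono power_mono) auto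
    also have "\<dots> = ((sqrt (U x) - S) * (sqrt (U x) + S))\<^sup>2" by (simp add: power_mult_distrib)
    also have "(sqrt (U x) - S) * (sqrt (U x) + S) = U x - S\<^sup>2"
      using U0[of x] by (simp add: algebra_simps power2_eq_square)
    finally have "(sqrt (U x) - S)\<^sup>2 \<le> 1 / S\<^sup>2 * (U x - S\<^sup>2)\<^sup>2"
      using SB by (simp add: field_simps)
    then show "ennreal ((sqrt (U x) - S)\<^sup>2) \<le> ennreal (1 / S\<^sup>2) * ennreal ((U x - S\<^sup>2)\<^sup>2)"
      by (subst ennreal_mult[symmetric]) (auto intro: ennreal_leI)
  qed
  also have "\<dots> = ennreal (1 / S\<^sup>2) * ?D" by (rule nn_integral_cmult) simp
  also have "\<dots> \<le> ennreal (1 / S\<^sup>2) * ennreal ((B + v) * S\<^sup>2)"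
    by (intro mult_left_mono D) simp
  also have "\<dots> = ennreal (B + v)"
    using SB B v by (subst ennreal_mult[symmetric]) auto
  also have "\<dots> \<le> ennreal (2 * B + v)" using B by (intro ennreal_leI) simp
  finally show ?thesis .
qed


section \<open>The kernel estimator of the norm and its risk\<close>

section \<open>The upper bound\<close>

text \<open>The counterpart of \<open>nn_integral_cube_kernel\<close> for the other variable,
  required because the kernel is one-sided.\<close>

lemma nn_integral_cube_kernel_reflect:
  assumes "0 < h"
  shows "(\<integral>\<^sup>+x. ennreal (cube_kernel h (y - x :: real ^ 'd)) \<partial>lborel) = 1"
proof -
  let ?B = "cbox (y - (\<chi> j. h)) y"
  have "(\<integral>\<^sup>+x. ennreal (cube_kernel h (y - x)) \<partial>lborel) =
    (\<integral>\<^sup>+x. ennreal (1 / h ^ CARD('d)) * indicator ?B x \<partial>lborel)"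
    by (intro nn_integral_cong) (auto simp: cube_kernel_def indicator_def mem_box_cart algebra_simps)
  also have "\<dots> = ennreal (1 / h ^ CARD('d)) * emeasure lborel ?B"
    by (subst nn_integral_cmult_indicator) auto
  also have "\<dots> = ennreal (1 / h ^ CARD('d)) * ennreal (h ^ CARD('d))"
    using assms by (subst emeasure_cbox_vec) auto
  also have "\<dots> = 1" using assms by (simp add: ennreal_mult[symmetric] del: ennreal_1 flip: ennreal_1)
  finally show ?thesis .
qed

lemma powr_square: "(x powr b)\<^sup>2 = x powr (2 * b)" for x b :: real
  by (simp add: power2_eq_square powr_add[symmetric])

lemma half_split_bounds:
  assumes "2 \<le> n"
  shows "real n \<le> 3 * real (n div 2)" "real n \<le> 2 * real (n - n div 2)"
proof -
  have "n \<le> 3 * (n div 2)" "n \<le> 2 * (n - n div 2)" using assms by linarith+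
  then have "real n \<le> real (3 * (n div 2))" "real n \<le> real (2 * (n - n div 2))"
    by (simp_all only: of_nat_le_iff)
  then show "real n \<le> 3 * real (n div 2)" "real n \<le> 2 * real (n - n div 2)"
    by (simp_all only: of_nat_mult of_nat_numeral)
qed

text \<open>The value 3 leaves room for the test densities of the lower bound. Their squared norm is
  at most \<open>2 * a\<close> with \<open>a = h powr (2 * b) \<le> 1\<close>, and their first
  differences fit because \<open>8 * a \<le> 9 * h powr (2 * b)\<close>.\<close>

definition iso_params :: "real \<Rightarrow> ('d::finite) params" where
  "iso_params b = \<lparr>smoothness = \<lambda>_. b, integrab = \<lambda>_. 2, qexp = \<infinity>, radius = \<lambda>_. 3, qbound = 3\<rparr>"

text \<open>The order \<open>k\<close> obtained from the class depends on \<open>f\<close>, but the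
  bound of \<open>fdiff_bound_of_fdiff_pow\<close> does not depend on \<open>k\<close>. The constant
  is \<open>108 = 12 * 9\<close>, with 9 the squared radius.\<close>

lemma fclass_iso_paramsD:
  fixes f :: "real ^ 'd \<Rightarrow> real"
  assumes f: "f \<in> fclass (iso_params b)" and b: "0 < b" "b \<le> 1 / 2"
  shows "f \<in> borel_measurable borel" "sq_int f \<le> ennreal 9" "AE x in lborel. \<bar>f x\<bar> \<le> 3"
    "sq_int (fdiff u j f) \<le> ennreal (108 * \<bar>u\<bar> powr (2 * b))"
proof -
  show fm: "f \<in> borel_measurable borel"
    using f by (auto simp: fclass_def nikolskii_def iso_params_def)
  have "Lnorm 2 f \<le> ennreal 3"
    using f by (auto simp: fclass_def nikolskii_def iso_params_def)
  then show fin: "sq_int f \<le> ennreal 9"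
    unfolding Lnorm_2 by (subst (asm) epowr_half_le_iff) (simp_all del: ennreal_numeral)
  have "Lnorm \<infinity> f \<le> ennreal 3"
    using f by (auto simp: fclass_def Lball_def iso_params_def)
  then show "AE x in lborel. \<bar>f x\<bar> \<le> 3"
    by (subst (asm) Lnorm_top_le_iff[OF fm]) auto
  obtain k :: nat where k: "b < real k" "\<And>u. Lnorm 2 ((fdiff u j ^^ k) f) \<le> ennreal (3 * \<bar>u\<bar> powr b)"
    using f by (auto simp: fclass_def nikolskii_def iso_params_def)
  have "sq_int ((fdiff u j ^^ k) f) \<le> ennreal (9 * \<bar>u\<bar> powr (2 * b))" for u
    using k(2)[of u] unfolding Lnorm_2
    by (subst (asm) epowr_half_le_iff) (auto simp: power_mult_distrib powr_square)
  moreover have "sq_int f < \<infinity>" using fin by (auto intro: le_less_trans)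
  moreover have "0 < k" using k(1) b by (cases k) auto
  ultimately have "sq_int (fdiff u j f) \<le> ennreal (12 * 9 * \<bar>u\<bar> powr (2 * b))"
    using b fm by (intro fdiff_bound_of_fdiff_pow[where k = k]) auto
  then show "sq_int (fdiff u j f) \<le> ennreal (108 * \<bar>u\<bar> powr (2 * b))" by simp
qed

text \<open>Each pair joins an observation of the first half of the sample with one of the second
  half. For \<open>2 \<le> n\<close> both halves are nonempty and the statistic is unbiased for
  \<open>smoothed_sq_int h f\<close>.\<close>

definition pair_stat :: "nat \<Rightarrow> real \<Rightarrow> (nat \<Rightarrow> real ^ 'd) \<Rightarrow> real" where
  "pair_stat n h X = (\<Sum>i\<in>{1..n div 2}. \<Sum>j\<in>{n div 2 + 1..n}. cube_kernel h (X j - X i))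
     / (real (n div 2) * real (n - n div 2))"

lemma pair_stat_measurable:
  "(\<lambda>X. sqrt (pair_stat n h X)) \<in> estimators n"
proof -
  have [measurable]: "(\<lambda>X. X i) \<in> measurable (Pi\<^sub>M {1..n} (\<lambda>_. borel)) borel" if "i \<in> {1..n}" for i
    using that by measurable
  have "(\<lambda>X. \<Sum>i\<in>{1..n div 2}. \<Sum>j\<in>{n div 2 + 1..n}. cube_kernel h (X j - X i))
    \<in> borel_measurable (Pi\<^sub>M {1..n} (\<lambda>_. borel))"
    by (intro borel_measurable_sum) measurable
  then show ?thesis unfolding estimators_def pair_stat_def by measurable
qed

text \<open>The mean of the statistic differs from the squared norm by the smoothing bias. In the
  variance, the bound 3 on the density serves as \<open>Q\<close> and \<open>1 / h ^ d\<close> as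
  \<open>H\<close>. Then \<open>sqrt_estimator_error\<close> passes from the squared norm to the
  norm.\<close>

lemma pair_stat_mse:
  fixes f :: "real ^ 'd \<Rightarrow> real"
  assumes f: "f \<in> fclass (iso_params b)" "f \<in> L2_densities" and b: "0 < b" "b \<le> 1 / 2"
    and n: "2 \<le> n" and h: "0 < h"
  shows "(\<integral>\<^sup>+X. ennreal ((sqrt (pair_stat n h X) - enn2real (Lnorm 2 f))\<^sup>2) \<partial>sample_law n f)
    \<le> ennreal (2 * (4 ^ CARD('d) * (108 * h powr (2 * b)))
        + (3 / real (n div 2) + 3 / real (n - n div 2) + 1 / (h ^ CARD('d) * real (n div 2) * real (n - n div 2))))"
proof -
  note fD = fclass_iso_paramsD[OF f(1) b]
  note fD(1)[measurable]
  have f0: "0 \<le> f x" for x using f(2) by (auto simp: L2_densities_def)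
  have f1: "(\<integral>\<^sup>+x. ennreal (f x) \<partial>lborel) = 1" using f(2) by (auto simp: L2_densities_def)
  define P where "P = density lborel (\<lambda>x. ennreal (f x))"
  have [measurable_cong]: "sets P = sets borel" by (simp add: P_def)
  interpret P: prob_space P
    by standard (simp add: P_def emeasure_density f1)
  let ?I = "{1..n div 2}" and ?J = "{n div 2 + 1..n}"
  have IJ: "?I \<inter> ?J = {}" "finite ?I" "finite ?J" by auto
  have U: "?I \<union> ?J = {1..n}" using n by auto
  have law: "sample_law n f = Pi\<^sub>M (?I \<union> ?J) (\<lambda>_. P)"
    unfolding sample_law_def U P_def ..
  interpret S: prob_space "Pi\<^sub>M (?I \<union> ?J) (\<lambda>_. P)"
    by (intro prob_space_PiM P.prob_space_axioms)
  define m where "m = real (n div 2)"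
  define m' where "m' = real (n - n div 2)"
  have m: "0 < m" "0 < m'" using n by (auto simp: m_def m'_def)
  let ?k = "\<lambda>x y. ennreal (cube_kernel h (y - x :: real ^ 'd))"
  have km: "case_prod ?k \<in> borel_measurable (P \<Otimes>\<^sub>M P)" by measurable
  have fAE: "AE x in lborel. ennreal (f x) \<le> 3" 
    using fD(3)
  proof eventually_elim
    case (elim x)
    then have "ennreal (f x) \<le> ennreal 3" by (intro ennreal_leI) simp
    then show ?case by simp
  qed
  have Q1: "(\<integral>\<^sup>+y. ?k x y \<partial>P) \<le> ennreal 3" for x
  proof -
    have "(\<integral>\<^sup>+y. ?k x y \<partial>P) = (\<integral>\<^sup>+y. ennreal (f y) * ?k x y \<partial>lborel)"
      unfolding P_def by (subst nn_integral_density) auto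
    also have "\<dots> \<le> (\<integral>\<^sup>+y. 3 * ?k x y \<partial>lborel)"
      by (rule nn_integral_mono_AE) (use fAE in eventually_elim, auto intro: mult_right_mono)
    also have "\<dots> = 3 * (\<integral>\<^sup>+y. ennreal (cube_kernel h y) \<partial>(lborel :: (real ^ 'd) measure))"
      using nn_integral_lborel_shift[of "\<lambda>y. ennreal (cube_kernel h y)" "- x"]
      by (subst nn_integral_cmult) auto
    finally show ?thesis by (simp add: nn_integral_cube_kernel[OF h])
  qed
  have Q2: "(\<integral>\<^sup>+x. ?k x y \<partial>P) \<le> ennreal 3" for y
  proof -
    have "(\<integral>\<^sup>+x. ?k x y \<partial>P) = (\<integral>\<^sup>+x. ennreal (f x) * ?k x y \<partial>lborel)"
      unfolding P_def by (subst nn_integral_density) auto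
    also have "\<dots> \<le> (\<integral>\<^sup>+x. 3 * ?k x y \<partial>lborel)"
      by (rule nn_integral_mono_AE) (use fAE in eventually_elim, auto intro: mult_right_mono)
    also have "\<dots> = 3 * (\<integral>\<^sup>+x. ?k x y \<partial>lborel)"
      by (subst nn_integral_cmult) auto
    finally show ?thesis by (simp add: nn_integral_cube_kernel_reflect[OF h])
  qed
  have H: "?k x y \<le> ennreal (1 / h ^ CARD('d))" for x y
    by (intro ennreal_leI cube_kernel_le h)
  let ?\<theta> = "\<integral>\<^sup>+x. \<integral>\<^sup>+y. ?k x y \<partial>P \<partial>P"
  have \<theta>_eq: "?\<theta> = smoothed_sq_int h f"
  proof -
    have intP: "(\<integral>\<^sup>+x. g x \<partial>P) = (\<integral>\<^sup>+x. ennreal (f x) * g x \<partial>lborel)"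
      if "g \<in> borel_measurable borel" for g :: "real ^ 'd \<Rightarrow> ennreal"
      unfolding P_def using that by (subst nn_integral_density) auto
    have "(\<lambda>x. \<integral>\<^sup>+y. ?k x y \<partial>P) \<in> borel_measurable borel"
      by (rule P.borel_measurable_nn_integral) measurable
    then have "?\<theta> = (\<integral>\<^sup>+x. ennreal (f x) * (\<integral>\<^sup>+y. ?k x y \<partial>P) \<partial>lborel)"
      by (rule intP)
    also have "\<dots> = (\<integral>\<^sup>+x. ennreal (f x) * (\<integral>\<^sup>+y. ?k x y * ennreal (f y) \<partial>lborel) \<partial>lborel)"
      by (subst intP) (auto simp: mult.commute)
    also have "\<dots> = smoothed_sq_int h f"
      unfolding smoothed_sq_int_def by (intro nn_integral_cong, subst nn_integral_cmult) auto
    finally show ?thesis .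
  qed
  define B where "B = 4 ^ CARD('d) * (108 * h powr (2 * b))"
  have B0: "0 \<le> B" by (simp add: B_def)
  have "sq_int (fdiff u j f) \<le> ennreal (108 * h powr (2 * b))" if "\<bar>u\<bar> \<le> h" for u j
    using that b by (intro order_trans[OF fD(4)] ennreal_leI mult_left_mono powr_mono2) auto
  then have bias: "smoothed_sq_int h f \<le> sq_int f" "sq_int f \<le> smoothed_sq_int h f + ennreal B"
    unfolding B_def using smoothed_sq_int_bias[OF fD(1) f0 h, of "108 * h powr (2 * b)"] by auto
  define t where "t = enn2real (smoothed_sq_int h f)"
  define s where "s = enn2real (sq_int f)"
  have sfin: "sq_int f = ennreal s" 
    using fD(2) unfolding s_def by (metis ennreal_enn2real_if ennreal_less_top neq_top_trans less_top)
  have tfin: "smoothed_sq_int h f = ennreal t"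
    using bias(1) unfolding t_def sfin by (metis ennreal_enn2real_if ennreal_less_top neq_top_trans less_top)
  have t0: "0 \<le> t" "0 \<le> s" by (simp_all add: t_def s_def)
  have ts: "t \<le> s" "s \<le> t + B"
    using bias t0 B0 unfolding tfin sfin by (simp_all add: ennreal_plus[symmetric] del: ennreal_plus)
  define v where "v = 3 / m + 3 / m' + 1 / (h ^ CARD('d) * m * m')"
  have v0: "0 \<le> v" using m h by (simp add: v_def)
  let ?c = "ennreal (1 / (m * m'))"
  let ?T = "\<lambda>X. \<Sum>i\<in>?I. \<Sum>j\<in>?J. ?k (X i) (X j)"
  have Tm[measurable]: "?T \<in> borel_measurable (Pi\<^sub>M (?I \<union> ?J) (\<lambda>_. P))"
    by (intro borel_measurable_sum) measurable
  have stat: "ennreal (pair_stat n h X) = ?c * ?T X" for X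
  proof -
    have "?T X = ennreal (\<Sum>i\<in>?I. \<Sum>j\<in>?J. cube_kernel h (X j - X i))"
      by (simp add: sum_ennreal sum_nonneg cube_kernel_nonneg h)
    then show ?thesis
      using m by (simp add: pair_stat_def m_def[symmetric] m'_def[symmetric] ennreal_mult[symmetric]
          sum_nonneg cube_kernel_nonneg h)
  qed
  have card: "of_nat (card ?I) = ennreal m" "of_nat (card ?J) = ennreal m'"
    by (simp_all add: m_def m'_def ennreal_of_nat_eq_real_of_nat)
  note mom = P.bilinear_sum_moments[OF IJ km Q1 Q2 H, unfolded \<theta>_eq tfin card]
  have "(\<integral>\<^sup>+X. ennreal (pair_stat n h X) \<partial>Pi\<^sub>M (?I \<union> ?J) (\<lambda>_. P)) = ?c * (ennreal m * ennreal m' * ennreal t)"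
    unfolding stat mom(1)[symmetric] by (rule nn_integral_cmult[OF Tm])
  also have "\<dots> = ennreal t"
    using m t0 by (simp add: ennreal_mult[symmetric])
  finally have E1: "(\<integral>\<^sup>+X. ennreal (pair_stat n h X) \<partial>Pi\<^sub>M (?I \<union> ?J) (\<lambda>_. P)) = ennreal t" .
  have "(\<integral>\<^sup>+X. (ennreal (pair_stat n h X))\<^sup>2 \<partial>Pi\<^sub>M (?I \<union> ?J) (\<lambda>_. P)) =
      ?c\<^sup>2 * (\<integral>\<^sup>+X. (?T X)\<^sup>2 \<partial>Pi\<^sub>M (?I \<union> ?J) (\<lambda>_. P))"
    unfolding stat power_mult_distrib by (rule nn_integral_cmult) measurable
  also have "\<dots> \<le> ?c\<^sup>2 * ((ennreal m * ennreal m' * ennreal t)\<^sup>2 + (ennreal m * (ennreal m')\<^sup>2 * ennreal 3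
      + (ennreal m)\<^sup>2 * ennreal m' * ennreal 3 + ennreal m * ennreal m' * ennreal (1 / h ^ CARD('d))) * ennreal t)"
    by (intro mult_left_mono mom(2)) simp
  also have "\<dots> = ennreal ((1 / (m * m'))\<^sup>2 * ((m * m' * t)\<^sup>2 + (m * m'\<^sup>2 * 3 + m\<^sup>2 * m' * 3 + m * m' * (1 / h ^ CARD('d))) * t))"
    using m t0 h
    by (simp only: ennreal_mult[symmetric] ennreal_power ennreal_plus[symmetric] mult_nonneg_nonneg
        add_nonneg_nonneg zero_le_power zero_le_divide_1_iff order_less_imp_le zero_le_numeral zero_le_power2 )
  also have "(1 / (m * m'))\<^sup>2 * ((m * m' * t)\<^sup>2 + (m * m'\<^sup>2 * 3 + m\<^sup>2 * m' * 3 + m * m' * (1 / h ^ CARD('d))) * t)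
     = t\<^sup>2 + v * t"
    using m h unfolding v_def by (simp add: field_simps power2_eq_square)
  finally have E2: "(\<integral>\<^sup>+X. (ennreal (pair_stat n h X))\<^sup>2 \<partial>Pi\<^sub>M (?I \<union> ?J) (\<lambda>_. P)) \<le> ennreal (t\<^sup>2 + v * t)" .
  have pm: "(\<lambda>X. pair_stat n h X) \<in> borel_measurable (Pi\<^sub>M (?I \<union> ?J) (\<lambda>_. P))"
  proof -
    have "(\<lambda>X. \<Sum>i\<in>?I. \<Sum>j\<in>?J. cube_kernel h (X j - X i)) \<in> borel_measurable (Pi\<^sub>M (?I \<union> ?J) (\<lambda>_. P))"
      by (intro borel_measurable_sum) measurable
    then show ?thesis unfolding pair_stat_def by measurable
  qed
  have pn: "0 \<le> pair_stat n h X" for X :: "nat \<Rightarrow> real ^ 'd"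
    by (simp add: pair_stat_def sum_nonneg cube_kernel_nonneg h)
  have "(\<integral>\<^sup>+X. ennreal ((sqrt (pair_stat n h X) - sqrt s)\<^sup>2) \<partial>Pi\<^sub>M (?I \<union> ?J) (\<lambda>_. P)) \<le> ennreal (2 * B + v)"
    by (rule S.sqrt_estimator_error[OF pm pn E1 E2 v0 B0]) (use t0 ts in auto)
  then show ?thesis
    unfolding law enn2real_Lnorm_2 s_def[symmetric] B_def v_def m_def m'_def by simp
qed

text \<open>The minimax exponent of \<open>iso_params b\<close>, as shown in
  \<open>rate_exponent_iso_params\<close>. The type argument carries the dimension
  \<open>d\<close>.\<close>

definition iso_exponent :: "'d itself \<Rightarrow> real \<Rightarrow> real" where
  "iso_exponent _ b = 2 * b / (2 * b + real CARD('d))"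

lemma risk_le_iff:
  assumes "0 \<le> c"
  shows "risk n N F \<le> ennreal c \<longleftrightarrow>
    (\<forall>f \<in> F \<inter> L2_densities. (\<integral>\<^sup>+X. ennreal ((N X - enn2real (Lnorm 2 f))\<^sup>2) \<partial>sample_law n f) \<le> ennreal (c\<^sup>2))"
  using assms by (simp add: risk_def SUP_le_iff epowr_half_le_iff)

text \<open>The width balances \<open>h powr (2 * b)\<close> against
  \<open>1 / (n^2 * h ^ d)\<close>: both are \<open>n powr (- 2 * z)\<close>. The terms of order
  \<open>1 / n\<close> are no larger, because \<open>2 * b \<le> d\<close> gives
  \<open>2 * z \<le> 1\<close>. In the constant, \<open>216 = 2 * 108\<close> and
  \<open>21 = 9 + 6 + 6\<close>.\<close>

lemma pair_stat_risk:
  assumes b: "0 < b" "b \<le> 1 / 2" and n: "2 \<le> n"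
  defines "z \<equiv> iso_exponent TYPE('d::finite) b"
  defines "h \<equiv> real n powr (- 2 / (2 * b + real CARD('d)))"
  shows "risk n (\<lambda>X. sqrt (pair_stat n h X)) (fclass (iso_params b :: 'd params))
     \<le> ennreal (sqrt (216 * 4 ^ CARD('d) + 21) * real n powr (- z))"
proof (subst risk_le_iff, simp, intro ballI)
  fix f :: "real ^ 'd \<Rightarrow> real" assume f: "f \<in> fclass (iso_params b) \<inter> L2_densities"
  let ?d = "real CARD('d)"
  have d: "1 \<le> ?d" by (simp add: Suc_leI)
  have h: "0 < h" using n by (simp add: h_def)
  have hb: "h powr (2 * b) = real n powr (- 2 * z)"
    using n by (simp add: h_def powr_powr z_def iso_exponent_def mult.commute)
  have "3 / real (n div 2) \<le> 9 / n" "3 / real (n - n div 2) \<le> 6 / n"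
  proof -
    note half_split_bounds[OF n]
    then show "3 / real (n div 2) \<le> 9 / n" "3 / real (n - n div 2) \<le> 6 / n"
      using n by (auto simp: divide_simps)
  qed
  moreover have "1 / (h ^ CARD('d) * real (n div 2) * real (n - n div 2)) \<le> 6 * real n powr (- 2 * z)"
  proof -
    note half_split_bounds[OF n]
    then have "real n * real n \<le> (3 * real (n div 2)) * (2 * real (n - n div 2))"
      by (intro mult_mono) auto
    also have "\<dots> = 6 * (real (n div 2) * real (n - n div 2))" by (simp only: mult_ac)
    finally have "1 / (real (n div 2) * real (n - n div 2)) \<le> 6 / (real n * real n)"
      using n by (auto simp: divide_simps)
    then have "1 / h ^ CARD('d) * (1 / (real (n div 2) * real (n - n div 2))) 
        \<le> 1 / h ^ CARD('d) * (6 / (real n * real n))"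
      using h by (intro mult_left_mono) auto
    also have "1 / h ^ CARD('d) * (6 / (real n * real n)) = 6 * real n powr (- 2 * z)"
    proof -
      have hd: "h ^ CARD('d) = real n powr (- 2 * ?d / (2 * b + ?d))"
        using h n by (simp add: powr_realpow[symmetric] h_def powr_powr)
      have "real n * real n = real n powr 2" using n by (simp add: powr_numeral power2_eq_square)
      then have "1 / h ^ CARD('d) * (6 / (real n * real n))
         = 6 * (real n powr (2 * ?d / (2 * b + ?d)) * real n powr (- 2))"
        unfolding hd by (simp add: powr_minus field_simps)
      also have "\<dots> = 6 * real n powr (2 * ?d / (2 * b + ?d) - 2)"
        by (simp add: powr_add[symmetric])
      also have "2 * ?d / (2 * b + ?d) - 2 = - 2 * z"
        using b d by (simp add: z_def iso_exponent_def field_simps)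
      finally show ?thesis .
    qed
    finally show ?thesis by (simp add: mult.assoc)
  qed
  moreover have "1 / real n \<le> real n powr (- 2 * z)"
  proof -
    have "2 * b \<le> ?d" using b d by linarith
    then have "2 * z \<le> 1" using b by (simp add: z_def iso_exponent_def field_simps)
    then have "real n powr (- 1) \<le> real n powr (- 2 * z)" using n by (intro powr_mono) auto
    then show ?thesis using n by (simp add: powr_minus_divide)
  qed
  ultimately have "2 * (4 ^ CARD('d) * (108 * h powr (2 * b)))
        + (3 / real (n div 2) + 3 / real (n - n div 2) + 1 / (h ^ CARD('d) * real (n div 2) * real (n - n div 2)))
     \<le> (216 * 4 ^ CARD('d) + 21) * real n powr (- 2 * z)"
    unfolding hb by (simp add: algebra_simps)
  also have "\<dots> = (sqrt (216 * 4 ^ CARD('d) + 21) * real n powr (- z))\<^sup>2"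
    by (simp add: power_mult_distrib powr_square)
  finally have "ennreal (2 * (4 ^ CARD('d) * (108 * h powr (2 * b)))
        + (3 / real (n div 2) + 3 / real (n - n div 2) + 1 / (h ^ CARD('d) * real (n div 2) * real (n - n div 2))))
     \<le> ennreal ((sqrt (216 * 4 ^ CARD('d) + 21) * real n powr (- z))\<^sup>2)"
    by (rule ennreal_leI)
  then show "(\<integral>\<^sup>+X. ennreal ((sqrt (pair_stat n h X) - enn2real (Lnorm 2 f))\<^sup>2) \<partial>sample_law n f)
     \<le> ennreal ((sqrt (216 * 4 ^ CARD('d) + 21) * real n powr (- z))\<^sup>2)"
    using f by (intro order_trans[OF pair_stat_mse[OF _ _ b n h]]) auto
qed


section \<open>Step functions on cubes: norms, smoothness and class membership\<close>

section \<open>Piecewise constant densities\<close>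

text \<open>Half-open cubes, so that distinct cells are disjoint. The index
  \<open>\<lambda>_. 0\<close> with a larger side also gives the large cube.\<close>

definition cell :: "real \<Rightarrow> ('d \<Rightarrow> nat) \<Rightarrow> (real ^ 'd) set" where
  "cell h c = {x. \<forall>j. h * real (c j) \<le> x $ j \<and> x $ j < h * (real (c j) + 1)}"

lemma cell_measurable[measurable]: "cell h (c :: 'd::finite \<Rightarrow> nat) \<in> sets borel"
proof -
  have "cell h c = (\<Inter>j. {x. h * real (c j) \<le> x $ j} \<inter> {x. x $ j < h * (real (c j) + 1)})"
    by (auto simp: cell_def)
  also have "\<dots> \<in> sets borel"
    by (intro sets.finite_INT sets.Int) measurable
  finally show ?thesis .
qed

lemma emeasure_cell:
  assumes "0 < h"
  shows "emeasure lborel (cell h (c :: 'd::finite \<Rightarrow> nat)) = ennreal (h ^ CARD('d))"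
proof (rule antisym)
  let ?l = "(\<chi> j. h * real (c j)) :: real ^ 'd" and ?u = "(\<chi> j. h * (real (c j) + 1)) :: real ^ 'd"
  have c: "emeasure lborel (cbox ?l ?u) = ennreal (h ^ CARD('d))"
    using assms by (subst emeasure_cbox_vec) (auto simp: algebra_simps)
  have "emeasure lborel (cell h c) \<le> emeasure lborel (cbox ?l ?u)"
    by (intro emeasure_mono) (auto simp: cell_def mem_box_cart less_imp_le)
  then show "emeasure lborel (cell h c) \<le> ennreal (h ^ CARD('d))" unfolding c .
  have "ennreal (h ^ CARD('d)) = emeasure lborel (box ?l ?u)"
    unfolding c[symmetric] by (simp add: emeasure_lborel_cbox_eq emeasure_lborel_box_eq)
  also have "\<dots> \<le> emeasure lborel (cell h c)"
    by (intro emeasure_mono) (auto simp: cell_def mem_box_cart less_imp_le)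
  finally show "ennreal (h ^ CARD('d)) \<le> emeasure lborel (cell h c)" .
qed

lemma cell_disjoint:
  assumes "0 < h" "c \<noteq> c'"
  shows "cell h c \<inter> cell h c' = {}"
proof (rule ccontr)
  assume "cell h c \<inter> cell h c' \<noteq> {}"
  then obtain x where x: "x \<in> cell h c" "x \<in> cell h c'" by auto
  obtain j where j: "c j \<noteq> c' j" using assms(2) by auto
  have "h * real (c j) < h * (real (c' j) + 1)" "h * real (c' j) < h * (real (c j) + 1)"
    using x by (auto simp: cell_def intro: le_less_trans)
  then have "real (c j) < real (c' j) + 1" "real (c' j) < real (c j) + 1"
    using assms(1) by auto
  then show False using j by linarith
qed

text \<open>A point that leaves the cell lies in a slab of thickness \<open>\<bar>u\<bar>\<close>
  along one face orthogonal to axis \<open>j\<close>: the upper face for \<open>u \<ge> 0\<close>,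
  the lower one otherwise. \<open>?lj\<close> is the lower end of this slab.\<close>

lemma emeasure_cell_escape:
  assumes h: "0 < h" and u: "\<bar>u\<bar> \<le> h"
  shows "emeasure lborel {x \<in> cell h (c :: 'd::finite \<Rightarrow> nat). x + u *\<^sub>R axis j 1 \<notin> cell h c}
    \<le> ennreal (\<bar>u\<bar> / h * h ^ CARD('d))"
proof -
  let ?lj = "if 0 \<le> u then h * (real (c j) + 1) - u else h * real (c j)"
  let ?l = "(\<chi> i. if i = j then ?lj else h * real (c i)) :: real ^ 'd"
  let ?u = "(\<chi> i. if i = j then ?lj + \<bar>u\<bar> else h * (real (c i) + 1)) :: real ^ 'd"
  have "{x \<in> cell h c. x + u *\<^sub>R axis j 1 \<notin> cell h c} \<subseteq> cbox ?l ?u"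
  proof
    fix x assume "x \<in> {x \<in> cell h c. x + u *\<^sub>R axis j 1 \<notin> cell h c}"
    then have x: "\<And>i. h * real (c i) \<le> x $ i" "\<And>i. x $ i < h * (real (c i) + 1)"
      and "x + u *\<^sub>R axis j 1 \<notin> cell h c" by (auto simp: cell_def)
    then obtain i where i: "\<not> (h * real (c i) \<le> x $ i + u * (if i = j then 1 else 0) \<and>
        x $ i + u * (if i = j then 1 else 0) < h * (real (c i) + 1))"
      by (auto simp: cell_def axis_def)
    then have "i = j" using x by (auto split: if_splits)
    then have "x $ j + u < h * real (c j) \<or> h * (real (c j) + 1) \<le> x $ j + u" using i by auto
    then have "?lj \<le> x $ j \<and> x $ j \<le> ?lj + \<bar>u\<bar>"
      using x(1)[of j] x(2)[of j] by (auto split: if_splits)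
    then show "x \<in> cbox ?l ?u" using x by (auto simp: mem_box_cart less_imp_le)
  qed
  then have "emeasure lborel {x \<in> cell h c. x + u *\<^sub>R axis j 1 \<notin> cell h c} \<le> emeasure lborel (cbox ?l ?u)"
    by (intro emeasure_mono) auto
  also have "\<dots> = ennreal (\<Prod>i\<in>UNIV. ?u $ i - ?l $ i)"
    using h by (intro emeasure_cbox_vec) auto
  also have "(\<Prod>i\<in>UNIV. ?u $ i - ?l $ i) = (\<Prod>i\<in>UNIV. h * (if i = j then \<bar>u\<bar> / h else 1))"
    using h by (intro prod.cong) (auto simp: algebra_simps)
  also have "\<dots> = \<bar>u\<bar> / h * h ^ CARD('d)"
    by (simp add: prod.distrib prod.delta)
  finally show ?thesis .
qed

definition bump :: "real \<Rightarrow> real \<Rightarrow> ('d \<Rightarrow> nat) set \<Rightarrow> real ^ 'd \<Rightarrow> real" where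
  "bump v h S = (\<lambda>x. v * indicator (\<Union>c\<in>S. cell h c) x)"

lemma measurable_bump[measurable]: 
  "finite (S :: ('d::finite \<Rightarrow> nat) set) \<Longrightarrow> bump v h S \<in> borel_measurable borel"
  unfolding bump_def by measurable

lemma nn_integral_scaled_cells:
  assumes h: "0 < h" and S: "finite (S :: ('d::finite \<Rightarrow> nat) set)" and w: "0 \<le> w"
  shows "(\<integral>\<^sup>+x. ennreal (w * indicator (\<Union>c\<in>S. cell h c) x) \<partial>lborel) = ennreal (w * (real (card S) * h ^ CARD('d)))"
proof -
  have "(\<integral>\<^sup>+x. ennreal (w * indicator (\<Union>c\<in>S. cell h c) x) \<partial>lborel)
     = (\<integral>\<^sup>+x. ennreal w * indicator (\<Union>c\<in>S. cell h c) x \<partial>lborel)"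
    by (intro nn_integral_cong) (auto simp: indicator_def)
  also have "\<dots> = ennreal w * emeasure lborel (\<Union>c\<in>S. cell h c)"
    using S by (intro nn_integral_cmult_indicator) auto
  also have "emeasure lborel (\<Union>c\<in>S. cell h c) = (\<Sum>c\<in>S. emeasure lborel (cell h c))"
    using S cell_disjoint[OF h]
    by (intro sum_emeasure[symmetric]) (auto simp: disjoint_family_on_def)
  also have "\<dots> = ennreal (real (card S) * h ^ CARD('d))"
    using h by (simp add: emeasure_cell ennreal_mult ennreal_of_nat_eq_real_of_nat)
  finally show ?thesis using h w by (simp add: ennreal_mult)
qed

lemma nn_integral_bump:
  assumes "0 < h" "finite (S :: ('d::finite \<Rightarrow> nat) set)" "0 \<le> v"
  shows "(\<integral>\<^sup>+x. ennreal (bump v h S x) \<partial>lborel) = ennreal (v * (real (card S) * h ^ CARD('d)))"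
  unfolding bump_def by (rule nn_integral_scaled_cells[OF assms])

lemma sq_int_bump:
  assumes "0 < h" "finite (S :: ('d::finite \<Rightarrow> nat) set)"
  shows "sq_int (bump v h S) = ennreal (v\<^sup>2 * (real (card S) * h ^ CARD('d)))"
proof -
  have "sq_int (bump v h S) = (\<integral>\<^sup>+x. ennreal (v\<^sup>2 * indicator (\<Union>c\<in>S. cell h c) x) \<partial>lborel)"
    unfolding sq_int_def bump_def by (intro nn_integral_cong) (auto simp: indicator_def)
  also have "\<dots> = ennreal (v\<^sup>2 * (real (card S) * h ^ CARD('d)))"
    by (rule nn_integral_scaled_cells[OF assms]) simp
  finally show ?thesis .
qed

text \<open>The difference can be nonzero only if exactly one of \<open>x\<close> and the shifted
  point lies in the union. Then \<open>x\<close> leaves its cell under the shift by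
  \<open>u\<close>, or the shifted point leaves its cell under the shift by \<open>- u\<close>. The
  factor 2 counts these two cases.\<close>

lemma sq_int_fdiff_bump_small:
  assumes h: "0 < h" and S: "finite (S :: ('d::finite \<Rightarrow> nat) set)" and u: "\<bar>u\<bar> \<le> h"
  shows "sq_int (fdiff u j (bump v h S)) \<le> ennreal (2 * (\<bar>u\<bar> / h) * (v\<^sup>2 * (real (card S) * h ^ CARD('d))))"
proof -
  let ?e = "u *\<^sub>R axis j 1 :: real ^ 'd"
  let ?E = "\<lambda>u c. {x \<in> cell h c. x + u *\<^sub>R axis j 1 \<notin> cell h c}"
  have Em[measurable]: "?E u c \<in> sets borel" for u c
  proof -
    have "(\<lambda>x :: real ^ 'd. x + u *\<^sub>R axis j 1) -` cell h c \<inter> space borel \<in> sets borel"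
      by (rule measurable_sets[OF _ cell_measurable]) measurable
    then have "cell h c - (\<lambda>x :: real ^ 'd. x + u *\<^sub>R axis j 1) -` cell h c \<in> sets borel" by auto
    also have "cell h c - (\<lambda>x :: real ^ 'd. x + u *\<^sub>R axis j 1) -` cell h c = ?E u c" by auto
    finally show ?thesis .
  qed
  have "sq_int (fdiff u j (bump v h S)) \<le>
    (\<integral>\<^sup>+x. ennreal (v\<^sup>2) * (\<Sum>c\<in>S. indicator (?E u c) x + indicator (?E (- u) c) (x + ?e)) \<partial>lborel)"
    unfolding sq_int_def
  proof (rule nn_integral_mono)
    fix x
    let ?U = "\<Union>c\<in>S. cell h c"
    let ?G = "\<Sum>c\<in>S. indicator (?E u c) x + indicator (?E (- u) c) (x + ?e) :: ennreal"
    show "ennreal ((fdiff u j (bump v h S) x)\<^sup>2) \<le> ennreal (v\<^sup>2) * ?G"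
    proof (cases "x \<in> ?U \<longleftrightarrow> x + ?e \<in> ?U")
      case True
      then have "fdiff u j (bump v h S) x = 0" by (simp add: fdiff_def bump_def indicator_def)
      then show ?thesis by simp
    next
      case False
      then have "(fdiff u j (bump v h S) x)\<^sup>2 = v\<^sup>2" by (auto simp: fdiff_def bump_def indicator_def)
      moreover have "1 \<le> ?G"
      proof -
        from False obtain c where c: "c \<in> S" "x \<in> ?E u c \<or> x + ?e \<in> ?E (- u) c" by auto
        then have "(1::ennreal) \<le> indicator (?E u c) x + indicator (?E (- u) c) (x + ?e)"
          by (auto simp: indicator_def)
        also have "\<dots> \<le> ?G" using c S by (intro member_le_sum) auto
        finally show ?thesis .
      qed
      ultimately show ?thesis using mult_left_mono[of 1 ?G "ennreal (v\<^sup>2)"] by simp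
    qed
  qed
  also have "\<dots> = ennreal (v\<^sup>2) * (\<Sum>c\<in>S. (\<integral>\<^sup>+x. indicator (?E u c) x \<partial>lborel)
      + (\<integral>\<^sup>+x. indicator (?E (- u) c) (x + ?e) \<partial>lborel))"
    using S by (simp add: nn_integral_cmult nn_integral_sum nn_integral_add)
  also have "\<dots> = ennreal (v\<^sup>2) * (\<Sum>c\<in>S. emeasure lborel (?E u c) + emeasure lborel (?E (- u) c))"
    by (subst nn_integral_lborel_shift) simp_all
  also have "\<dots> \<le> ennreal (v\<^sup>2) * (\<Sum>c\<in>S. ennreal (\<bar>u\<bar> / h * h ^ CARD('d)) + ennreal (\<bar>- u\<bar> / h * h ^ CARD('d)))"
    using u by (intro mult_left_mono sum_mono add_mono emeasure_cell_escape h) auto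
  also have "\<dots> = ennreal (2 * (\<bar>u\<bar> / h) * (v\<^sup>2 * (real (card S) * h ^ CARD('d))))"
  proof -
    have "ennreal (\<bar>u\<bar> / h * h ^ CARD('d)) + ennreal (\<bar>- u\<bar> / h * h ^ CARD('d)) 
      = ennreal (\<bar>u\<bar> / h * h ^ CARD('d) + \<bar>- u\<bar> / h * h ^ CARD('d))"
      using h by (intro ennreal_plus[symmetric]) auto
    then have "(\<Sum>c\<in>S. ennreal (\<bar>u\<bar> / h * h ^ CARD('d)) + ennreal (\<bar>- u\<bar> / h * h ^ CARD('d)))
      = ennreal (real (card S) * (2 * (\<bar>u\<bar> / h * h ^ CARD('d))))"
      by (simp only: sum_constant ennreal_of_nat_eq_real_of_nat)
         (use h in \<open>simp add: ennreal_mult[symmetric]\<close>)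
    then show ?thesis using h by (simp add: ennreal_mult[symmetric] mult_ac)
  qed
  finally show ?thesis .
qed

text \<open>For \<open>\<bar>u\<bar> \<le> h\<close> the linear bound is below the power because
  \<open>2 * b \<le> 1\<close>. For larger \<open>u\<close> the parallelogram bound
  \<open>4 * sq_int\<close> suffices, the power being at least 1.\<close>

lemma sq_int_fdiff_bump:
  assumes h: "0 < h" and S: "finite (S :: ('d::finite \<Rightarrow> nat) set)" and b: "0 < b" "b \<le> 1 / 2"
  shows "sq_int (fdiff u j (bump v h S))
    \<le> ennreal (4 * (v\<^sup>2 * (real (card S) * h ^ CARD('d))) * (\<bar>u\<bar> / h) powr (2 * b))"
proof -
  let ?s = "v\<^sup>2 * (real (card S) * h ^ CARD('d))"
  have s: "0 \<le> ?s" using h by simp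
  show ?thesis
  proof (cases "\<bar>u\<bar> \<le> h")
    case True
    have "\<bar>u\<bar> / h \<le> (\<bar>u\<bar> / h) powr (2 * b)"
    proof (cases "u = 0")
      case False
      then have "(\<bar>u\<bar> / h) powr 1 \<le> (\<bar>u\<bar> / h) powr (2 * b)"
        using h b True by (intro powr_mono') auto
      then show ?thesis using h by simp
    qed simp
    then have "2 * (\<bar>u\<bar> / h) * ?s \<le> 4 * (\<bar>u\<bar> / h) powr (2 * b) * ?s"
      using h by (intro mult_right_mono s mult_mono) auto
    then show ?thesis
      by (intro order_trans[OF sq_int_fdiff_bump_small[OF h S True]] ennreal_leI) (simp add: mult_ac)
  next
    case False
    have "sq_int (fdiff u j (bump v h S)) \<le> sq_int (fdiff u j (bump v h S)) + sq_int (fplus u j (bump v h S))"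
      by simp
    also have "\<dots> = 4 * ennreal ?s"
      using S by (subst sq_int_parallelogram) (auto simp: sq_int_bump[OF h S])
    also have "\<dots> = ennreal (4 * ?s)" using s by (simp add: ennreal_mult)
    also have "\<dots> \<le> ennreal (4 * ?s * (\<bar>u\<bar> / h) powr (2 * b))"
    proof (rule ennreal_leI)
      have "1 \<le> (\<bar>u\<bar> / h) powr (2 * b)" using False h b by (intro ge_one_powr_ge_zero) auto
      then show "4 * ?s \<le> 4 * ?s * (\<bar>u\<bar> / h) powr (2 * b)"
        using mult_left_mono[of 1 "(\<bar>u\<bar> / h) powr (2 * b)" "4 * ?s"] s by simp
    qed
    finally show ?thesis .
  qed
qed

text \<open>Differences of order 1 are admissible since \<open>b < 1\<close>. Assumption
  \<open>s\<close> compares the squared norm with the squared radius 9; \<open>sh\<close> does the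
  same for the constant of \<open>sq_int_fdiff_bump\<close> once \<open>h powr (2 * b)\<close> is
  cleared.\<close>

lemma bump_in_fclass:
  assumes h: "0 < h" and S: "finite (S :: ('d::finite \<Rightarrow> nat) set)" and b: "0 < b" "b \<le> 1 / 2"
    and v: "0 \<le> v" "v \<le> 3" and s: "v\<^sup>2 * (real (card S) * h ^ CARD('d)) \<le> 9"
    and sh: "4 * (v\<^sup>2 * (real (card S) * h ^ CARD('d))) \<le> 9 * h powr (2 * b)"
  shows "bump v h S \<in> fclass (iso_params b)"
proof -
  let ?f = "bump v h S" and ?s = "v\<^sup>2 * (real (card S) * h ^ CARD('d))"
  have fm[measurable]: "?f \<in> borel_measurable borel" using S by measurable
  have 1: "Lnorm 2 ?f \<le> ennreal 3"
    unfolding Lnorm_2 sq_int_bump[OF h S]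
    by (subst epowr_half_le_iff) (use s in \<open>auto simp del: ennreal_numeral intro: ennreal_leI\<close>)
  have 2: "Lnorm \<infinity> ?f \<le> ennreal 3"
    using v by (subst Lnorm_top_le_iff) (auto simp: bump_def indicator_def)
  have 3: "Lnorm 2 ((fdiff u j ^^ 1) ?f) \<le> ennreal (3 * \<bar>u\<bar> powr b)" for u j
  proof -
    have "sq_int (fdiff u j ?f) \<le> ennreal (4 * ?s * (\<bar>u\<bar> / h) powr (2 * b))"
      by (rule sq_int_fdiff_bump[OF h S b])
    also have "\<dots> \<le> ennreal ((3 * \<bar>u\<bar> powr b)\<^sup>2)"
    proof (rule ennreal_leI)
      have "4 * ?s * (\<bar>u\<bar> / h) powr (2 * b) \<le> 9 * h powr (2 * b) * (\<bar>u\<bar> / h) powr (2 * b)"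
        by (intro mult_right_mono sh) auto
      also have "\<dots> = (3 * \<bar>u\<bar> powr b)\<^sup>2"
        using h by (simp add: powr_divide power_mult_distrib powr_square)
      finally show "4 * ?s * (\<bar>u\<bar> / h) powr (2 * b) \<le> (3 * \<bar>u\<bar> powr b)\<^sup>2" .
    qed
    finally show ?thesis unfolding Lnorm_2 by (subst epowr_half_le_iff) auto
  qed
  have "real 1 > b" using b by simp
  with 1 2 3 fm show ?thesis
    unfolding fclass_def nikolskii_def Lball_def iso_params_def by (auto intro!: exI[of _ "1::nat"])
qed

lemma bump_in_L2_densities:
  assumes h: "0 < h" and S: "finite (S :: ('d::finite \<Rightarrow> nat) set)" and v: "0 \<le> v"
    and one: "v * (real (card S) * h ^ CARD('d)) = 1"
  shows "bump v h S \<in> L2_densities"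
proof -
  have "bump v h S \<in> borel_measurable borel" using S by measurable
  then show ?thesis
    using v by (simp add: L2_densities_def nn_integral_bump[OF h S v] one Lnorm_2 sq_int_bump[OF h S] epowr_def)
       (simp add: bump_def indicator_def)
qed


section \<open>Chi-square comparison of a product law with a mixture\<close>

section \<open>Comparison of a product law with a mixture\<close>

text \<open>A finite product measure is determined by its values on rectangles, where the integral
  of the product density factors.\<close>

lemma PiM_density_iid:
  fixes I :: "'i set"
  assumes P: "prob_space P" and I: "finite I" and g[measurable]: "g \<in> borel_measurable P"
    and Q: "prob_space (density P g)"
  shows "Pi\<^sub>M I (\<lambda>_. density P g) = density (Pi\<^sub>M I (\<lambda>_. P)) (\<lambda>X. \<Prod>i\<in>I. g (X i))"
proof (rule sym, rule product_sigma_finite.PiM_eqI)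
  interpret P: prob_space P by fact
  interpret Q: prob_space "density P g" by fact
  interpret PP: product_sigma_finite "\<lambda>_::'i. P" by standard
  show "product_sigma_finite (\<lambda>_::'i. density P g)" by standard
  show "finite I" by fact
  have [measurable]: "(\<lambda>X. \<Prod>i\<in>I. g (X i)) \<in> borel_measurable (Pi\<^sub>M I (\<lambda>_. P))"
    by (intro borel_measurable_prod_ennreal) measurable
  show "sets (density (Pi\<^sub>M I (\<lambda>_. P)) (\<lambda>X. \<Prod>i\<in>I. g (X i))) = sets (Pi\<^sub>M I (\<lambda>_. density P g))"
    unfolding sets_density by (intro sets_PiM_cong) auto
  fix A assume A: "\<And>i. i \<in> I \<Longrightarrow> A i \<in> sets (density P g)"
  then have A'[measurable]: "A i \<in> sets P" if "i \<in> I" for i using that by simp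
  have "emeasure (density (Pi\<^sub>M I (\<lambda>_. P)) (\<lambda>X. \<Prod>i\<in>I. g (X i))) (Pi\<^sub>E I A)
     = (\<integral>\<^sup>+X. (\<Prod>i\<in>I. g (X i)) * indicator (Pi\<^sub>E I A) X \<partial>Pi\<^sub>M I (\<lambda>_. P))"
    using I by (intro emeasure_density sets_PiM_I_finite) auto
  also have "\<dots> = (\<integral>\<^sup>+X. (\<Prod>i\<in>I. g (X i) * indicator (A i) (X i)) \<partial>Pi\<^sub>M I (\<lambda>_. P))"
  proof (rule nn_integral_cong)
    fix X assume X: "X \<in> space (Pi\<^sub>M I (\<lambda>_. P))"
    have "indicator (Pi\<^sub>E I A) X = (\<Prod>i\<in>I. indicator (A i) (X i) :: ennreal)"
    proof (cases "X \<in> Pi\<^sub>E I A")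
      case True
      then show ?thesis by (auto intro!: prod.neutral[symmetric] simp: indicator_def PiE_iff)
    next
      case False
      then obtain i where "i \<in> I" "X i \<notin> A i" using X by (auto simp: space_PiM PiE_iff)
      then have "(\<Prod>i\<in>I. indicator (A i) (X i) :: ennreal) = 0"
        using I by (auto intro!: prod_zero simp: indicator_def)
      then show ?thesis using False by simp
    qed
    then show "(\<Prod>i\<in>I. g (X i)) * indicator (Pi\<^sub>E I A) X = (\<Prod>i\<in>I. g (X i) * indicator (A i) (X i))"
      by (simp add: prod.distrib)
  qed
  also have "\<dots> = (\<Prod>i\<in>I. \<integral>\<^sup>+x. g x * indicator (A i) x \<partial>P)"
    using I A' by (intro PP.product_nn_integral_prod) measurable
  also have "\<dots> = (\<Prod>i\<in>I. emeasure (density P g) (A i))"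
    using A' by (intro prod.cong refl emeasure_density[symmetric]) auto
  finally show "emeasure (density (Pi\<^sub>M I (\<lambda>_. P)) (\<lambda>X. \<Prod>i\<in>I. g (X i))) (Pi\<^sub>E I A)
     = (\<Prod>i\<in>I. emeasure (density P g) (A i))" .
qed

text \<open>A crude form of \<open>cosh x \<le> exp (x^2 / 2)\<close>. For
  \<open>\<bar>x\<bar> \<le> 1\<close> quadratic upper bounds of both exponentials are added;
  otherwise \<open>\<bar>x\<bar> \<le> x^2\<close> bounds each of them by
  \<open>exp (x^2)\<close>.\<close>

lemma cosh_le_exp_square: "exp x + exp (- x) \<le> 2 * exp (x\<^sup>2)" for x :: real
proof -
  have *: "exp y + exp (- y) \<le> 2 * exp (y\<^sup>2)" if y: "0 \<le> y" for y :: real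
  proof (cases "y \<le> 1")
    case True
    have "exp y \<le> 1 + y + y\<^sup>2" using y True by (rule exp_bound)
    moreover have "exp (- y) \<le> 1 - y + y\<^sup>2"
    proof -
      have "1 \<le> (1 - y + y\<^sup>2) * (1 + y)" using y by (simp add: algebra_simps power2_eq_square)
      also have "\<dots> \<le> (1 - y + y\<^sup>2) * exp y"
        using True y by (intro mult_left_mono exp_ge_add_one_self) auto
      finally show ?thesis by (simp add: exp_minus field_simps)
    qed
    moreover have "1 + y\<^sup>2 \<le> exp (y\<^sup>2)" by (rule exp_ge_add_one_self)
    ultimately show ?thesis by linarith
  next
    case False
    then have "y \<le> y\<^sup>2" by (simp add: power2_eq_square)
    then have "exp y \<le> exp (y\<^sup>2)" "exp (- y) \<le> exp (y\<^sup>2)" using y by auto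
    then show ?thesis by linarith
  qed
  show ?thesis using *[of "\<bar>x\<bar>"] by (cases "0 \<le> x") (auto simp: abs_if)
qed

text \<open>Up to the factor \<open>2 ^ m\<close> this is the chi-square bound. With
  \<open>c\<close> agreements, \<open>2 * c / m\<close> is 1 plus the average of \<open>m\<close>
  signs, so \<open>1 + s \<le> exp s\<close> bounds the \<open>n\<close>-th power by a product over
  \<open>i\<close>. Summing over \<open>e'\<close> gives the \<open>m\<close>-th power of
  \<open>exp t + exp (- t)\<close> with \<open>t = n / m\<close>.\<close>

lemma sum_agreement_bound:
  fixes e :: "nat \<Rightarrow> bool"
  assumes m: "0 < m"
  shows "(\<Sum>e'\<in>PiE {..<m} (\<lambda>_. UNIV). (2 / real m * real (card {i. i < m \<and> e i = e' i})) ^ n)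
    \<le> 2 ^ m * exp ((real n)\<^sup>2 / real m)"
proof -
  let ?t = "real n / real m"
  let ?g = "\<lambda>i b. exp (if e i = b then ?t else - ?t)"
  have "(2 / real m * real (card {i. i < m \<and> e i = e' i})) ^ n \<le> (\<Prod>i<m. ?g i (e' i))" for e'
  proof -
    let ?c = "card {i. i < m \<and> e i = e' i}"
    have "(2 / real m * real ?c) ^ n \<le> exp (2 / real m * real ?c - 1) ^ n"
      using exp_ge_add_one_self[of "2 / real m * real ?c - 1"] by (intro power_mono) auto
    also have "\<dots> = exp (real n * (2 / real m * real ?c - 1))" by (simp add: exp_of_nat_mult)
    also have "real n * (2 / real m * real ?c - 1) = (\<Sum>i<m. if e i = e' i then ?t else - ?t)"
    proof -
      have "(\<Sum>i<m. if e i = e' i then ?t else - ?t) = (\<Sum>i<m. (if e i = e' i then 2 * ?t else 0) - ?t)"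
        by (intro sum.cong) auto
      also have "\<dots> = (\<Sum>i<m. if e i = e' i then 2 * ?t else 0) - real m * ?t"
        by (simp add: sum_subtractf)
      also have "(\<Sum>i<m. if e i = e' i then 2 * ?t else 0) = (\<Sum>i\<in>{i. i < m \<and> e i = e' i}. 2 * ?t)"
        by (rule sum.mono_neutral_cong_right) auto
      finally show ?thesis using m by (simp add: field_simps)
    qed
    also have "exp \<dots> = (\<Prod>i<m. ?g i (e' i))" by (rule exp_sum) simp
    finally show ?thesis .
  qed
  then have "(\<Sum>e'\<in>PiE {..<m} (\<lambda>_. UNIV). (2 / real m * real (card {i. i < m \<and> e i = e' i})) ^ n)
     \<le> (\<Sum>e'\<in>PiE {..<m} (\<lambda>_. UNIV). \<Prod>i<m. ?g i (e' i))"
    by (intro sum_mono)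
  also have "\<dots> = (\<Prod>i<m. \<Sum>b\<in>UNIV. ?g i b)"
    by (rule prod_sum_PiE[symmetric]) auto
  also have "\<dots> \<le> (\<Prod>i<m. 2 * exp (?t\<^sup>2))"
  proof (rule prod_mono, intro conjI)
    fix i
    show "0 \<le> (\<Sum>b\<in>UNIV. ?g i b)" by (intro sum_nonneg) auto
    show "(\<Sum>b\<in>UNIV. ?g i b) \<le> 2 * exp (?t\<^sup>2)"
      using cosh_le_exp_square[of ?t] by (cases "e i") (auto simp: UNIV_bool)
  qed
  also have "\<dots> = 2 ^ m * exp (real m * ?t\<^sup>2)" by (simp add: power_mult_distrib exp_of_nat_mult)
  also have "real m * ?t\<^sup>2 = (real n)\<^sup>2 / real m" using m by (simp add: power2_eq_square)
  finally show ?thesis .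
qed

text \<open>Markov's inequality for the square of \<open>g\<close>; it converts mean squared error
  into error probabilities.\<close>

lemma (in prob_space) square_deviation_prob:
  fixes g :: "'a \<Rightarrow> real"
  assumes A: "A \<in> sets M" and c: "0 < c" and dev: "\<And>x. x \<in> A \<Longrightarrow> c \<le> \<bar>g x\<bar>"
    and r: "0 \<le> r" and int: "(\<integral>\<^sup>+x. ennreal ((g x)\<^sup>2) \<partial>M) \<le> ennreal r"
  shows "prob A \<le> r / c\<^sup>2"
proof -
  have "ennreal (c\<^sup>2 * prob A) = (\<integral>\<^sup>+x. ennreal (c\<^sup>2) * indicator A x \<partial>M)"
    using A by (subst nn_integral_cmult_indicator) (auto simp: emeasure_eq_measure ennreal_mult)
  also have "\<dots> \<le> (\<integral>\<^sup>+x. ennreal ((g x)\<^sup>2) \<partial>M)"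
  proof (rule nn_integral_mono)
    fix x
    show "ennreal (c\<^sup>2) * indicator A x \<le> ennreal ((g x)\<^sup>2)"
    proof (cases "x \<in> A")
      case True
      then have "c\<^sup>2 \<le> \<bar>g x\<bar>\<^sup>2" using dev c by (intro power_mono) auto
      then show ?thesis using True by (simp add: ennreal_leI)
    qed simp
  qed
  also note int
  finally have "c\<^sup>2 * prob A \<le> r" using r by simp
  then show ?thesis using c by (simp add: field_simps)
qed

text \<open>Cauchy-Schwarz under the base law for the indicator of \<open>A\<close> and the sum of
  the likelihood ratios. The second moment of that sum factors over the \<open>n\<close> coordinates
  for each pair \<open>e\<close>, \<open>e'\<close>. The sums over \<open>E\<close> are left
  unnormalised.\<close>

lemma mixture_event_bound:
  fixes P :: "'a measure" and \<rho> :: "'e \<Rightarrow> 'a \<Rightarrow> ennreal"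
  assumes P: "prob_space P" and E: "finite E" and \<rho>[measurable]: "\<And>e. e \<in> E \<Longrightarrow> \<rho> e \<in> borel_measurable P"
    and Q: "\<And>e. e \<in> E \<Longrightarrow> prob_space (density P (\<rho> e))"
    and A: "A \<in> sets (Pi\<^sub>M {1..n::nat} (\<lambda>_. P))"
  shows "(\<Sum>e\<in>E. emeasure (Pi\<^sub>M {1..n} (\<lambda>_. density P (\<rho> e))) A)\<^sup>2
     \<le> emeasure (Pi\<^sub>M {1..n} (\<lambda>_. P)) A * (\<Sum>e\<in>E. \<Sum>e'\<in>E. (\<integral>\<^sup>+x. \<rho> e x * \<rho> e' x \<partial>P) ^ n)"
proof -
  interpret P: prob_space P by fact
  interpret PP: product_sigma_finite "\<lambda>_::nat. P" by standard
  let ?P = "Pi\<^sub>M {1..n} (\<lambda>_. P)"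
  let ?r = "\<lambda>e X. \<Prod>i\<in>{1..n}. \<rho> e (X i)"
  have rm[measurable]: "?r e \<in> borel_measurable ?P" if "e \<in> E" for e
    using that by (intro borel_measurable_prod_ennreal) measurable
  have Lm[measurable]: "(\<lambda>X. \<Sum>e\<in>E. ?r e X) \<in> borel_measurable ?P"
    by (intro borel_measurable_sum rm)
  have [measurable]: "A \<in> sets ?P" by fact
  have "(\<Sum>e\<in>E. emeasure (Pi\<^sub>M {1..n} (\<lambda>_. density P (\<rho> e))) A) = (\<Sum>e\<in>E. \<integral>\<^sup>+X. indicator A X * ?r e X \<partial>?P)"
  proof (rule sum.cong, rule refl)
    fix e assume e: "e \<in> E"
    show "emeasure (Pi\<^sub>M {1..n} (\<lambda>_. density P (\<rho> e))) A = (\<integral>\<^sup>+X. indicator A X * ?r e X \<partial>?P)"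
      unfolding PiM_density_iid[OF P finite_atLeastAtMost \<rho>[OF e] Q[OF e]] emeasure_density[OF rm[OF e] A]
      by (simp only: mult.commute)
  qed
  also have "\<dots> = (\<integral>\<^sup>+X. indicator A X * (\<Sum>e\<in>E. ?r e X) \<partial>?P)"
    unfolding sum_distrib_left by (rule nn_integral_sum[symmetric]) measurable
  finally have "(\<Sum>e\<in>E. emeasure (Pi\<^sub>M {1..n} (\<lambda>_. density P (\<rho> e))) A)\<^sup>2
     \<le> (\<integral>\<^sup>+X. (indicator A X)\<^sup>2 \<partial>?P) * (\<integral>\<^sup>+X. (\<Sum>e\<in>E. ?r e X)\<^sup>2 \<partial>?P)"
    using Cauchy_Schwarz_nn_integral[OF borel_measurable_indicator[OF A] Lm] by simp
  also have "(\<integral>\<^sup>+X. (indicator A X)\<^sup>2 \<partial>?P) = emeasure ?P A"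
  proof -
    have "(\<lambda>X. (indicator A X)\<^sup>2 :: ennreal) = indicator A"
      by (auto simp: fun_eq_iff indicator_def)
    then show ?thesis using nn_integral_indicator[OF A] by simp
  qed
  also have "(\<integral>\<^sup>+X. (\<Sum>e\<in>E. ?r e X)\<^sup>2 \<partial>?P) = (\<integral>\<^sup>+X. (\<Sum>e\<in>E. \<Sum>e'\<in>E. \<Prod>i\<in>{1..n}. \<rho> e (X i) * \<rho> e' (X i)) \<partial>?P)"
    by (simp add: power2_eq_square sum_product prod.distrib)
  also have "\<dots> = (\<Sum>e\<in>E. \<Sum>e'\<in>E. \<integral>\<^sup>+X. (\<Prod>i\<in>{1..n}. \<rho> e (X i) * \<rho> e' (X i)) \<partial>?P)"
  proof -
    have m: "(\<lambda>X. \<Prod>i\<in>{1..n}. \<rho> e (X i) * \<rho> e' (X i)) \<in> borel_measurable ?P" if "e \<in> E" "e' \<in> E" for e e'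
      using that by (intro borel_measurable_prod_ennreal) measurable
    show ?thesis
      by (subst nn_integral_sum, intro borel_measurable_sum m, assumption+,
          intro sum.cong refl, subst nn_integral_sum, rule m, assumption+, rule refl)
  qed
  also have "\<dots> = (\<Sum>e\<in>E. \<Sum>e'\<in>E. (\<integral>\<^sup>+x. \<rho> e x * \<rho> e' x \<partial>P) ^ n)"
  proof (intro sum.cong refl)
    fix e e' assume "e \<in> E" "e' \<in> E"
    then show "(\<integral>\<^sup>+X. (\<Prod>i\<in>{1..n}. \<rho> e (X i) * \<rho> e' (X i)) \<partial>?P) = (\<integral>\<^sup>+x. \<rho> e x * \<rho> e' x \<partial>P) ^ n"
      by (subst PP.product_nn_integral_prod) auto
  qed
  finally show ?thesis .
qed


section \<open>Testing the uniform density against the perturbed densities\<close>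

section \<open>The two-class lower bound\<close>

lemma sample_law_sets: "sets (sample_law n f) = sets (Pi\<^sub>M {1..n} (\<lambda>_. borel))"
  unfolding sample_law_def by (intro sets_PiM_cong) auto

lemma prob_space_density_L2:
  "f \<in> L2_densities \<Longrightarrow> prob_space (density lborel (\<lambda>x. ennreal (f x)))"
  by (intro prob_spaceI) (auto simp: L2_densities_def emeasure_density)

lemma risk_event_bound:
  fixes N :: "(nat \<Rightarrow> real ^ 'd) \<Rightarrow> real"
  assumes f: "f \<in> F \<inter> L2_densities"
    and r: "0 \<le> r" "risk n N F \<le> ennreal r" and A: "A \<in> sets (sample_law n f)" and c: "0 < c"
    and dev: "\<And>X. X \<in> A \<Longrightarrow> c \<le> \<bar>N X - enn2real (Lnorm 2 f)\<bar>"
  shows "measure (sample_law n f) A \<le> r\<^sup>2 / c\<^sup>2"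
proof -
  interpret prob_space "sample_law n f"
    unfolding sample_law_def using f by (intro prob_space_PiM prob_space_density_L2) auto
  show ?thesis
    using f r(2) unfolding risk_le_iff[OF r(1)]
    by (intro square_deviation_prob[OF A c dev]) auto
qed

text \<open>\<open>N\<close> serves as a test between the uniform density \<open>f0\<close> in the
  class for \<open>b'\<close> and the densities \<open>f1 \<epsilon>\<close> in the class for
  \<open>b\<close>, whose norms differ from that of \<open>f0\<close> by \<open>D\<close>. Missing
  \<open>f1 \<epsilon>\<close> has probability at most \<open>4 * r1^2 / D^2\<close>, and a false
  alarm under \<open>f0\<close> at most \<open>4 * r0^2 / D^2\<close>. Cauchy-Schwarz transfers the
  latter to the mixture with a square root, which explains the term linear in \<open>r0\<close> and
  the halved exponent \<open>n^2 / K ^ d\<close> in place of \<open>n^2 / m\<close>.\<close>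

lemma two_class_bound:
  fixes N :: "(nat \<Rightarrow> real ^ 'd) \<Rightarrow> real" and l n :: nat
  assumes N: "N \<in> estimators n" and l: "1 \<le> l"
    and b: "0 < b" "b \<le> 1 / 2" and b': "0 < b'" "b' \<le> 1 / 2" and r: "0 \<le> r0" "0 \<le> r1"
    and risk0: "risk n N (fclass (iso_params b')) \<le> ennreal r0"
    and risk1: "risk n N (fclass (iso_params b)) \<le> ennreal r1"
  defines "K \<equiv> 2 * l"
  defines "D \<equiv> (sqrt 2 - 1) * real K powr (- (real CARD('d) * iso_exponent TYPE('d) b / 2))"
  shows "1 \<le> 4 * r1\<^sup>2 / D\<^sup>2 + 2 * r0 / D * exp ((real n)\<^sup>2 / real K ^ CARD('d))"
proof -
  let ?d = "CARD('d)"
  \<comment> \<open>\<open>K\<close> is even, so the \<open>K ^ d\<close> cells of the grid can be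
    split into \<open>m\<close> pairs.\<close>
  define m where "m = l * K ^ (?d - 1)"
  have K: "1 \<le> K" "1 < real K" using l by (auto simp: K_def)
  have m0: "0 < m" using l K by (simp add: m_def)
  have Km: "K ^ ?d = 2 * m"
  proof -
    have "K ^ ?d = K * K ^ (?d - 1)" by (metis power_eq_if zero_less_card_finite less_numeral_extra(3))
    then show ?thesis by (simp add: m_def K_def)
  qed
  \<comment> \<open>\<open>h\<close> solves \<open>K ^ d * h powr (2 * b + d) = 1\<close>. Hence
    \<open>a = h powr (2 * b)\<close> is the height of the uniform density on the cube of side
    \<open>K * h\<close>, and also of the order that smoothness \<open>b\<close> permits for
    perturbations of width \<open>h\<close>.\<close>
  define h where "h = real K powr (- real ?d / (2 * b + real ?d))"
  define a where "a = h powr (2 * b)"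
  have h: "0 < h" "h \<le> 1"
  proof -
    show "0 < h" using K by (simp add: h_def)
    have "real K powr (- real ?d / (2 * b + real ?d)) \<le> real K powr 0"
      using K b by (intro powr_mono) (auto simp: divide_nonpos_nonneg)
    then show "h \<le> 1" using K by (simp add: h_def)
  qed
  have a: "0 < a" "a \<le> 1"
    using h b by (auto simp: a_def powr_le1)
  have pos: "2 * b + real ?d > 0" using b by (simp add: add_pos_nonneg)
  have aKh: "a * (real K * h) ^ ?d = 1"
  proof -
    have "a * (real K * h) ^ ?d = h powr (2 * b) * (real K powr real ?d * h powr real ?d)"
      using h K by (simp add: a_def power_mult_distrib powr_realpow)
    also have "\<dots> = real K powr real ?d * h powr (2 * b + real ?d)"
      by (simp add: powr_add)
    also have "h powr (2 * b + real ?d) = real K powr (- real ?d)"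
      unfolding h_def powr_powr using pos by (intro arg_cong[where f = "(powr) _"]) (simp add: field_simps)
    finally show ?thesis using K by (simp add: powr_add[symmetric])
  qed
  \<comment> \<open>The large cube has side at least 1, which puts the uniform density into the
    class for every admissible \<open>b'\<close>.\<close>
  have Kh: "1 \<le> real K * h"
  proof (rule ccontr)
    assume "\<not> 1 \<le> real K * h"
    then have "(real K * h) ^ ?d < 1 ^ ?d" using h by (intro power_strict_mono) auto
    then have "a * (real K * h) ^ ?d < 1 * 1" using a h by (intro mult_le_less_imp_less) auto
    then show False using aKh by simp
  qed
  have amh: "2 * a * (real m * h ^ ?d) = 1"
  proof -
    have "real K ^ ?d = 2 * real m" by (metis Km of_nat_mult of_nat_numeral of_nat_power)
    then show ?thesis using aKh by (simp add: power_mult_distrib)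
  qed
  have sqa: "sqrt a = real K powr (- (real ?d * iso_exponent TYPE('d) b / 2))"
  proof -
    have "sqrt a = a powr (1 / 2)" using a by (simp add: powr_half_sqrt)
    also have "\<dots> = real K powr (- real ?d / (2 * b + real ?d) * (2 * b * (1 / 2)))"
      unfolding a_def h_def powr_powr by (simp only: mult.assoc)
    also have "- real ?d / (2 * b + real ?d) * (2 * b * (1 / 2)) = - (real ?d * iso_exponent TYPE('d) b / 2)"
      using pos by (simp add: iso_exponent_def field_simps)
    finally show ?thesis .
  qed
  then have D: "D = sqrt (2 * a) - sqrt a"
    by (simp add: D_def real_sqrt_mult algebra_simps)
  have D0: "0 < D" using a by (simp add: D)
  define idx where "idx = PiE (UNIV :: 'd set) (\<lambda>_. {..<K})"
  have "card idx = K ^ ?d" by (simp add: idx_def card_PiE)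
  moreover have "finite idx" by (simp add: idx_def finite_PiE)
  moreover have "card ({..<m} \<times> (UNIV :: bool set)) = 2 * m" by (simp add: card_cartesian_product)
  \<comment> \<open>Any pairing of the cells will do: \<open>e (i, True)\<close> and
    \<open>e (i, False)\<close> form pair \<open>i\<close> and need not be neighbours.\<close>
  ultimately obtain e where e: "bij_betw e ({..<m} \<times> (UNIV :: bool set)) idx"
    using Km by (metis finite_same_card_bij finite_cartesian_product finite_lessThan finite)
  have inj: "e (i, s) = e (i', s') \<longleftrightarrow> i = i' \<and> s = s'" if "i < m" "i' < m" for i i' s s'
    using that e by (auto simp: bij_betw_def inj_on_def)
  have e_idx: "e (i, s) \<in> idx" if "i < m" for i s
    using that e by (auto simp: bij_betw_def)
  \<comment> \<open>\<open>\<epsilon>\<close> selects one cell of each pair. Doubling the density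
    there and setting it to 0 on the partner cells keeps the total mass 1.\<close>
  define S where "S = (\<lambda>\<epsilon> :: nat \<Rightarrow> bool. (\<lambda>i. e (i, \<epsilon> i)) ` {..<m})"
  have finS: "finite (S \<epsilon>)" for \<epsilon> by (simp add: S_def)
  have cardS: "card (S \<epsilon>) = m" for \<epsilon>
    unfolding S_def by (subst card_image) (auto simp: inj_on_def inj)
  have interS: "card (S \<epsilon> \<inter> S \<epsilon>') = card {i. i < m \<and> \<epsilon> i = \<epsilon>' i}" for \<epsilon> \<epsilon>'
  proof -
    have "S \<epsilon> \<inter> S \<epsilon>' = (\<lambda>i. e (i, \<epsilon> i)) ` {i. i < m \<and> \<epsilon> i = \<epsilon>' i}"
    proof (intro equalityI subsetI)
      fix c assume "c \<in> S \<epsilon> \<inter> S \<epsilon>'"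
      then obtain i i' where "i < m" "i' < m" "c = e (i, \<epsilon> i)" "c = e (i', \<epsilon>' i')"
        by (auto simp: S_def)
      then show "c \<in> (\<lambda>i. e (i, \<epsilon> i)) ` {i. i < m \<and> \<epsilon> i = \<epsilon>' i}"
        using inj by auto
    next
      fix c assume "c \<in> (\<lambda>i. e (i, \<epsilon> i)) ` {i. i < m \<and> \<epsilon> i = \<epsilon>' i}"
      then obtain i where "i < m" "c = e (i, \<epsilon> i)" "c = e (i, \<epsilon>' i)" by auto
      then show "c \<in> S \<epsilon> \<inter> S \<epsilon>'" unfolding S_def by blast
    qed
    then show ?thesis by (simp add: card_image inj_on_def inj)
  qed
  define f0 :: "real ^ 'd \<Rightarrow> real" where "f0 = bump a (real K * h) {\<lambda>_. 0}"
  define f1 where "f1 = (\<lambda>\<epsilon>. bump (2 * a) h (S \<epsilon>))"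
  have Kh0: "0 < real K * h" using Kh by linarith
  have s0: "a\<^sup>2 * (real (card {\<lambda>_ :: 'd. 0 :: nat}) * (real K * h) ^ ?d) = a"
    using aKh by (simp add: power2_eq_square mult.assoc)
  have s1: "(2 * a)\<^sup>2 * (real (card (S \<epsilon>)) * h ^ ?d) = 2 * a" for \<epsilon>
  proof -
    have "(2 * a)\<^sup>2 * (real (card (S \<epsilon>)) * h ^ ?d) = (2 * a) * (2 * a * (real m * h ^ ?d))"
      by (simp only: cardS power2_eq_square mult.assoc)
    then show ?thesis by (simp only: amh mult_1_right)
  qed
  have f0: "f0 \<in> fclass (iso_params b') \<inter> L2_densities"
  proof
    have "1 \<le> (real K * h) powr (2 * b')" using Kh b' by (intro ge_one_powr_ge_zero) auto
    then show "f0 \<in> fclass (iso_params b')"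
      unfolding f0_def using a by (intro bump_in_fclass Kh0 b', unfold s0) auto
    show "f0 \<in> L2_densities"
      unfolding f0_def using a aKh by (intro bump_in_L2_densities Kh0) auto
  qed
  have f1: "f1 \<epsilon> \<in> fclass (iso_params b) \<inter> L2_densities" for \<epsilon>
  proof
    show "f1 \<epsilon> \<in> fclass (iso_params b)"
      unfolding f1_def using a by (intro bump_in_fclass h(1) finS b, unfold s1) (auto simp: a_def)
    show "f1 \<epsilon> \<in> L2_densities"
      unfolding f1_def using a amh by (intro bump_in_L2_densities h(1) finS) (auto simp: cardS)
  qed
  have norm0: "enn2real (Lnorm 2 f0) = sqrt a"
    unfolding enn2real_Lnorm_2 f0_def using a by (subst sq_int_bump[OF Kh0], simp, unfold s0) simp
  have norm1: "enn2real (Lnorm 2 (f1 \<epsilon>)) = sqrt (2 * a)" for \<epsilon>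
    unfolding enn2real_Lnorm_2 f1_def sq_int_bump[OF h(1) finS] s1 using a by simp
  define P where "P = density lborel (\<lambda>x. ennreal (f0 x))"
  have P: "prob_space P" unfolding P_def using f0 by (intro prob_space_density_L2) auto
  have f0m[measurable]: "f0 \<in> borel_measurable borel" unfolding f0_def by measurable
  \<comment> \<open>The likelihood ratio of \<open>f1 \<epsilon>\<close> with respect to
    \<open>f0\<close>.\<close>
  define \<rho> :: "(nat \<Rightarrow> bool) \<Rightarrow> real ^ 'd \<Rightarrow> ennreal" where "\<rho> = (\<lambda>\<epsilon>. \<lambda>x. 2 * indicator (\<Union>c\<in>S \<epsilon>. cell h c) x)"
  have Um[measurable]: "(\<Union>c\<in>S \<epsilon>. cell h c) \<in> sets borel" for \<epsilon>
    using finS by auto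
  have \<rho>m[measurable]: "\<rho> \<epsilon> \<in> borel_measurable borel" for \<epsilon>
    unfolding \<rho>_def by measurable
  have sub: "cell h c \<subseteq> cell (real K * h) (\<lambda>_. 0)" if "c \<in> S \<epsilon>" for c \<epsilon>
  proof
    fix x assume x: "x \<in> cell h c"
    have "c \<in> idx" using that e_idx by (auto simp: S_def)
    then have c: "real (c j) + 1 \<le> real K" for j
      by (auto simp: idx_def PiE_iff) (metis Suc_leI of_nat_Suc of_nat_le_iff add.commute)
    have "0 \<le> x $ j \<and> x $ j < real K * h" for j
    proof
      have "0 \<le> h * real (c j)" using h by simp
      also have "\<dots> \<le> x $ j" using x by (simp add: cell_def)
      finally show "0 \<le> x $ j" .
      have "x $ j < h * (real (c j) + 1)" using x by (simp add: cell_def)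
      also have "\<dots> \<le> h * real K" using c h by (intro mult_left_mono) auto
      finally show "x $ j < real K * h" by (simp add: mult.commute)
    qed
    then show "x \<in> cell (real K * h) (\<lambda>_. 0)" by (simp add: cell_def)
  qed
  have f1_eq: "ennreal (f0 x) * \<rho> \<epsilon> x = ennreal (f1 \<epsilon> x)" for \<epsilon> x
    using sub a by (auto simp: f0_def f1_def \<rho>_def bump_def indicator_def ennreal_mult mult.commute)
  have dens: "density P (\<rho> \<epsilon>) = density lborel (\<lambda>x. ennreal (f1 \<epsilon> x))" for \<epsilon>
    unfolding P_def by (subst density_density_eq) (auto simp: f1_eq)
  have law1: "sample_law n (f1 \<epsilon>) = Pi\<^sub>M {1..n} (\<lambda>_. density P (\<rho> \<epsilon>))" for \<epsilon>
    by (simp add: sample_law_def dens)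
  have law0: "sample_law n f0 = Pi\<^sub>M {1..n} (\<lambda>_. P)"
    by (simp add: sample_law_def P_def)
  \<comment> \<open>The integrand has height \<open>4 * a\<close> on the common cells, each of
    volume \<open>h ^ d\<close>, and \<open>2 * a * m * h ^ d = 1\<close>. The overlap is 1 when
    exactly half of the choices agree.\<close>
  have overlap: "(\<integral>\<^sup>+x. \<rho> \<epsilon> x * \<rho> \<epsilon>' x \<partial>P) = ennreal (2 / real m * real (card {i. i < m \<and> \<epsilon> i = \<epsilon>' i}))" for \<epsilon> \<epsilon>'
  proof -
    have "(\<integral>\<^sup>+x. \<rho> \<epsilon> x * \<rho> \<epsilon>' x \<partial>P) = (\<integral>\<^sup>+x. ennreal (f0 x) * (\<rho> \<epsilon> x * \<rho> \<epsilon>' x) \<partial>lborel)"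
      unfolding P_def by (subst nn_integral_density) auto
    also have "\<dots> = (\<integral>\<^sup>+x. ennreal (bump (4 * a) h (S \<epsilon> \<inter> S \<epsilon>') x) \<partial>lborel)"
    proof (rule nn_integral_cong)
      fix x
      have "ennreal (f0 x) * (\<rho> \<epsilon> x * \<rho> \<epsilon>' x) = ennreal (f1 \<epsilon> x) * \<rho> \<epsilon>' x"
        by (simp only: mult.assoc[symmetric] f1_eq)
      also have "\<dots> = ennreal (bump (4 * a) h (S \<epsilon> \<inter> S \<epsilon>') x)"
      proof (cases "x \<in> (\<Union>c\<in>S \<epsilon>. cell h c) \<and> x \<in> (\<Union>c\<in>S \<epsilon>'. cell h c)")
        case True
        then obtain c c' where c: "c \<in> S \<epsilon>" "c' \<in> S \<epsilon>'" "x \<in> cell h c" "x \<in> cell h c'" by auto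
        then have "c = c'" using cell_disjoint[OF h(1), of c c'] by auto
        then have "x \<in> (\<Union>c\<in>S \<epsilon> \<inter> S \<epsilon>'. cell h c)" using c by auto
        moreover have "ennreal (2 * a) * 2 = ennreal (4 * a)"
        proof -
          have "ennreal (2 * a) * ennreal 2 = ennreal (2 * a * 2)"
            using a by (intro ennreal_mult[symmetric]) auto
          then show ?thesis by simp
        qed
        ultimately show ?thesis using True by (simp add: f1_def \<rho>_def bump_def)
      next
        case False
        then have "x \<notin> (\<Union>c\<in>S \<epsilon> \<inter> S \<epsilon>'. cell h c)" by auto
        then show ?thesis using False by (auto simp: f1_def \<rho>_def bump_def indicator_def)
      qed
      finally show "ennreal (f0 x) * (\<rho> \<epsilon> x * \<rho> \<epsilon>' x) = ennreal (bump (4 * a) h (S \<epsilon> \<inter> S \<epsilon>') x)" .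
    qed
    also have "\<dots> = ennreal (4 * a * (real (card (S \<epsilon> \<inter> S \<epsilon>')) * h ^ ?d))"
      using a finS by (intro nn_integral_bump h) auto
    also have "4 * a * (real (card (S \<epsilon> \<inter> S \<epsilon>')) * h ^ ?d) = 2 / real m * real (card {i. i < m \<and> \<epsilon> i = \<epsilon>' i})"
      using amh m0 by (simp add: interS field_simps)
    finally show ?thesis .
  qed
  let ?E = "PiE {..<m} (\<lambda>_. UNIV :: bool set)"
  have finE: "finite ?E" by (simp add: finite_PiE)
  have cardE: "card ?E = 2 ^ m" by (simp add: card_PiE)
  \<comment> \<open>The test rejects \<open>f0\<close> when the estimate reaches the midpoint of the
    two norms, so a wrong decision on either side means an error of at least
    \<open>D / 2\<close>.\<close>
  define A where "A = {X \<in> space (sample_law n f0). sqrt a + D / 2 \<le> N X}"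
  have Nm: "N \<in> borel_measurable (sample_law n f)" for f
    using N unfolding estimators_def using sample_law_sets[of n f] by (simp cong: measurable_cong_sets)
  have A0: "A \<in> sets (sample_law n f0)"
    unfolding A_def using Nm[of f0] by measurable
  have sets_eq: "sets (sample_law n f) = sets (sample_law n f0)" for f :: "real ^ 'd \<Rightarrow> real"
    by (simp add: sample_law_sets)
  have space_eq: "space (sample_law n f) = space (sample_law n f0)" for f :: "real ^ 'd \<Rightarrow> real"
    by (rule sets_eq_imp_space_eq[OF sets_eq])
  have pA0: "measure (sample_law n f0) A \<le> r0\<^sup>2 / (D / 2)\<^sup>2"
    using D0 by (intro risk_event_bound[OF f0 r(1) risk0 A0]) (auto simp: norm0 A_def)
  have pA1: "1 - r1\<^sup>2 / (D / 2)\<^sup>2 \<le> measure (sample_law n (f1 \<epsilon>)) A" for \<epsilon>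
  proof -
    interpret prob_space "sample_law n (f1 \<epsilon>)"
      unfolding sample_law_def using f1 by (intro prob_space_PiM prob_space_density_L2) auto
    have A1: "A \<in> sets (sample_law n (f1 \<epsilon>))" using A0 by (simp only: sets_eq[of "f1 \<epsilon>"])
    have "prob (space (sample_law n (f1 \<epsilon>)) - A) \<le> r1\<^sup>2 / (D / 2)\<^sup>2"
    proof (rule risk_event_bound[OF f1 r(2) risk1])
      show "space (sample_law n (f1 \<epsilon>)) - A \<in> sets (sample_law n (f1 \<epsilon>))" using A1 by auto
      show "0 < D / 2" using D0 by simp
      fix X assume "X \<in> space (sample_law n (f1 \<epsilon>)) - A"
      then have "N X < sqrt a + D / 2" by (auto simp: A_def space_eq[of "f1 \<epsilon>"])
      moreover have "sqrt (2 * a) = sqrt a + D" by (simp only: D diff_add_cancel add_diff_cancel add.commute)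
      moreover have "D' / 2 \<le> \<bar>w - q\<bar>" if "w < s + D' / 2" "q = s + D'" for w s q D' :: real
        using that by linarith
      ultimately show "D / 2 \<le> \<bar>N X - enn2real (Lnorm 2 (f1 \<epsilon>))\<bar>"
        unfolding norm1 by blast
    qed
    then show ?thesis using prob_compl[OF A1] by simp
  qed
  define q where "q = measure (sample_law n f0) A"
  have "(\<Sum>\<epsilon>\<in>?E. emeasure (sample_law n (f1 \<epsilon>)) A)\<^sup>2
      \<le> emeasure (sample_law n f0) A * (\<Sum>\<epsilon>\<in>?E. \<Sum>\<epsilon>'\<in>?E. (\<integral>\<^sup>+x. \<rho> \<epsilon> x * \<rho> \<epsilon>' x \<partial>P) ^ n)"
    unfolding law1 law0
  proof (rule mixture_event_bound[OF P finE])
    show "\<rho> \<epsilon> \<in> borel_measurable P" for \<epsilon> using \<rho>m by (simp add: P_def)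
    show "prob_space (density P (\<rho> \<epsilon>))" for \<epsilon>
      unfolding dens using f1 by (intro prob_space_density_L2) auto
    show "A \<in> sets (Pi\<^sub>M {1..n} (\<lambda>_. P))" using A0 unfolding law0 .
  qed
  also have "emeasure (sample_law n f0) A = ennreal q"
  proof -
    interpret prob_space "sample_law n f0"
      unfolding sample_law_def using f0 by (intro prob_space_PiM prob_space_density_L2) auto
    show ?thesis by (simp add: q_def emeasure_eq_measure)
  qed
  also have "(\<Sum>\<epsilon>\<in>?E. \<Sum>\<epsilon>'\<in>?E. (\<integral>\<^sup>+x. \<rho> \<epsilon> x * \<rho> \<epsilon>' x \<partial>P) ^ n)
     = ennreal (\<Sum>\<epsilon>\<in>?E. \<Sum>\<epsilon>'\<in>?E. (2 / real m * real (card {i. i < m \<and> \<epsilon> i = \<epsilon>' i})) ^ n)"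
    unfolding overlap by (simp add: ennreal_power sum_ennreal sum_nonneg)
  also have "(\<Sum>\<epsilon>\<in>?E. emeasure (sample_law n (f1 \<epsilon>)) A) = ennreal (\<Sum>\<epsilon>\<in>?E. measure (sample_law n (f1 \<epsilon>)) A)"
  proof -
    have "emeasure (sample_law n (f1 \<epsilon>)) A = ennreal (measure (sample_law n (f1 \<epsilon>)) A)" for \<epsilon>
    proof -
      interpret prob_space "sample_law n (f1 \<epsilon>)"
        unfolding sample_law_def using f1 by (intro prob_space_PiM prob_space_density_L2) auto
      show ?thesis by (simp add: emeasure_eq_measure)
    qed
    then show ?thesis by (simp add: sum_ennreal)
  qed
  finally have "ennreal ((\<Sum>\<epsilon>\<in>?E. measure (sample_law n (f1 \<epsilon>)) A)\<^sup>2)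
     \<le> ennreal (q * (\<Sum>\<epsilon>\<in>?E. \<Sum>\<epsilon>'\<in>?E. (2 / real m * real (card {i. i < m \<and> \<epsilon> i = \<epsilon>' i})) ^ n))"
    by (simp add: ennreal_power sum_nonneg ennreal_mult q_def)
  then have "(\<Sum>\<epsilon>\<in>?E. measure (sample_law n (f1 \<epsilon>)) A)\<^sup>2
     \<le> q * (\<Sum>\<epsilon>\<in>?E. \<Sum>\<epsilon>'\<in>?E. (2 / real m * real (card {i. i < m \<and> \<epsilon> i = \<epsilon>' i})) ^ n)"
  proof (rule iffD1[OF ennreal_le_iff, rotated])
    show "0 \<le> q * (\<Sum>\<epsilon>\<in>?E. \<Sum>\<epsilon>'\<in>?E. (2 / real m * real (card {i. i < m \<and> \<epsilon> i = \<epsilon>' i})) ^ n)"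
      by (intro mult_nonneg_nonneg sum_nonneg) (simp_all add: q_def)
  qed
  \<comment> \<open>The inner sum has the same bound for each of the \<open>2 ^ m\<close> outer
    choices. The resulting factor \<open>(2 ^ m)^2\<close> cancels against the unnormalised sum on
    the left after taking roots.\<close>
  also have "\<dots> \<le> q * (\<Sum>\<epsilon>\<in>?E. 2 ^ m * exp ((real n)\<^sup>2 / real m))"
    by (intro mult_left_mono sum_mono sum_agreement_bound m0) (simp add: q_def)
  also have "\<dots> = q * ((2 ^ m)\<^sup>2 * exp ((real n)\<^sup>2 / real m))"
    by (simp add: cardE power2_eq_square)
  also have "\<dots> \<le> (r0\<^sup>2 / (D / 2)\<^sup>2) * ((2 ^ m)\<^sup>2 * exp ((real n)\<^sup>2 / real m))"
    using pA0 by (intro mult_right_mono) (auto simp: q_def)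
  also have "exp ((real n)\<^sup>2 / real m) = (exp ((real n)\<^sup>2 / real K ^ ?d))\<^sup>2"
  proof -
    have "real K ^ ?d = 2 * real m" by (metis Km of_nat_mult of_nat_numeral of_nat_power)
    then show ?thesis using m0 by (simp add: exp_double[symmetric])
  qed
  also have "(r0\<^sup>2 / (D / 2)\<^sup>2) * ((2 ^ m)\<^sup>2 * (exp ((real n)\<^sup>2 / real K ^ ?d))\<^sup>2)
     = (2 ^ m * (2 * r0 / D * exp ((real n)\<^sup>2 / real K ^ ?d)))\<^sup>2"
    by (simp add: power_mult_distrib power_divide)
  finally have "(\<Sum>\<epsilon>\<in>?E. measure (sample_law n (f1 \<epsilon>)) A)
     \<le> 2 ^ m * (2 * r0 / D * exp ((real n)\<^sup>2 / real K ^ ?d))"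
  proof (rule power2_le_imp_le)
    show "0 \<le> 2 ^ m * (2 * r0 / D * exp ((real n)\<^sup>2 / real K ^ ?d))"
      using r D0 by (intro mult_nonneg_nonneg divide_nonneg_pos) auto
  qed
  moreover have "2 ^ m * (1 - r1\<^sup>2 / (D / 2)\<^sup>2) \<le> (\<Sum>\<epsilon>\<in>?E. measure (sample_law n (f1 \<epsilon>)) A)"
    using sum_mono[of ?E "\<lambda>_. 1 - r1\<^sup>2 / (D / 2)\<^sup>2", OF pA1] by (simp add: cardE)
  ultimately have "2 ^ m * (1 - r1\<^sup>2 / (D / 2)\<^sup>2) \<le> 2 ^ m * (2 * r0 / D * exp ((real n)\<^sup>2 / real K ^ ?d))"
    by linarith
  then have "1 - r1\<^sup>2 / (D / 2)\<^sup>2 \<le> 2 * r0 / D * exp ((real n)\<^sup>2 / real K ^ ?d)"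
    by (rule mult_left_le_imp_le) simp
  then show ?thesis by (simp add: power_divide)
qed


section \<open>The rate of the isotropic classes, the choice of the grid size, and the impossibility
  of adaptation\<close>

section \<open>Rates and adaptation\<close>

text \<open>Integrability 2 makes the two sums in \<open>tau\<close> cancel at \<open>s = 2\<close>,
  so the first branch applies, and \<open>tau\<close> at 1 is \<open>1 + d / (2 * b)\<close>. Its
  reciprocal is at most \<open>1 / 2\<close> because \<open>2 * b \<le> d\<close>, hence it is the
  minimum.\<close>

lemma rate_exponent_iso_params:
  assumes b: "0 < b" "b \<le> 1 / 2"
  shows "rate_exponent (iso_params b :: ('d::finite) params) = iso_exponent TYPE('d) b"
proof -
  let ?\<theta> = "iso_params b :: 'd params" and ?d = "real CARD('d)"
  have "1 \<le> ?d" by (simp add: Suc_leI)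
  then have d: "2 * b \<le> ?d" using b by linarith
  have t2: "tau ?\<theta> 2 = 1"
    by (simp add: tau_def iso_params_def recip_2)
  have "tau ?\<theta> 1 = (2 * b + ?d) / (2 * b)"
    using b by (simp add: tau_def iso_params_def recip_2 recip_1 field_simps)
  then have "1 / tau ?\<theta> 1 = iso_exponent TYPE('d) b"
    by (simp add: iso_exponent_def)
  moreover have "iso_exponent TYPE('d) b \<le> 1 / 2"
    using b d by (simp add: iso_exponent_def field_simps)
  ultimately show ?thesis unfolding rate_exponent_def t2 by simp
qed

lemma ennreal_divide_le_iff:
  assumes "0 < p" "0 \<le> c"
  shows "x / ennreal p \<le> ennreal c \<longleftrightarrow> x \<le> ennreal (c * p)"
proof (cases x)
  case (real r)
  then show ?thesis using assms by (simp add: divide_ennreal pos_divide_le_eq)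
qed (use assms in \<open>simp add: ennreal_top_divide top_unique\<close>)

lemma ennreal_le_divide_iff:
  assumes "0 < p" "0 \<le> c"
  shows "ennreal c \<le> x / ennreal p \<longleftrightarrow> ennreal (c * p) \<le> x"
proof (cases x)
  case (real r)
  then show ?thesis using assms by (simp add: divide_ennreal pos_le_divide_eq)
qed (use assms in \<open>simp add: ennreal_top_divide\<close>)

text \<open>\<open>K ^ d\<close> is taken of order \<open>n^2 / g\<close>. The exponential is then
  at most \<open>exp g\<close>, while the gap between the norms gains the factor
  \<open>g powr (z / 2)\<close> over the minimax order. The power of 4 in \<open>E\<close> pays for
  rounding \<open>K\<close> to an even integer.\<close>

lemma two_class_bound_growth:
  fixes N :: "(nat \<Rightarrow> real ^ 'd) \<Rightarrow> real" and n :: nat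
  assumes N: "N \<in> estimators n" and n: "1 \<le> n" and g: "1 \<le> g" "g \<le> (real n)\<^sup>2"
    and b: "0 < b" "b \<le> 1 / 2" and b': "0 < b'" "b' \<le> 1 / 2" and r: "0 \<le> r0" "0 \<le> r1"
    and risk0: "risk n N (fclass (iso_params b')) \<le> ennreal r0"
    and risk1: "risk n N (fclass (iso_params b)) \<le> ennreal r1"
  defines "z \<equiv> iso_exponent TYPE('d) b"
  defines "E \<equiv> (sqrt 2 - 1) * 4 powr (- (real CARD('d) * z / 2)) * (real n powr (- z) * g powr (z / 2))"
  shows "1 \<le> 4 * r1\<^sup>2 / E\<^sup>2 + 2 * r0 / E * exp g"
proof -
  let ?d = "real CARD('d)"
  have d: "0 < ?d" by simp
  have z: "0 \<le> z" using b by (simp add: z_def iso_exponent_def)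
  \<comment> \<open>\<open>g \<le> n^2\<close> gives \<open>y \<ge> 1\<close>, so rounding up at
    most doubles \<open>y\<close>, and \<open>K = 2 * l\<close> lies between \<open>y\<close> and
    \<open>4 * y\<close>.\<close>
  define y where "y = ((real n)\<^sup>2 / g) powr (1 / ?d)"
  have q: "1 \<le> (real n)\<^sup>2 / g" using g by simp
  have y: "1 \<le> y" unfolding y_def using q by (intro ge_one_powr_ge_zero) auto
  have yd: "y powr ?d = (real n)\<^sup>2 / g"
    using q d g by (simp add: y_def powr_powr)
  define l where "l = nat \<lceil>y\<rceil>"
  have l: "y \<le> real l" "real l \<le> 2 * y" "1 \<le> l"
    using y by (auto simp: l_def) linarith+
  define K where "K = 2 * l"
  have K: "y \<le> real K" "real K \<le> 4 * y" using l y by (auto simp: K_def)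
  define D where "D = (sqrt 2 - 1) * real K powr (- (?d * z / 2))"
  have main: "1 \<le> 4 * r1\<^sup>2 / D\<^sup>2 + 2 * r0 / D * exp ((real n)\<^sup>2 / real K ^ CARD('d))"
    unfolding D_def K_def z_def by (rule two_class_bound[OF N l(3) b b' r risk0 risk1])
  have E0: "0 < E" using n g by (simp add: E_def)
  have ED: "E \<le> D"
  proof -
    have "4 powr (- (?d * z / 2)) * (real n powr (- z) * g powr (z / 2)) = (4 * y) powr (- (?d * z / 2))"
    proof -
      have "y powr (- (?d * z / 2)) = (y powr ?d) powr (- (z / 2))" by (simp add: powr_powr)
      also have "\<dots> = ((real n)\<^sup>2) powr (- (z / 2)) / g powr (- (z / 2))"
        unfolding yd using g by (simp add: powr_divide)
      also have "((real n)\<^sup>2) powr (- (z / 2)) = real n powr (- z)"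
        using n by (simp add: powr_powr flip: powr_numeral)
      finally have e1: "y powr (- (?d * z / 2)) = real n powr (- z) / g powr (- (z / 2))" .
      have "g powr (- (z / 2)) = inverse (g powr (z / 2))" by (rule powr_minus)
      then have e2: "w / g powr (- (z / 2)) = w * g powr (z / 2)" for w
        by (simp only: divide_inverse inverse_inverse_eq)
      define s where "s = - (?d * z / 2)"
      have e3: "(4 * y) powr s = 4 powr s * y powr s" using y by (simp add: powr_mult)
      show ?thesis unfolding e3[unfolded s_def] e1 e2 ..
    qed
    also have "\<dots> \<le> real K powr (- (?d * z / 2))"
      using K y z by (intro powr_mono2') auto
    finally show ?thesis
      unfolding E_def D_def by (simp add: mult.assoc mult_left_mono)
  qed
  have "(real n)\<^sup>2 / real K ^ CARD('d) \<le> g"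
  proof -
    have "(real n)\<^sup>2 / g \<le> real K ^ CARD('d)"
      unfolding yd[symmetric] using K y by (simp add: powr_realpow power_mono)
    then show ?thesis using g K y by (simp add: field_simps)
  qed
  then have e: "exp ((real n)\<^sup>2 / real K ^ CARD('d)) \<le> exp g" by simp
  have "4 * r1\<^sup>2 / D\<^sup>2 \<le> 4 * r1\<^sup>2 / E\<^sup>2"
    using E0 ED by (intro divide_left_mono power_mono mult_pos_pos) auto
  moreover have "2 * r0 / D * exp ((real n)\<^sup>2 / real K ^ CARD('d)) \<le> 2 * r0 / E * exp g"
    using E0 ED r by (intro mult_mono e divide_left_mono mult_pos_pos) auto
  ultimately show ?thesis using main by linarith
qed

text \<open>The case \<open>g = 1\<close> of \<open>two_class_bound_growth\<close>, with the same
  class in both roles.\<close>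

lemma minimax_lower_bound:
  assumes b: "0 < b" "b \<le> 1 / 2" and n: "1 \<le> n"
  defines "z \<equiv> iso_exponent TYPE('d::finite) b"
  shows "ennreal ((sqrt 2 - 1) * 4 powr (- (real CARD('d) * z / 2)) / 16 * real n powr (- z))
    \<le> minimax_risk n (fclass (iso_params b :: 'd params))"
  unfolding minimax_risk_def
proof (rule INF_greatest)
  fix N :: "(nat \<Rightarrow> real ^ 'd) \<Rightarrow> real" assume N: "N \<in> estimators n"
  define c where "c = (sqrt 2 - 1) * 4 powr (- (real CARD('d) * z / 2))"
  define x where "x = c * real n powr (- z)"
  have x: "0 < x" using n by (simp add: x_def c_def)
  show "ennreal ((sqrt 2 - 1) * 4 powr (- (real CARD('d) * z / 2)) / 16 * real n powr (- z))
    \<le> risk n N (fclass (iso_params b))"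
  proof (rule ccontr)
    assume "\<not> ?thesis"
    \<comment> \<open>With both risks at most \<open>x / 16\<close> the two terms become
      \<open>4 / 256\<close> and \<open>exp 1 / 8\<close>, whose sum is below 1.\<close>
    then have *: "risk n N (fclass (iso_params b)) \<le> ennreal (x / 16)"
      by (simp add: x_def c_def)
    have "1 \<le> (real n)\<^sup>2" using n by simp
    from two_class_bound_growth[OF N n order_refl this b b _ _ * *]
    have "1 \<le> 4 * (x / 16)\<^sup>2 / x\<^sup>2 + 2 * (x / 16) / x * exp 1"
      using x by (simp add: x_def c_def z_def)
    also have "\<dots> = 1 / 64 + exp 1 / 8" using x by (simp add: power_divide)
    also have "\<dots> < 1" using exp_le by simp
    finally show False by simp
  qed
qed

text \<open>The root of \<open>pair_stat\<close> is the attaining estimator and also bounds the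
  minimax risk from above. Its risk bound holds from \<open>n = 2\<close> on, which is enough for
  the limits.\<close>

lemma has_minimax_rate_iso:
  assumes b: "0 < b" "b \<le> 1 / 2"
  shows "has_minimax_rate (fclass (iso_params b :: ('d::finite) params)) (rate (iso_params b :: 'd params))"
proof -
  let ?\<theta> = "iso_params b :: 'd params"
  define z where "z = iso_exponent TYPE('d) b"
  have rate: "rate ?\<theta> n = real n powr (- z)" for n
    unfolding rate_def rate_exponent_iso_params[OF b] z_def ..
  define h where "h = (\<lambda>n. real n powr (- 2 / (2 * b + real CARD('d))))"
  define N :: "nat \<Rightarrow> (nat \<Rightarrow> real ^ 'd) \<Rightarrow> real" where "N = (\<lambda>n X. sqrt (pair_stat n (h n) X))"
  have N: "N n \<in> estimators n" for n unfolding N_def by (rule pair_stat_measurable)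
  define C where "C = sqrt (216 * 4 ^ CARD('d) + 21)"
  have C: "0 \<le> C" by (simp add: C_def)
  have up: "risk n (N n) (fclass ?\<theta>) / ennreal (rate ?\<theta> n) \<le> ennreal C" if "2 \<le> n" for n
    using that pair_stat_risk[OF b that, where 'd = 'd] C
    by (simp add: ennreal_divide_le_iff rate C_def N_def h_def z_def)
  have up_ev: "\<forall>\<^sub>F n in sequentially. risk n (N n) (fclass ?\<theta>) / ennreal (rate ?\<theta> n) \<le> ennreal C"
    by (rule eventually_sequentiallyI[of 2]) (rule up)
  then have "limsup (\<lambda>n. risk n (N n) (fclass ?\<theta>) / ennreal (rate ?\<theta> n)) \<le> ennreal C"
    by (rule Limsup_bounded)
  then have 1: "limsup (\<lambda>n. risk n (N n) (fclass ?\<theta>) / ennreal (rate ?\<theta> n)) < \<infinity>"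
    by (rule le_less_trans) simp
  have "minimax_risk n (fclass ?\<theta>) / ennreal (rate ?\<theta> n) \<le> risk n (N n) (fclass ?\<theta>) / ennreal (rate ?\<theta> n)" for n
    unfolding minimax_risk_def by (intro divide_right_mono_ennreal INF_lower N)
  with up_ev have "\<forall>\<^sub>F n in sequentially. minimax_risk n (fclass ?\<theta>) / ennreal (rate ?\<theta> n) \<le> ennreal C"
    by (auto elim!: eventually_mono intro: order_trans)
  then have "limsup (\<lambda>n. minimax_risk n (fclass ?\<theta>) / ennreal (rate ?\<theta> n)) \<le> ennreal C"
    by (rule Limsup_bounded)
  then have 2: "limsup (\<lambda>n. minimax_risk n (fclass ?\<theta>) / ennreal (rate ?\<theta> n)) < \<infinity>"
    by (rule le_less_trans) simp
  define c where "c = (sqrt 2 - 1) * 4 powr (- (real CARD('d) * z / 2)) / 16"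
  have c: "0 < c" by (simp add: c_def)
  have "ennreal c \<le> minimax_risk n (fclass ?\<theta>) / ennreal (rate ?\<theta> n)" if "1 \<le> n" for n
    using that minimax_lower_bound[OF b that, where 'd = 'd] c
    by (subst ennreal_le_divide_iff) (auto simp: rate c_def z_def)
  then have le: "ennreal c \<le> liminf (\<lambda>n. minimax_risk n (fclass ?\<theta>) / ennreal (rate ?\<theta> n))"
    by (intro Liminf_bounded eventually_sequentiallyI[of 1])
  have "0 < ennreal c" using c by simp
  from this le have 3: "0 < liminf (\<lambda>n. minimax_risk n (fclass ?\<theta>) / ennreal (rate ?\<theta> n))"
    by (rule less_le_trans)
  show ?thesis unfolding has_minimax_rate_def by (intro conjI exI[of _ N] allI 1 2 3 N)
qed

text \<open>With \<open>g = \<kappa> * ln n\<close> the first term of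
  \<open>two_class_bound_growth\<close> decays like \<open>ln n powr (- z)\<close> and the second at
  least as fast as \<open>n powr (- \<kappa>)\<close>, so their sum falls below 1. The threshold in
  \<open>n\<close> is uniform over \<open>N\<close>, as the infimum over estimators demands.\<close>

lemma adaptation_lower_bound:
  assumes b: "0 < b" "b < b'" "b' \<le> 1 / 2" and M: "0 < M"
  shows "\<forall>\<^sub>F n in sequentially. \<forall>N :: (nat \<Rightarrow> real ^ 'd) \<Rightarrow> real. N \<in> estimators n \<longrightarrow>
    \<not> (risk n N (fclass (iso_params b')) \<le> ennreal (M * real n powr (- iso_exponent TYPE('d) b'))
       \<and> risk n N (fclass (iso_params b)) \<le> ennreal (M * real n powr (- iso_exponent TYPE('d) b)))"
proof -
  define z where "z = iso_exponent TYPE('d) b"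
  define z' where "z' = iso_exponent TYPE('d) b'"
  have d: "0 < real CARD('d)" by simp
  have z: "0 < z" using b by (simp add: z_def iso_exponent_def add_pos_pos)
  have "2 * b * (2 * b' + real CARD('d)) < 2 * b' * (2 * b + real CARD('d))"
    using b d by (simp add: algebra_simps)
  then have zz: "z < z'"
    using b d unfolding z_def z'_def iso_exponent_def
    by (simp add: divide_less_eq less_divide_eq add_pos_pos mult.commute mult.left_commute)
  \<comment> \<open>Half of the gap between the exponents: \<open>exp g = n powr \<kappa>\<close>
    consumes only half of the factor \<open>n powr (z - z')\<close> gained on the smoother
    class.\<close>
  define \<kappa> where "\<kappa> = (z' - z) / 2"
  have \<kappa>: "0 < \<kappa>" using zz by (simp add: \<kappa>_def)
  define c where "c = (sqrt 2 - 1) * 4 powr (- (real CARD('d) * z / 2))"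
  have c: "0 < c" by (simp add: c_def)
  have "(\<lambda>n. 4 * M\<^sup>2 / (c\<^sup>2 * (\<kappa> * ln (real n)) powr z) + 2 * M / c * real n powr (- \<kappa>)) \<longlonglongrightarrow> 0"
    using z \<kappa> c by real_asymp
  then have ev1: "\<forall>\<^sub>F n in sequentially. 4 * M\<^sup>2 / (c\<^sup>2 * (\<kappa> * ln (real n)) powr z) + 2 * M / c * real n powr (- \<kappa>) < 1"
    by (rule order_tendstoD) simp
  have ev2: "\<forall>\<^sub>F n in sequentially. 1 \<le> \<kappa> * ln (real n)"
    using \<kappa> by real_asymp
  have ev3: "\<forall>\<^sub>F n in sequentially. \<kappa> * ln (real n) \<le> (real n)\<^sup>2"
    using \<kappa> by real_asymp
  show ?thesis
    using ev1 ev2 ev3 eventually_ge_at_top[of 1]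
  proof eventually_elim
    case (elim n)
    show ?case
    proof (intro allI impI notI)
      fix N :: "(nat \<Rightarrow> real ^ 'd) \<Rightarrow> real" assume N: "N \<in> estimators n"
      assume *: "risk n N (fclass (iso_params b')) \<le> ennreal (M * real n powr (- iso_exponent TYPE('d) b'))
         \<and> risk n N (fclass (iso_params b)) \<le> ennreal (M * real n powr (- iso_exponent TYPE('d) b))"
      define g where "g = \<kappa> * ln (real n)"
      define E where "E = c * (real n powr (- z) * g powr (z / 2))"
      have n: "0 < real n" and g: "1 \<le> g" using elim by (auto simp: g_def)
      have "1 \<le> 4 * (M * real n powr (- z))\<^sup>2 / E\<^sup>2 + 2 * (M * real n powr (- z')) / E * exp g"
        unfolding E_def c_def z_def z'_def g_def
        using elim b M * by (intro two_class_bound_growth[OF N]) auto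
      also have "4 * (M * real n powr (- z))\<^sup>2 / E\<^sup>2 = 4 * M\<^sup>2 / (c\<^sup>2 * g powr z)"
        using n c g unfolding E_def by (simp add: power_mult_distrib powr_square)
      also have "2 * (M * real n powr (- z')) / E * exp g
         = 2 * M / c * (real n powr (- z') * real n powr z * real n powr \<kappa>) / g powr (z / 2)"
      proof -
        have "exp g = real n powr \<kappa>" using n by (simp add: g_def powr_def)
        then show ?thesis using n c g unfolding E_def by (simp add: powr_minus field_simps)
      qed
      also have "real n powr (- z') * real n powr z * real n powr \<kappa> = real n powr (- \<kappa>)"
      proof -
        have e: "- z' + z + \<kappa> = - \<kappa>" by (simp add: \<kappa>_def field_simps)
        show ?thesis unfolding powr_add[symmetric] e ..
      qed
      also have "2 * M / c * real n powr (- \<kappa>) / g powr (z / 2) \<le> 2 * M / c * real n powr (- \<kappa>) / 1"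
        using M c g z by (intro divide_left_mono ge_one_powr_ge_zero) auto
      finally have "1 \<le> 4 * M\<^sup>2 / (c\<^sup>2 * g powr z) + 2 * M / c * real n powr (- \<kappa>)" by simp
      then show False using elim by (simp add: g_def)
    qed
  qed
qed

theorem theorem1:
  shows "\<exists>\<theta>1 \<in> (Theta :: ('d::finite) params set). \<exists>\<theta>2 \<in> (Theta :: 'd params set).
     has_minimax_rate (fclass \<theta>1) (rate \<theta>1) \<and>
     has_minimax_rate (fclass \<theta>2) (rate \<theta>2) \<and>
     liminf (\<lambda>n. INF N \<in> estimators n.
        SUP \<theta> \<in> {\<theta>1, \<theta>2}. risk n N (fclass \<theta>) / ennreal (rate \<theta> n)) = \<infinity>"
proof -
  let ?\<theta>1 = "iso_params (1 / 2) :: 'd params" and ?\<theta>2 = "iso_params (1 / 4) :: 'd params"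
  let ?R = "\<lambda>n. INF N \<in> estimators n. SUP \<theta> \<in> {?\<theta>1, ?\<theta>2}. risk n N (fclass \<theta>) / ennreal (rate \<theta> n)"
  have Theta: "iso_params b \<in> (Theta :: 'd params set)" if "0 < b" for b
    using that by (simp add: Theta_def iso_params_def)
  have rate: "rate (iso_params b :: 'd params) n = real n powr (- iso_exponent TYPE('d) b)"
    if "0 < b" "b \<le> 1 / 2" for b n
    unfolding rate_def rate_exponent_iso_params[OF that] ..
  \<comment> \<open>For every \<open>M\<close>, no estimator keeps both normalised risks at or below
    \<open>M\<close> once \<open>n\<close> is large. The liminf therefore exceeds every real
    number.\<close>
  have big: "ennreal M \<le> liminf ?R" if M: "0 < M" for M
  proof (rule Liminf_bounded)
    have "(0::real) < 1 / 4" "(1 / 4 :: real) < 1 / 2" "(1 / 2 :: real) \<le> 1 / 2" by simp_all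
    from adaptation_lower_bound[OF this M, where 'd = 'd] eventually_ge_at_top[of 1]
    show "\<forall>\<^sub>F n in sequentially. ennreal M \<le> ?R n"
    proof eventually_elim
      case (elim n)
      show ?case
      proof (rule INF_greatest)
        fix N :: "(nat \<Rightarrow> real ^ 'd) \<Rightarrow> real" assume N: "N \<in> estimators n"
        show "ennreal M \<le> (SUP \<theta> \<in> {?\<theta>1, ?\<theta>2}. risk n N (fclass \<theta>) / ennreal (rate \<theta> n))"
        proof (rule ccontr)
          assume "\<not> ?thesis"
          then have "risk n N (fclass \<theta>) / ennreal (rate \<theta> n) \<le> ennreal M" if "\<theta> \<in> {?\<theta>1, ?\<theta>2}" for \<theta>
            using that by (meson SUP_upper le_less_trans less_imp_le not_le)
          from this[of ?\<theta>1] this[of ?\<theta>2]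
          have "risk n N (fclass ?\<theta>1) \<le> ennreal (M * real n powr (- iso_exponent TYPE('d) (1 / 2)))
             \<and> risk n N (fclass ?\<theta>2) \<le> ennreal (M * real n powr (- iso_exponent TYPE('d) (1 / 4)))"
            using elim M by (simp add: rate ennreal_divide_le_iff)
          then show False using elim N by blast
        qed
      qed
    qed
  qed
  have "liminf ?R = \<infinity>"
  proof (cases "liminf ?R")
    case (real r)
    then show ?thesis using big[of "r + 1"] by simp
  qed simp
  then show ?thesis
    using Theta has_minimax_rate_iso[where 'd = 'd] by (intro bexI[of _ ?\<theta>1] bexI[of _ ?\<theta>2] conjI) auto
qed

end
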